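(* Let $p\in(0,1)$ and let $\mu^p$ be the biased Brownian separable permuton of parameter $p$. Almost surely, the support of $\mu^p$ is totally disconnected, and its Hausdorff dimension is $1$, with one-dimensional Hausdorff measure bounded above by $\sqrt2$.
   Context: A permuton is a probability measure on $[0,1]^2$ with both marginals uniform on $[0,1]$ (the set of permutons carries the weak topology). For distinct reals $x_1,\dots,x_k$, $\mathrm{rank}(x_1,\dots,x_k)$ is the permutation $\alpha$ of $\{1,\dots,k\}$ with $\alpha(i)<\alpha(j)\iff x_i<x_j$. For a random permuton $\mu$, $\mathrm{subperm}_k(\mu)=\mathrm{rank}(Y_1,\dots,Y_k)\circ \mathrm{rank}(X_1,\dots,X_k)^{-1}$, where conditionally on $\mu$ the $(X_i,Y_i)$, $1\le i\le k$, are independent with law $\mu$. The law of a random permuton is determined by the laws of $\mathrm{subperm}_k(\mu)$, $k\ge1$. For a rooted plane tree $t$ with leaves labeled $1,\dots,k$ in left-to-right order and internal nodes decorated with signs in $\{\oplus,\ominus\}$, let $\tilde t$ be obtained by reversing the order of the children of every node with sign $\ominus$; $\mathrm{perm}(t)$ is the permutation $\sigma$ with $\sigma(i)$ the position in $\tilde t$ of leaf $i$. The biased Brownian separable permuton $\mu^p$ is the random permuton whose law is determined by $\mathrm{subperm}_k(\mu^p)\stackrel d=\mathrm{perm}(t_{k,p})$ for all $k\ge1$, where $t_{k,p}$ is a uniform rooted plane binary tree with $k$ leaves whose internal nodes carry i.i.d. signs, $\oplus$ with probability $p$ and $\ominus$ with probability $1-p$. The one-dimensional Hausdorff measure is taken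 with the Euclidean metric and normalized by sums of diameters of covering sets. *)

theory Defs
  imports "HOL-Probability.Probability"
begin

section \<open>Support, total disconnectedness, Hausdorff measure and dimension\<close>

definition measure_support :: "'a::topological_space measure \<Rightarrow> 'a set" where
  "measure_support \<nu> = {x. \<forall>U. open U \<and> x \<in> U \<longrightarrow> emeasure \<nu> U > 0}"

definition totally_disconnected :: "'a::topological_space set \<Rightarrow> bool" where
  "totally_disconnected S \<longleftrightarrow> (\<forall>x\<in>S. connected_component_set S x = {x})"

text \<open>The \<open>s\<close>-th power of the diameter, with the convention \<open>0\<^sup>0 = 1\<close> for nonempty sets,
  so that the zero-dimensional measure is counting measure; \<open>powr\<close> alone would give
  \<open>0 powr 0 = 0\<close>.\<close>

definition diam_powr :: "real \<Rightarrow> 'a::metric_space set \<Rightarrow> ennreal" where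
  "diam_powr s U =
     (if U = {} then 0 else if s = 0 then 1 else ennreal (diameter U powr s))"

text \<open>Finite covers are included, since members of a cover may be empty.  Boundedness is
  required because \<^const>\<open>diameter\<close> is not meaningful on unbounded sets.\<close>

definition hausdorff_premeasure :: "real \<Rightarrow> real \<Rightarrow> 'a::metric_space set \<Rightarrow> ennreal" where
  "hausdorff_premeasure s \<delta> A =
     (INF U \<in> {U :: nat \<Rightarrow> 'a set. A \<subseteq> (\<Union>n. U n) \<and> (\<forall>n. bounded (U n) \<and> diameter (U n) \<le> \<delta>)}.
        \<Sum>n. diam_powr s (U n))"

definition hausdorff_measure :: "real \<Rightarrow> 'a::metric_space set \<Rightarrow> ennreal" where
  "hausdorff_measure s A = (SUP \<delta>\<in>{0<..}. hausdorff_premeasure s \<delta> A)"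

definition hausdorff_dim :: "'a::metric_space set \<Rightarrow> ennreal" where
  "hausdorff_dim A = (INF s\<in>{s. 0 \<le> s \<and> hausdorff_measure s A = 0}. ennreal s)"


section \<open>Permutons\<close>

text \<open>A probability measure on the unit square is represented by the Borel measure on the
  plane that it induces.\<close>

definition permutons :: "(real \<times> real) measure set" where
  "permutons = {\<nu>. sets \<nu> = sets borel \<and> prob_space \<nu> \<and> (AE z in \<nu>. z \<in> {0..1} \<times> {0..1}) \<and>
     distr \<nu> borel fst = uniform_measure lborel {0..1} \<and>
     distr \<nu> borel snd = uniform_measure lborel {0..1}}"

text \<open>The weak topology is the coarsest one for which \<open>\<nu> \<mapsto> \<integral> f d\<nu>\<close> is continuous for every
  bounded continuous \<open>f\<close>; a random permuton is a random element for its Borel sets.\<close>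

definition weak_permuton_topology :: "(real \<times> real) measure topology" where
  "weak_permuton_topology = topology_generated_by
     {{\<nu> \<in> permutons. (LINT z|\<nu>. f z) \<in> V} | (f :: real \<times> real \<Rightarrow> real) V.
        continuous_on UNIV f \<and> bounded (range f) \<and> open V}"

definition permuton_space :: "(real \<times> real) measure measure" where
  "permuton_space = sigma permutons {S. openin weak_permuton_topology S}"

definition random_permuton :: "'w measure \<Rightarrow> ('w \<Rightarrow> (real \<times> real) measure) \<Rightarrow> bool" where
  "random_permuton M \<mu> \<longleftrightarrow> prob_space M \<and> \<mu> \<in> measurable M permuton_space"

text \<open>Permutations of \<open>{1..k}\<close> are functions on \<^typ>\<open>nat\<close> that fix everything outside
  \<open>{1..k}\<close>.  The value of \<open>rank_perm\<close> is meaningful only if the \<open>x i\<close> are distinct, which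
  holds almost surely for the coordinates of points sampled from a permuton.\<close>

definition rank_perm :: "nat \<Rightarrow> (nat \<Rightarrow> real) \<Rightarrow> nat \<Rightarrow> nat" where
  "rank_perm k x = (THE \<alpha>. \<alpha> permutes {1..k} \<and>
     (\<forall>i\<in>{1..k}. \<forall>j\<in>{1..k}. \<alpha> i < \<alpha> j \<longleftrightarrow> x i < x j))"

definition points_perm :: "nat \<Rightarrow> (nat \<Rightarrow> real \<times> real) \<Rightarrow> nat \<Rightarrow> nat" where
  "points_perm k z = rank_perm k (\<lambda>i. snd (z i)) \<circ> inv (rank_perm k (\<lambda>i. fst (z i)))"

text \<open>The law of the permutation \<open>subperm\<^sub>k(\<mu>)\<close>: given \<open>\<omega>\<close>, the \<open>k\<close> points are sampled
  independently with law \<open>\<mu> \<omega>\<close>, and \<open>\<omega>\<close> is averaged out.\<close>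

definition subperm_law ::
    "'w measure \<Rightarrow> ('w \<Rightarrow> (real \<times> real) measure) \<Rightarrow> nat \<Rightarrow> (nat \<Rightarrow> nat) measure" where
  "subperm_law M \<mu> k =
     distr (M \<bind> (\<lambda>\<omega>. \<Pi>\<^sub>M i\<in>{1..k}. \<mu> \<omega>)) (count_space UNIV) (points_perm k)"


section \<open>Signed trees and separable permutations\<close>

datatype sign = Plus | Minus

text \<open>Rooted plane trees with leaf labels in \<open>'l\<close> and internal nodes decorated by \<open>'n\<close>.\<close>

datatype ('l, 'n) plane_tree = Leaf 'l | Node 'n "('l, 'n) plane_tree list"

fun leaves :: "('l, 'n) plane_tree \<Rightarrow> 'l list" where
  "leaves (Leaf a) = [a]"
| "leaves (Node _ ts) = concat (map leaves ts)"

fun reverse_minus :: "('l, sign) plane_tree \<Rightarrow> ('l, sign) plane_tree" where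
  "reverse_minus (Leaf a) = Leaf a"
| "reverse_minus (Node Plus ts) = Node Plus (map reverse_minus ts)"
| "reverse_minus (Node Minus ts) = Node Minus (rev (map reverse_minus ts))"

text \<open>The position is counted from \<open>1\<close>, whereas list indices start at \<open>0\<close>.\<close>

definition tree_perm :: "(nat, sign) plane_tree \<Rightarrow> nat \<Rightarrow> nat" where
  "tree_perm t i = (if i \<in> set (leaves t)
     then Suc (THE j. j < length (leaves (reverse_minus t)) \<and> leaves (reverse_minus t) ! j = i) else i)"

fun binary_tree :: "('l, 'n) plane_tree \<Rightarrow> bool" where
  "binary_tree (Leaf _) \<longleftrightarrow> True"
| "binary_tree (Node _ ts) \<longleftrightarrow> length ts = 2 \<and> (\<forall>t\<in>set ts. binary_tree t)"

definition binary_trees :: "nat \<Rightarrow> (nat, unit) plane_tree set" where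
  "binary_trees k = {t. binary_tree t \<and> leaves t = [1..<Suc k]}"

primrec sequence_pmf :: "'a pmf list \<Rightarrow> 'a list pmf" where
  "sequence_pmf [] = return_pmf []"
| "sequence_pmf (q # qs) =
     bind_pmf q (\<lambda>x. bind_pmf (sequence_pmf qs) (\<lambda>xs. return_pmf (x # xs)))"

definition sign_pmf :: "real \<Rightarrow> sign pmf" where
  "sign_pmf p = map_pmf (\<lambda>b. if b then Plus else Minus) (bernoulli_pmf p)"

fun random_signs :: "real \<Rightarrow> ('l, unit) plane_tree \<Rightarrow> ('l, sign) plane_tree pmf" where
  "random_signs p (Leaf a) = return_pmf (Leaf a)"
| "random_signs p (Node _ ts) =
     bind_pmf (sign_pmf p) (\<lambda>s.
     bind_pmf (sequence_pmf (map (random_signs p) ts)) (\<lambda>ts'.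
     return_pmf (Node s ts')))"

text \<open>\<^const>\<open>pmf_of_set\<close> is meaningful here because \<open>binary_trees k\<close> is finite and, for
  \<open>k \<ge> 1\<close>, nonempty; see below.\<close>

definition random_signed_tree :: "nat \<Rightarrow> real \<Rightarrow> (nat, sign) plane_tree pmf" where
  "random_signed_tree k p = bind_pmf (pmf_of_set (binary_trees k)) (random_signs p)"

lemma leaves_binary_nonempty: "binary_tree t \<Longrightarrow> leaves t \<noteq> []"
proof (induction t)
  case (Node n ts)
  then obtain t1 t2 where "ts = [t1, t2]"
    by (auto simp: numeral_2_eq_2 length_Suc_conv)
  with Node show ?case by auto
qed simp

lemma finite_binary_trees_with_leaves:
  "finite {t :: ('l, unit) plane_tree. binary_tree t \<and> leaves t = xs}"
proof (induction "length xs" arbitrary: xs rule: less_induct)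
  case less
  define A where "A = (\<lambda>ys :: 'l list. {t :: ('l, unit) plane_tree. binary_tree t \<and> leaves t = ys})"
  define L where "L = {ys. length ys < length xs \<and> set ys \<subseteq> set xs}"
  have finL: "finite L"
  proof (rule finite_subset)
    show "L \<subseteq> {ys. set ys \<subseteq> set xs \<and> length ys \<le> length xs}"
      by (auto simp: L_def)
    show "finite {ys. set ys \<subseteq> set xs \<and> length ys \<le> length xs}"
      by (rule finite_lists_length_le) simp
  qed
  have fin: "finite (\<Union>ys\<in>L. A ys)"
  proof (rule finite_UN_I[OF finL])
    fix ys assume "ys \<in> L"
    then show "finite (A ys)" unfolding A_def by (intro less) (simp add: L_def)
  qed
  have "A xs \<subseteq> Leaf ` set xs \<union> (\<lambda>(t1, t2). Node () [t1, t2]) ` ((\<Union>ys\<in>L. A ys) \<times> (\<Union>ys\<in>L. A ys))"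
  proof
    fix t assume t: "t \<in> A xs"
    show "t \<in> Leaf ` set xs \<union> (\<lambda>(t1, t2). Node () [t1, t2]) ` ((\<Union>ys\<in>L. A ys) \<times> (\<Union>ys\<in>L. A ys))"
    proof (cases t)
      case (Leaf a)
      then show ?thesis using t by (auto simp: A_def)
    next
      case (Node n ts)
      then obtain t1 t2 where ts: "ts = [t1, t2]"
        using t by (auto simp: A_def numeral_2_eq_2 length_Suc_conv)
      have b: "binary_tree t1" "binary_tree t2" and xs: "xs = leaves t1 @ leaves t2"
        using t Node ts by (auto simp: A_def)
      have "leaves t1 \<in> L" "leaves t2 \<in> L"
        using leaves_binary_nonempty[OF b(1)] leaves_binary_nonempty[OF b(2)]
        by (auto simp: L_def xs)
      then have "(t1, t2) \<in> (\<Union>ys\<in>L. A ys) \<times> (\<Union>ys\<in>L. A ys)"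
        using b by (auto simp: A_def)
      then show ?thesis using Node ts by force
    qed
  qed
  then have "finite (A xs)" by (rule finite_subset) (use fin in simp)
  then show ?case by (simp add: A_def)
qed

lemma finite_binary_trees: "finite (binary_trees k)"
  unfolding binary_trees_def by (rule finite_binary_trees_with_leaves)

lemma binary_trees_nonempty:
  assumes "k \<ge> 1"
  shows "binary_trees k \<noteq> {}"
proof -
  have "\<exists>t :: (nat, unit) plane_tree. binary_tree t \<and> leaves t = [1..<Suc k]"
    using assms
  proof (induction k rule: dec_induct)
    case base
    show ?case by (rule exI[of _ "Leaf 1"]) simp
  next
    case (step n)
    then obtain t :: "(nat, unit) plane_tree" where "binary_tree t" "leaves t = [1..<Suc n]" by blast
    then show ?case
      by (intro exI[of _ "Node () [t, Leaf (Suc n)]"]) simp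
  qed
  then show ?thesis by (auto simp: binary_trees_def)
qed


section \<open>The biased Brownian separable permuton\<close>

text \<open>The law of the permuton is determined by the laws of its subpermutations, so \<open>\<mu>\<close>
  is allowed to be any realisation of it, on any probability space.\<close>

definition brownian_separable_permuton ::
    "real \<Rightarrow> 'w measure \<Rightarrow> ('w \<Rightarrow> (real \<times> real) measure) \<Rightarrow> bool" where
  "brownian_separable_permuton p M \<mu> \<longleftrightarrow> random_permuton M \<mu> \<and>
     (\<forall>k\<ge>1. subperm_law M \<mu> k = measure_pmf (map_pmf tree_perm (random_signed_tree k p)))"

end

theory Submission
  imports Defs
begin

text \<open>
  Only the laws of the sampled permutations are used.  In a uniform binary tree with \<open>k\<close> leaves,
  call maximal a subtree with fewer than \<open>m = \<theta>k\<close> leaves whose parent has at least \<open>m\<close>.  The leaves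
  in maximal subtrees of size below \<open>s = \<eta>k\<close> are on average a small proportion if \<open>\<eta>\<close> is much
  smaller than \<open>\<theta>\<close>.  Every other maximal subtree occupies a square block of the permutation, and
  the remaining points lie in boundedly many rectangles of small total size.  Hence the permutation,
  and in the limit the support, is covered by boundedly many small boxes whose diagonals add up to
  at most \<open>sqrt 2 + \<epsilon>\<close>.  This gives the bound on the Hausdorff measure; the lower bound on the
  dimension comes from projecting to a coordinate axis.

  The same covers show that almost every vertical and horizontal line meets the support in a single
  point, so quadrants with corners at typical coordinates are clopen in the support.
  If a connected subset of the support had two points, then over some interval it would contain all
  typical points, and the clopen quadrants would force these points to be monotone.  But the ascents
  of the random permutation are independent with parameter \<open>p\<close>, so it has no monotone runs of
  linear length.
\<close>

text \<open>The number of boxes must be bounded independently of \<open>k\<close>: a support point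
  is only known to lie within some distance \<open>r\<close> of a scaled permutation point, so every
  box is enlarged, at a cost of order \<open>r\<close> per box. Covering the small subtrees one by
  one would need too many boxes; collecting them in corner rectangles avoids this. Their mean share
  of the leaves is governed by the partial sums of i catalan(i) / 4^i, which grow like the square
  root, so the part below \<open>s\<close> is a fraction of order sqrt(s / m) of the part below
  \<open>m\<close>.

  The constant sqrt 2, the diagonal of a unit square, is used twice. Besides bounding the Hausdorff
  measure it is extremal: boxes covering a set that projects onto both unit intervals have widths
  and heights summing to at least 2, hence diagonals summing to at least sqrt 2. A cover almost
  attaining this has little overlap in either projection, whence the singleton fibres.

  Almost sure statements come from bounds in mean alone: Markov's inequality limits the event that a
  sample probability stays on the wrong side of 1/2 for all large \<open>k\<close>, and off that
  event the conclusion is deterministic.\<close>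

section \<open>Covers by boxes\<close>

text \<open>The bound \<open>n\<close> controls the cost of enlarging all boxes, \<open>c\<close>
  the one-dimensional Hausdorff sum, and \<open>d\<close> the fineness. A pair is charged
  \<open>dist u v\<close> even if its box is empty, so that the cost scales under similarities
  without case distinctions.\<close>

definition box_cover :: "nat \<Rightarrow> real \<Rightarrow> real \<Rightarrow> (real \<times> real) set \<Rightarrow> bool" where
  "box_cover n c d S \<longleftrightarrow> (\<exists>R. length R \<le> n \<and> (\<Sum>(u, v)\<leftarrow>R. dist u v) \<le> c \<and>
     (\<forall>(u, v)\<in>set R. dist u v \<le> d) \<and> S \<subseteq> (\<Union>(u, v)\<in>set R. cbox u v))"

lemma box_cover_mono:
  assumes "box_cover n c d S" "n \<le> n'" "c \<le> c'" "d \<le> d'" "S' \<subseteq> S"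
  shows "box_cover n' c' d' S'"
proof -
  obtain R where R: "length R \<le> n" "(\<Sum>(u, v)\<leftarrow>R. dist u v) \<le> c"
    "\<forall>(u, v)\<in>set R. dist u v \<le> d" "S \<subseteq> (\<Union>(u, v)\<in>set R. cbox u v)"
    using assms(1) unfolding box_cover_def by blast
  show ?thesis unfolding box_cover_def
    by (rule exI[of _ R]) (use R assms in force)
qed

lemma box_cover_Un:
  assumes "box_cover n c d S" "box_cover n' c' d S'"
  shows "box_cover (n + n') (c + c') d (S \<union> S')"
proof -
  obtain R where R: "length R \<le> n" "(\<Sum>(u, v)\<leftarrow>R. dist u v) \<le> c"
    "\<forall>(u, v)\<in>set R. dist u v \<le> d" "S \<subseteq> (\<Union>(u, v)\<in>set R. cbox u v)"
    using assms(1) unfolding box_cover_def by blast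
  obtain R' where R': "length R' \<le> n'" "(\<Sum>(u, v)\<leftarrow>R'. dist u v) \<le> c'"
    "\<forall>(u, v)\<in>set R'. dist u v \<le> d" "S' \<subseteq> (\<Union>(u, v)\<in>set R'. cbox u v)"
    using assms(2) unfolding box_cover_def by blast
  show ?thesis unfolding box_cover_def
    by (rule exI[of _ "R @ R'"]) (use R R' in auto)
qed

lemma box_cover_image:
  assumes "box_cover n c d S" "0 \<le> a"
    and f: "\<And>u v. f ` cbox u v \<subseteq> cbox (f u) (f v)"
    and d: "\<And>u v. dist (f u) (f v) = a * dist u v"
  shows "box_cover n (a * c) (a * d) (f ` S)"
proof -
  obtain R where R: "length R \<le> n" "(\<Sum>(u, v)\<leftarrow>R. dist u v) \<le> c"
    "\<forall>(u, v)\<in>set R. dist u v \<le> d" "S \<subseteq> (\<Union>(u, v)\<in>set R. cbox u v)"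
    using assms(1) unfolding box_cover_def by blast
  have "(\<Sum>(u, v)\<leftarrow>map (map_prod f f) R. dist u v) = a * (\<Sum>(u, v)\<leftarrow>R. dist u v)"
    by (simp add: case_prod_unfold comp_def d sum_list_const_mult)
  moreover have "\<forall>(u, v)\<in>set (map (map_prod f f) R). dist u v \<le> a * d"
  proof -
    have "dist (f u) (f v) \<le> a * d" if "(u, v) \<in> set R" for u v
      unfolding d using R(3) that \<open>0 \<le> a\<close> by (intro mult_left_mono) auto
    then show ?thesis by (auto simp: map_prod_def)
  qed
  moreover have "f ` S \<subseteq> (\<Union>(u, v)\<in>set (map (map_prod f f) R). cbox u v)"
  proof
    fix y assume "y \<in> f ` S"
    then obtain x where x: "x \<in> S" "y = f x" by blast
    then obtain u v where uv: "(u, v) \<in> set R" "x \<in> cbox u v" using R(4) by auto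
    then have "y \<in> cbox (f u) (f v)" using f x(2) by blast
    then show "y \<in> (\<Union>(u, v)\<in>set (map (map_prod f f) R). cbox u v)"
      using uv(1) by (auto intro!: bexI[of _ "(u, v)"])
  qed
  ultimately show ?thesis unfolding box_cover_def
    by (intro exI[of _ "map (map_prod f f) R"]) (use R(1) mult_left_mono[OF R(2) \<open>0 \<le> a\<close>] in auto)
qed

lemma box_cover_translation:
  assumes "box_cover n c d S"
  shows "box_cover n c d ((+) w ` S)"
  using box_cover_image[OF assms, of 1 "(+) w"] by (simp add: cbox_translation)

lemma box_cover_scale:
  assumes "box_cover n c d S" "0 \<le> a"
  shows "box_cover n (a * c) (a * d) ((*\<^sub>R) a ` S)"
proof (rule box_cover_image[OF assms])
  show "(*\<^sub>R) a ` cbox u v \<subseteq> cbox (a *\<^sub>R u) (a *\<^sub>R v)" for u v :: "real \<times> real"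
    using \<open>0 \<le> a\<close> by (cases u; cases v) (auto simp: cbox_Pair_eq intro: mult_left_mono)
  show "dist (a *\<^sub>R u) (a *\<^sub>R v) = a * dist u v" for u v :: "real \<times> real"
    using \<open>0 \<le> a\<close> by (simp add: dist_norm flip: scaleR_diff_right)
qed

lemma box_cover_cbox: "dist u v \<le> d \<Longrightarrow> box_cover 1 (dist u v) d (cbox u v)"
  unfolding box_cover_def by (rule exI[of _ "[(u, v)]"]) simp

lemma dist_Pair_le: "dist (a, b) (c, d) \<le> \<bar>a - c\<bar> + \<bar>b - d\<bar>" for a b c d :: real
  by (simp add: dist_Pair_Pair dist_real_def sqrt_sum_squares_le_sum_abs)

text \<open>Half the perimeter exceeds the diagonal by a factor of at most sqrt 2. This loss is
  harmless for the corner rectangles, whose total size is small.\<close>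

lemma box_cover_rectangle:
  fixes a b c d :: real
  assumes "a \<le> c" "b \<le> d" "(c - a) + (d - b) \<le> D"
  shows "box_cover 1 ((c - a) + (d - b)) D ({a..c} \<times> {b..d})"
proof -
  have "dist (a, b) (c, d) \<le> (c - a) + (d - b)" using dist_Pair_le[of a b c d] assms by simp
  then show ?thesis
    using box_cover_mono[OF box_cover_cbox[of "(a, b)" "(c, d)" D], of 1 _ D] assms
    by (simp add: cbox_Pair_eq)
qed

section \<open>Deterministic covers of the points of a signed tree\<close>

section \<open>Points of a signed tree\<close>

abbreviation nleaves :: "('l, 'n) plane_tree \<Rightarrow> nat" where
  "nleaves t \<equiv> length (leaves t)"

lemma binary_tree_induct [consumes 1, case_names Leaf Node]:
  assumes "binary_tree t" and "\<And>a. P (Leaf a)"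
    and "\<And>n l r. binary_tree l \<Longrightarrow> binary_tree r \<Longrightarrow> P l \<Longrightarrow> P r \<Longrightarrow> P (Node n [l, r])"
  shows "P t"
  using assms(1)
proof (induction t)
  case (Node n ts)
  then obtain l r where "ts = [l, r]" by (auto simp: numeral_2_eq_2 length_Suc_conv)
  with Node assms(3) show ?case by auto
qed (rule assms(2))

lemma mset_leaves_reverse_minus:
  "binary_tree t \<Longrightarrow> mset (leaves (reverse_minus t)) = mset (leaves t)"
proof (induction t rule: binary_tree_induct)
  case (Node n l r)
  then show ?case by (cases n) auto
qed simp

lemma nleaves_reverse_minus: "binary_tree t \<Longrightarrow> nleaves (reverse_minus t) = nleaves t"
  using mset_leaves_reverse_minus mset_eq_length by blast

lemma set_leaves_reverse_minus:
  "binary_tree t \<Longrightarrow> set (leaves (reverse_minus t)) = set (leaves t)"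
  using mset_leaves_reverse_minus mset_eq_setD by blast

lemma nleaves_pos: "binary_tree t \<Longrightarrow> 0 < nleaves t"
  using leaves_binary_nonempty by auto

text \<open>Positions are counted from \<open>0\<close> here.\<close>

definition tree_points :: "('l, sign) plane_tree \<Rightarrow> (real \<times> real) set" where
  "tree_points t = {(real i, real j) | i j. i < nleaves t \<and> j < nleaves t \<and>
     leaves t ! i = leaves (reverse_minus t) ! j}"

lemma tree_pointsI:
  "i < nleaves t \<Longrightarrow> j < nleaves t \<Longrightarrow> leaves t ! i = leaves (reverse_minus t) ! j \<Longrightarrow>
    (real i, real j) \<in> tree_points t"
  unfolding tree_points_def by blast

lemma tree_points_subset: "tree_points t \<subseteq> {0..nleaves t} \<times> {0..nleaves t}"
  by (auto simp: tree_points_def)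

text \<open>A match across the two children would be a common label, against distinctness. The other
  matches are those inside a child, displaced by its offsets in the two leaf orders.\<close>

lemma tree_points_Node_Plus:
  assumes "binary_tree l" "binary_tree r" "distinct (leaves l @ leaves r)"
  shows "tree_points (Node Plus [l, r]) \<subseteq>
    tree_points l \<union> (+) (real (nleaves l), real (nleaves l)) ` tree_points r"
proof
  let ?a = "nleaves l" and ?l = "leaves (reverse_minus l)" and ?r = "leaves (reverse_minus r)"
  have len: "length ?l = ?a" "length ?r = nleaves r"
    and set: "set ?l = set (leaves l)" "set ?r = set (leaves r)"
    using assms by (auto simp: nleaves_reverse_minus set_leaves_reverse_minus)
  fix z assume "z \<in> tree_points (Node Plus [l, r])"
  then obtain i j where z: "z = (real i, real j)" and ij: "i < ?a + nleaves r" "j < ?a + nleaves r"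
    and eq: "(leaves l @ leaves r) ! i = (?l @ ?r) ! j"
    by (auto simp: tree_points_def)
  consider "i < ?a" "j < ?a" | "i \<ge> ?a" "j \<ge> ?a" | "i < ?a" "j \<ge> ?a" | "i \<ge> ?a" "j < ?a" by linarith
  then show "z \<in> tree_points l \<union> (+) (real ?a, real ?a) ` tree_points r"
  proof cases
    case 1
    then show ?thesis using eq z by (auto simp: tree_points_def nth_append len)
  next
    case 2
    then have "(real (i - ?a), real (j - ?a)) \<in> tree_points r"
      using eq ij by (intro tree_pointsI) (auto simp: nth_append len)
    moreover have "z = (real ?a, real ?a) + (real (i - ?a), real (j - ?a))"
      using z 2 by (simp add: of_nat_diff)
    ultimately show ?thesis by blast
  next
    case 3
    then have "leaves l ! i = ?r ! (j - ?a)" using eq by (simp add: nth_append len)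
    then have "leaves l ! i \<in> set (leaves l) \<inter> set (leaves r)"
      using 3 ij len set by (metis IntI add_diff_inverse_nat leD nat_add_left_cancel_less nth_mem)
    then show ?thesis using assms(3) by auto
  next
    case 4
    then have "leaves r ! (i - ?a) = ?l ! j" using eq by (simp add: nth_append len)
    then have "?l ! j \<in> set (leaves l) \<inter> set (leaves r)"
      using 4 ij len set by (metis IntI add_diff_inverse_nat leD nat_add_left_cancel_less nth_mem)
    then show ?thesis using assms(3) by auto
  qed
qed

lemma tree_points_Node_Minus:
  assumes "binary_tree l" "binary_tree r" "distinct (leaves l @ leaves r)"
  shows "tree_points (Node Minus [l, r]) \<subseteq>
    (+) (0, real (nleaves r)) ` tree_points l \<union> (+) (real (nleaves l), 0) ` tree_points r"
proof
  let ?a = "nleaves l" and ?b = "nleaves r"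
  let ?l = "leaves (reverse_minus l)" and ?r = "leaves (reverse_minus r)"
  have len: "length ?l = ?a" "length ?r = ?b"
    and set: "set ?l = set (leaves l)" "set ?r = set (leaves r)"
    using assms by (auto simp: nleaves_reverse_minus set_leaves_reverse_minus)
  fix z assume "z \<in> tree_points (Node Minus [l, r])"
  then obtain i j where z: "z = (real i, real j)" and ij: "i < ?a + ?b" "j < ?a + ?b"
    and eq: "(leaves l @ leaves r) ! i = (?r @ ?l) ! j"
    by (auto simp: tree_points_def)
  consider "i < ?a" "j \<ge> ?b" | "i \<ge> ?a" "j < ?b" | "i < ?a" "j < ?b" | "i \<ge> ?a" "j \<ge> ?b" by linarith
  then show "z \<in> (+) (0, real ?b) ` tree_points l \<union> (+) (real ?a, 0) ` tree_points r"
  proof cases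
    case 1
    then have "(real i, real (j - ?b)) \<in> tree_points l"
      using eq ij by (intro tree_pointsI) (auto simp: nth_append len)
    moreover have "z = (0, real ?b) + (real i, real (j - ?b))"
      using z 1 by (simp add: of_nat_diff)
    ultimately show ?thesis by blast
  next
    case 2
    then have "(real (i - ?a), real j) \<in> tree_points r"
      using eq ij by (intro tree_pointsI) (auto simp: nth_append len)
    moreover have "z = (real ?a, 0) + (real (i - ?a), real j)"
      using z 2 by (simp add: of_nat_diff)
    ultimately show ?thesis by blast
  next
    case 3
    then have "leaves l ! i = ?r ! j" using eq by (simp add: nth_append len)
    then have "leaves l ! i \<in> set (leaves l) \<inter> set (leaves r)"
      using 3 ij len set by (metis IntI nth_mem)
    then show ?thesis using assms(3) by auto
  next
    case 4
    then have "leaves r ! (i - ?a) = ?l ! (j - ?b)" using eq by (simp add: nth_append len)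
    moreover have "i - ?a < ?b" "j - ?b < ?a" using 4 ij by auto
    ultimately have "?l ! (j - ?b) \<in> set (leaves l) \<inter> set (leaves r)"
      using len set by (metis IntI nth_mem)
    then show ?thesis using assms(3) by auto
  qed
qed

section \<open>Box covers of the points of a tree\<close>

text \<open>The number of leaves whose first ancestor with fewer than \<open>m\<close> leaves, counted from the
  root, has even fewer than \<open>s\<close> leaves.\<close>

fun small_mass :: "nat \<Rightarrow> nat \<Rightarrow> ('l, 'n) plane_tree \<Rightarrow> nat" where
  "small_mass s m (Leaf _) = (if 1 < s then 1 else 0)"
| "small_mass s m (Node n ts) =
     (if nleaves (Node n ts) < s then nleaves (Node n ts)
      else if nleaves (Node n ts) < m then 0 else sum_list (map (small_mass s m) ts))"

lemma small_mass_small: "nleaves t < s \<Longrightarrow> small_mass s m t = nleaves t"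
  by (cases t) auto

text \<open>L, R, B and T are the thicknesses of the left, right, bottom and top border strips of
  the square of side n.\<close>

definition corners :: "real \<Rightarrow> real \<Rightarrow> real \<Rightarrow> real \<Rightarrow> real \<Rightarrow> (real \<times> real) set" where
  "corners n L R B T = ({0..L} \<union> {n - R..n}) \<times> ({0..B} \<union> {n - T..n})"

text \<open>Each rectangle is charged half its perimeter. Every strip thickness occurs in two
  rectangles, so the total is 2 (L + R) + 2 (B + T) = 4 (L + R), and a single rectangle costs at
  most half of this.\<close>

lemma box_cover_corners:
  assumes "0 \<le> L" "0 \<le> R" "0 \<le> B" "0 \<le> T" "L + R = B + T" "2 * (L + R) \<le> d"
  shows "box_cover 4 (4 * (L + R)) d (corners n L R B T)"
proof -
  have "corners n L R B T = (({0..L} \<times> {0..B}) \<union> ({0..L} \<times> {n - T..n})) \<union>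
     (({n - R..n} \<times> {0..B}) \<union> ({n - R..n} \<times> {n - T..n}))"
    unfolding corners_def by auto
  moreover have "box_cover ((1 + 1) + (1 + 1))
     ((((L - 0) + (B - 0)) + ((L - 0) + (n - (n - T)))) +
      (((n - (n - R)) + (B - 0)) + ((n - (n - R)) + (n - (n - T))))) d
     ((({0..L} \<times> {0..B}) \<union> ({0..L} \<times> {n - T..n})) \<union>
     (({n - R..n} \<times> {0..B}) \<union> ({n - R..n} \<times> {n - T..n})))"
    using assms by (intro box_cover_Un box_cover_rectangle) auto
  moreover have "4 * (L + R) = (((L - 0) + (B - 0)) + ((L - 0) + (n - (n - T)))) +
      (((n - (n - R)) + (B - 0)) + ((n - (n - R)) + (n - (n - T))))"
    using assms by simp
  moreover have "(4 :: nat) = (1 + 1) + (1 + 1)" by simp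
  ultimately show ?thesis by metis
qed

text \<open>A subtree fits in a square block; the sqrt 2 of the final bound is the diagonal of this
  block.\<close>

lemma box_cover_small_tree:
  assumes "2 * real (nleaves t) \<le> d"
  shows "box_cover 1 (sqrt 2 * nleaves t) d (tree_points t)"
proof -
  let ?n = "real (nleaves t)"
  have "dist (0, 0) (?n, ?n) = sqrt 2 * ?n"
    by (simp add: dist_Pair_Pair real_sqrt_mult flip: mult_2)
  moreover have "dist (0, 0) (?n, ?n) \<le> d" using dist_Pair_le[of 0 0 ?n ?n] assms by simp
  ultimately have "box_cover 1 (sqrt 2 * ?n) d (cbox (0, 0) (?n, ?n))"
    using box_cover_cbox[of "(0, 0)" "(?n, ?n)" d] by simp
  then show ?thesis
    by (rule box_cover_mono) (use tree_points_subset[of t] in \<open>auto simp: cbox_Pair_eq\<close>)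
qed

text \<open>A maximal chain of nodes each having one child with fewer than \<open>s\<close> leaves places all these
  small children in four corner rectangles around the points of its last node.  This is what keeps
  the number of boxes bounded independently of the size of the tree.\<close>

definition ring_cover :: "nat \<Rightarrow> nat \<Rightarrow> real \<Rightarrow> ('l, sign) plane_tree \<Rightarrow> bool" where
  "ring_cover s m d t \<longleftrightarrow> (\<exists>(L :: real) (R :: real) B T N c K. 0 \<le> L \<and> 0 \<le> R \<and> 0 \<le> B \<and> 0 \<le> T \<and> L + R = B + T \<and>
     L + R \<le> small_mass s m t \<and> box_cover N c d K \<and>
     tree_points t \<subseteq> corners (nleaves t) L R B T \<union> K \<and>
     c + 4 * (L + R) \<le> sqrt 2 * nleaves t + 4 * real (small_mass s m t) \<and>
     real N + 8 \<le> 10 * real (nleaves t) / s)"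

lemma ring_coverI:
  fixes L R B T :: real
  assumes "0 \<le> L" "0 \<le> R" "0 \<le> B" "0 \<le> T" "L + R = B + T" "L + R \<le> small_mass s m t"
    "box_cover N c d K" "tree_points t \<subseteq> corners (nleaves t) L R B T \<union> K"
    "c + 4 * (L + R) \<le> sqrt 2 * nleaves t + 4 * real (small_mass s m t)"
    "real N + 8 \<le> 10 * real (nleaves t) / s"
  shows "ring_cover s m d t"
  unfolding ring_cover_def using assms by blast

text \<open>Closing the ring spends four boxes on the corners and lowers the slack 8 of
  \<open>ring_cover\<close> to 4; two closed rings under one node restore 4 + 4 = 8. The 10 is 1 + 1
  + 8, for a node with two one-box children and at least \<open>s\<close> leaves in all.\<close>

lemma box_cover_ring:
  assumes "ring_cover s m d t" "2 * real (small_mass s m t) \<le> d"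
  shows "\<exists>N. real N + 4 \<le> 10 * real (nleaves t) / s \<and>
     box_cover N (sqrt 2 * nleaves t + 4 * real (small_mass s m t)) d (tree_points t)"
proof -
  obtain L R B T :: real and N c K where *: "0 \<le> L" "0 \<le> R" "0 \<le> B" "0 \<le> T" "L + R = B + T"
     "L + R \<le> small_mass s m t" "box_cover N c d K"
     "tree_points t \<subseteq> corners (nleaves t) L R B T \<union> K"
     "c + 4 * (L + R) \<le> sqrt 2 * nleaves t + 4 * real (small_mass s m t)"
     "real N + 8 \<le> 10 * real (nleaves t) / s"
    using assms(1) unfolding ring_cover_def by blast
  have "box_cover (4 + N) (4 * (L + R) + c) d (corners (nleaves t) L R B T \<union> K)"
    using * assms(2) by (intro box_cover_Un box_cover_corners) auto
  then have "box_cover (4 + N) (sqrt 2 * nleaves t + 4 * real (small_mass s m t)) d (tree_points t)"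
    by (rule box_cover_mono) (use * in auto)
  then show ?thesis using *(10) by (intro exI[of _ "4 + N"]) auto
qed

lemma image_corners_add:
  assumes "0 \<le> x" "0 \<le> y" "n + x + x' = N" "n + y + y' = N" "0 \<le> x'" "0 \<le> y'"
  shows "(+) (x, y) ` corners n L R B T \<subseteq> corners N (L + x) (R + x') (B + y) (T + y')"
  using assms unfolding corners_def by auto

text \<open>A child with fewer than \<open>s\<close> leaves beside one with at least
  \<open>m\<close> only widens the ring of the latter. Every other node starts a new ring; a one-box
  child beside a large one has at least \<open>s\<close> leaves there, so its leaves contribute 10
  to the bound on the number of boxes.\<close>

lemma ring_cover_tree:
  assumes "binary_tree t" "distinct (leaves t)" "1 \<le> s" "s \<le> m" "m \<le> nleaves t"
    "2 * real m \<le> d" "2 * real (small_mass s m t) \<le> d"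
  shows "ring_cover s m d (t :: ('l, sign) plane_tree)"
  using assms
proof (induction t rule: binary_tree_induct)
  case (Leaf a)
  have "box_cover 1 (sqrt 2 * nleaves (Leaf a :: ('l, sign) plane_tree)) d (tree_points (Leaf a :: ('l, sign) plane_tree))"
    by (rule box_cover_small_tree) (use Leaf in auto)
  moreover have "s = 1" using Leaf by auto
  ultimately show ?case unfolding ring_cover_def
    by (intro exI[of _ "0 :: real"] exI[of _ "1 :: nat"] exI[of _ "sqrt 2 :: real"]
        exI[of _ "tree_points (Leaf a)"] conjI) auto
next
  case (Node q l r)
  let ?t = "Node q [l, r]"
  let ?a = "real (nleaves l)" and ?b = "real (nleaves r)"
  have bin: "binary_tree l" "binary_tree r" and dis: "distinct (leaves l @ leaves r)"
    "distinct (leaves l)" "distinct (leaves r)"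
    using Node.hyps Node.prems by auto
  \<comment> \<open>Offsets of the children in the two leaf orders; under \<open>Minus\<close> the
    left child comes after the right one vertically.\<close>
  define wl :: "real \<times> real" where "wl = (case q of Plus \<Rightarrow> (0, 0) | Minus \<Rightarrow> (0, ?b))"
  define wr :: "real \<times> real" where "wr = (case q of Plus \<Rightarrow> (?a, ?a) | Minus \<Rightarrow> (?a, 0))"
  have pts: "tree_points ?t \<subseteq> (+) wl ` tree_points l \<union> (+) wr ` tree_points r"
    using tree_points_Node_Plus[OF bin dis(1)] tree_points_Node_Minus[OF bin dis(1)]
    by (cases q) (simp_all add: wl_def wr_def flip: zero_prod_def)
  have nt: "nleaves ?t = nleaves l + nleaves r" by simp
  have "\<not> nleaves ?t < s" "\<not> nleaves ?t < m" using Node.prems by linarith+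
  then have sm: "small_mass s m ?t = small_mass s m l + small_mass s m r" by simp
  have s0: "0 < real s" using Node.prems by auto
  have full: "\<exists>N. real N + 4 \<le> 10 * real (nleaves u) / s \<and>
     box_cover N (sqrt 2 * nleaves u + 4 * real (small_mass s m u)) d (tree_points u)"
    if "u = l \<or> u = r" "m \<le> nleaves u" for u
    using that Node.IH Node.prems dis sm by (intro box_cover_ring) auto
  have small: "\<exists>N. N = 1 \<and>
     box_cover N (sqrt 2 * nleaves u + 4 * real (small_mass s m u)) d (tree_points u)"
    if "u = l \<or> u = r" "nleaves u < m" for u
  proof -
    have "box_cover 1 (sqrt 2 * nleaves u) d (tree_points u)"
      by (rule box_cover_small_tree) (use that Node.prems in auto)
    then show ?thesis by (auto elim!: box_cover_mono)
  qed
  \<comment> \<open>The new ring has L = R = B = T = 0, with all points in \<open>K\<close>.\<close>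
  have split: "ring_cover s m d ?t"
    if "box_cover N1 (sqrt 2 * nleaves l + 4 * real (small_mass s m l)) d (tree_points l)"
      "box_cover N2 (sqrt 2 * nleaves r + 4 * real (small_mass s m r)) d (tree_points r)"
      "real N1 + real N2 + 8 \<le> 10 * real (nleaves ?t) / s" for N1 N2
  proof -
    have "box_cover (N1 + N2) ((sqrt 2 * nleaves l + 4 * real (small_mass s m l)) +
       (sqrt 2 * nleaves r + 4 * real (small_mass s m r))) d
       ((+) wl ` tree_points l \<union> (+) wr ` tree_points r)"
      by (intro box_cover_Un box_cover_translation that)
    then have "box_cover (N1 + N2) (sqrt 2 * nleaves ?t + 4 * real (small_mass s m ?t)) d (tree_points ?t)"
      by (rule box_cover_mono) (use pts sm in \<open>auto simp: algebra_simps\<close>)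
    then show ?thesis unfolding ring_cover_def
      by (intro exI[of _ "0 :: real"] exI[of _ "N1 + N2"] 
          exI[of _ "sqrt 2 * nleaves ?t + 4 * real (small_mass s m ?t)"] exI[of _ "tree_points ?t"])
         (use that(3) in auto)
  qed
  have ext: "ring_cover s m d ?t"
    if uv: "u = l \<and> v = r \<and> wu = wl \<and> wv = wr \<or> u = r \<and> v = l \<and> wu = wr \<and> wv = wl"
      and "nleaves u < s" "m \<le> nleaves v" for u v wu wv
  proof -
    have "ring_cover s m d v"
      using that Node.IH Node.prems dis sm by auto
    then obtain L R B T :: real and N c K where *: "0 \<le> L" "0 \<le> R" "0 \<le> B" "0 \<le> T" "L + R = B + T"
      "L + R \<le> small_mass s m v" "box_cover N c d K"
      "tree_points v \<subseteq> corners (nleaves v) L R B T \<union> K"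
      "c + 4 * (L + R) \<le> sqrt 2 * nleaves v + 4 * real (small_mass s m v)"
      "real N + 8 \<le> 10 * real (nleaves v) / s"
      unfolding ring_cover_def by blast
    define n where "n = real (nleaves u)"
    define x where "x = fst wv"
    define y where "y = snd wv"
    have n: "0 \<le> n" "small_mass s m ?t = n + small_mass s m v" "real (nleaves ?t) = n + nleaves v"
      using uv sm small_mass_small[OF \<open>nleaves u < s\<close>] by (auto simp: n_def)
    have xy: "x = 0 \<or> x = n" "y = 0 \<or> y = n" "wv = (x, y)"
      using uv by (cases q; auto simp: wl_def wr_def n_def x_def y_def)+
    have wu: "wu = (if x = 0 then nleaves v else 0, if y = 0 then nleaves v else 0)"
    proof -
      have "0 < n" using uv bin nleaves_pos by (auto simp: n_def)
      then show ?thesis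
        using uv by (cases q) (auto simp: wl_def wr_def n_def x_def y_def)
    qed
    \<comment> \<open>If v is moved by n, then u lies on the side it leaves free. Hence x is added
      to one strip and n - x to the opposite one, likewise for y; both sums grow by n, which
      preserves the equality of L + R and B + T.\<close>
    let ?C = "corners (nleaves ?t) (L + x) (R + (n - x)) (B + y) (T + (n - y))"
    have "(+) wv ` corners (nleaves v) L R B T \<subseteq> ?C"
      unfolding xy(3) by (rule image_corners_add) (use xy(1,2) n in auto)
    then have v: "(+) wv ` tree_points v \<subseteq> ?C \<union> (+) wv ` K" using *(8) by blast
    have "(+) wu ` ({0..n} \<times> {0..n}) \<subseteq> ?C"
      using xy(1,2) n * unfolding corners_def wu by (auto simp: n_def)
    then have u: "(+) wu ` tree_points u \<subseteq> ?C"
      using tree_points_subset[of u] unfolding n_def by blast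
    have "tree_points ?t \<subseteq> (+) wu ` tree_points u \<union> (+) wv ` tree_points v"
      using uv pts by (elim disjE conjE) (simp_all only: Un_commute)
    then have "tree_points ?t \<subseteq> ?C \<union> (+) wv ` K" using u v by fast
    moreover have "real N + 8 \<le> 10 * real (nleaves ?t) / s"
      using *(10) n s0 by (simp add: field_simps)
    moreover have "c + 4 * ((L + x) + (R + (n - x))) \<le> sqrt 2 * nleaves ?t + 4 * real (small_mass s m ?t)"
    proof -
      have "0 \<le> sqrt 2 * n" using n(1) by simp
      then show ?thesis unfolding n(2,3) using *(9) by (simp add: algebra_simps)
    qed
    moreover have "0 \<le> x" "0 \<le> y" "0 \<le> n - x" "0 \<le> n - y" using xy(1,2) n(1) by auto
    moreover have "L + x + (R + (n - x)) = B + y + (T + (n - y))"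
      "L + x + (R + (n - x)) \<le> real (small_mass s m ?t)"
      using *(5,6) n(2) by linarith+
    ultimately show ?thesis
      using *(1-4) box_cover_translation[OF *(7)] by (intro ring_coverI[where L = "L + x" and
        R = "R + (n - x)" and B = "B + y" and T = "T + (n - y)" and K = "(+) wv ` K" and c = c
        and N = N] add_nonneg_nonneg) assumption+
  qed
  have large: "1 \<le> nleaves u / s" if "s \<le> nleaves u" for u :: "('l, sign) plane_tree"
    using that s0 by simp
  have sum: "10 * real (nleaves ?t) / s = 10 * real (nleaves l) / s + 10 * real (nleaves r) / s"
    by (simp add: add_divide_distrib)
  consider "nleaves l < s" "m \<le> nleaves r" | "nleaves r < s" "m \<le> nleaves l"
    | "m \<le> nleaves l" "m \<le> nleaves r" | "m \<le> nleaves l" "s \<le> nleaves r" "nleaves r < m"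
    | "m \<le> nleaves r" "s \<le> nleaves l" "nleaves l < m" | "nleaves l < m" "nleaves r < m"
    by linarith
  then show ?case
  proof cases
    case 1 then show ?thesis using ext[of l r wl wr] by blast
  next
    case 2 then show ?thesis using ext[of r l wr wl] by blast
  next
    case 3
    then show ?thesis using full[of l] full[of r] split sum by fastforce
  next
    case 4
    then show ?thesis using full[of l] small[of r] split sum large[of r] by fastforce
  next
    case 5
    then show ?thesis using full[of r] small[of l] split sum large[of l] by fastforce
  next
    case 6
    have "1 \<le> nleaves ?t / s" using Node.prems s0 by (simp del: leaves.simps)
    then have "real 1 + real 1 + 8 \<le> 10 * real (nleaves ?t) / s"
      unfolding times_divide_eq_right[symmetric] by linarith
    moreover obtain N1 N2 where "N1 = 1" "N2 = 1"
      "box_cover N1 (sqrt 2 * nleaves l + 4 * real (small_mass s m l)) d (tree_points l)"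
      "box_cover N2 (sqrt 2 * nleaves r + 4 * real (small_mass s m r)) d (tree_points r)"
      using small 6 by blast
    ultimately show ?thesis using split by blast
  qed
qed

lemma box_cover_tree:
  assumes "binary_tree t" "distinct (leaves t)" "1 \<le> s" "s \<le> m" "m \<le> nleaves t"
    "2 * real m \<le> d" "2 * real (small_mass s m t) \<le> d"
  shows "\<exists>N. real N \<le> 10 * real (nleaves t) / s \<and>
     box_cover N (sqrt 2 * nleaves t + 4 * real (small_mass s m t)) d (tree_points t)"
  proof -
  obtain N where "real N + 4 \<le> 10 * real (nleaves t) / s"
     "box_cover N (sqrt 2 * nleaves t + 4 * real (small_mass s m t)) d (tree_points t)"
    using box_cover_ring[OF ring_cover_tree[OF assms] assms(7)] by blast
  then show ?thesis by (intro exI[of _ N]) auto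
qed

section \<open>Estimates for the random tree and its permutation at finite size\<close>

section \<open>Counting binary trees\<close>

text \<open>The index is the number of leaves, so \<open>catalan (n + 1)\<close> is the usual \<open>n\<close>-th Catalan number.\<close>

fun catalan :: "nat \<Rightarrow> real" where
  "catalan 0 = 0"
| "catalan (Suc 0) = 1"
| "catalan (Suc (Suc n)) = 2 * (2 * real n + 1) / (real n + 2) * catalan (Suc n)"

lemma catalan_pos: "0 < n \<Longrightarrow> 0 < catalan n"
  by (induction n rule: catalan.induct) auto

lemma catalan_nonneg: "0 \<le> catalan n"
  using catalan_pos[of n] by (cases "n = 0") auto

lemma catalan_Suc: "1 \<le> n \<Longrightarrow> (real n + 1) * catalan (Suc n) = (4 * real n - 2) * catalan n"
  by (cases n) (auto simp: field_simps)

lemma catalan_Suc_le: "1 \<le> n \<Longrightarrow> catalan (Suc n) \<le> 4 * catalan n"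
proof -
  assume n: "1 \<le> n"
  have "(real n + 1) * catalan (Suc n) \<le> (real n + 1) * (4 * catalan n)"
    unfolding catalan_Suc[OF n] using catalan_nonneg[of n] by (simp add: algebra_simps)
  then show ?thesis by (simp add: mult_le_cancel_left_pos)
qed

text \<open>The reflection of i to n - i fixes the product, and the weights i and n - i add up to
  n.\<close>

lemma sum_weighted_convolution:
  fixes a :: "nat \<Rightarrow> real"
  shows "2 * (\<Sum>i\<in>{1..<n}. real i * a i * a (n - i)) = real n * (\<Sum>i\<in>{1..<n}. a i * a (n - i))"
proof -
  have "(\<Sum>i\<in>{1..<n}. real i * a i * a (n - i)) = (\<Sum>i\<in>{1..<n}. real (n - i) * a (n - i) * a (n - (n - i)))"
    by (rule sum.reindex_bij_witness[of _ "\<lambda>i. n - i" "\<lambda>i. n - i"]) auto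
  also have "\<dots> = (\<Sum>i\<in>{1..<n}. real (n - i) * a i * a (n - i))"
    by (rule sum.cong) auto
  finally have "2 * (\<Sum>i\<in>{1..<n}. real i * a i * a (n - i)) =
      (\<Sum>i\<in>{1..<n}. real i * a i * a (n - i) + real (n - i) * a i * a (n - i))"
    by (simp add: sum.distrib)
  also have "\<dots> = (\<Sum>i\<in>{1..<n}. real n * (a i * a (n - i)))"
    by (rule sum.cong) (auto simp: of_nat_diff algebra_simps)
  finally show ?thesis by (simp add: sum_distrib_left)
qed

text \<open>Both sides satisfy the same linear recurrence, as one sees by weighting the convolution
  with the index.\<close>

lemma catalan_convolution: "2 \<le> n \<Longrightarrow> catalan n = (\<Sum>i\<in>{1..<n}. catalan i * catalan (n - i))"
proof (induction n rule: nat_induct_at_least)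
  case base
  have "{1..<2} = {1 :: nat}" by auto
  then show ?case by (simp add: numeral_2_eq_2)
next
  case (Suc n)
  let ?c = catalan
  let ?S = "\<lambda>n. \<Sum>i\<in>{1..<n}. ?c i * ?c (n - i)"
  have "real (Suc n) * ?S (Suc n) = 2 * (\<Sum>i\<in>{1..<Suc n}. real i * ?c i * ?c (Suc n - i))"
    by (rule sum_weighted_convolution[symmetric])
  \<comment> \<open>The term i = 1 is split off because \<open>catalan_Suc\<close> rewrites only the
    indices Suc j with j \<ge> 1.\<close>
  also have "(\<Sum>i\<in>{1..<Suc n}. real i * ?c i * ?c (Suc n - i)) =
      ?c n + (\<Sum>i\<in>{2..<Suc n}. real i * ?c i * ?c (Suc n - i))"
    using Suc(1) by (subst sum.atLeast_Suc_lessThan) (auto simp: numeral_2_eq_2)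
  also have "(\<Sum>i\<in>{2..<Suc n}. real i * ?c i * ?c (Suc n - i)) =
      (\<Sum>j\<in>{1..<n}. real (Suc j) * ?c (Suc j) * ?c (n - j))"
    by (rule sum.reindex_bij_witness[of _ Suc "\<lambda>i. i - 1"]) auto
  also have "\<dots> = (\<Sum>j\<in>{1..<n}. 4 * (real j * ?c j * ?c (n - j)) - 2 * (?c j * ?c (n - j)))"
  proof (rule sum.cong)
    fix j assume "j \<in> {1..<n}"
    then have "real (Suc j) * ?c (Suc j) = (4 * real j - 2) * ?c j"
      using catalan_Suc[of j] by (simp add: add.commute)
    then show "real (Suc j) * ?c (Suc j) * ?c (n - j) =
        4 * (real j * ?c j * ?c (n - j)) - 2 * (?c j * ?c (n - j))"
      by (simp only:) (simp add: algebra_simps)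
  qed simp
  also have "\<dots> = 2 * (2 * (\<Sum>j\<in>{1..<n}. real j * ?c j * ?c (n - j))) - 2 * ?S n"
    by (simp add: sum_subtractf sum_distrib_left)
  also have "\<dots> = 2 * (real n * ?S n) - 2 * ?S n"
    by (simp only: sum_weighted_convolution)
  also have "?S n = ?c n" using Suc by simp
  finally have "real (Suc n) * ?S (Suc n) = (4 * real n - 2) * ?c n"
    by (simp add: algebra_simps)
  also have "\<dots> = real (Suc n) * ?c (Suc n)"
    using catalan_Suc[of n] Suc(1) by (simp add: add.commute)
  finally have "real (Suc n) * ?S (Suc n) = real (Suc n) * ?c (Suc n)" .
  then show ?case using mult_left_cancel[of "real (Suc n)" "?S (Suc n)" "?c (Suc n)"] by simp
qed

text \<open>Arbitrary leaf lists are allowed because the children of a tree in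
  \<open>binary_trees k\<close> carry segments of its list, which makes induction on the length
  possible.\<close>

definition trees_on :: "'l list \<Rightarrow> ('l, unit) plane_tree set" where
  "trees_on xs = {t. binary_tree t \<and> leaves t = xs}"

lemma finite_trees_on: "finite (trees_on xs)"
  unfolding trees_on_def by (rule finite_binary_trees_with_leaves)

lemma trees_on_singleton: "trees_on [a :: 'l] = {Leaf a}"
proof -
  have "t = Leaf a" if "binary_tree t" "leaves t = [a]" for t :: "('l, unit) plane_tree"
    using that
  proof (induction t rule: binary_tree_induct)
    case (Node n l r)
    then show ?case using leaves_binary_nonempty[of l] leaves_binary_nonempty[of r]
      by (auto simp: append_eq_Cons_conv)
  qed simp
  then show ?thesis by (auto simp: trees_on_def)
qed

text \<open>Decomposition at the root. The split index is recovered as the number of leaves of the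
  left child, which makes the correspondence injective.\<close>

lemma sum_trees_on:
  assumes "2 \<le> length xs"
  shows "(\<Sum>t\<in>trees_on xs. f t) =
    (\<Sum>i\<in>{1..<length xs}. \<Sum>l\<in>trees_on (take i xs). \<Sum>r\<in>trees_on (drop i xs). f (Node () [l, r]))"
proof -
  define A where "A = (\<lambda>i. trees_on (take i xs) \<times> trees_on (drop i xs))"
  have "(\<Sum>i\<in>{1..<length xs}. \<Sum>l\<in>trees_on (take i xs). \<Sum>r\<in>trees_on (drop i xs). f (Node () [l, r])) =
     (\<Sum>i\<in>{1..<length xs}. \<Sum>lr\<in>A i. f (Node () [fst lr, snd lr]))"
    unfolding A_def by (simp add: sum.cartesian_product case_prod_unfold)
  also have "\<dots> = (\<Sum>ilr\<in>Sigma {1..<length xs} A. f (Node () [fst (snd ilr), snd (snd ilr)]))"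
    by (subst sum.Sigma) (auto simp: A_def finite_trees_on case_prod_unfold)
  also have "\<dots> = (\<Sum>t\<in>trees_on xs. f t)"
  proof (rule sum.reindex_bij_betw[where h = "\<lambda>ilr. Node () [fst (snd ilr), snd (snd ilr)]" and g = f])
    show "bij_betw (\<lambda>ilr. Node () [fst (snd ilr), snd (snd ilr)]) (Sigma {1..<length xs} A) (trees_on xs)"
    proof (rule bij_betwI')
      fix x y assume "x \<in> Sigma {1..<length xs} A" "y \<in> Sigma {1..<length xs} A"
      moreover obtain i l r where "x = (i, l, r)" by (metis surj_pair)
      moreover obtain j l' r' where "y = (j, l', r')" by (metis surj_pair)
      moreover have "i = length (take i xs)" if "i \<le> length xs" for i using that by simp
      ultimately show "(Node () [fst (snd x), snd (snd x)] = Node () [fst (snd y), snd (snd y)]) = (x = y)"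
        unfolding A_def trees_on_def by (auto dest!: arg_cong[of _ _ length])
    next
      fix x assume "x \<in> Sigma {1..<length xs} A"
      then show "Node () [fst (snd x), snd (snd x)] \<in> trees_on xs"
        by (auto simp: A_def trees_on_def)
    next
      fix t assume t: "t \<in> trees_on xs"
      then have "binary_tree t" "leaves t = xs" by (auto simp: trees_on_def)
      then have "\<exists>l r. t = Node () [l, r] \<and> binary_tree l \<and> binary_tree r \<and> leaves l @ leaves r = xs"
        using assms by (induction t rule: binary_tree_induct) auto
      then obtain l r where lr: "t = Node () [l, r]" "binary_tree l" "binary_tree r" "leaves l @ leaves r = xs"
        by blast
      then have "(nleaves l, l, r) \<in> Sigma {1..<length xs} A"
        using leaves_binary_nonempty[of l] leaves_binary_nonempty[of r]
        by (auto simp: A_def trees_on_def Suc_le_eq)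
      then show "\<exists>x\<in>Sigma {1..<length xs} A. t = Node () [fst (snd x), snd (snd x)]"
        using lr(1) by (intro bexI[of _ "(nleaves l, l, r)"]) simp_all
    qed
  qed
  finally show ?thesis by simp
qed

lemma card_trees_on: "xs \<noteq> [] \<Longrightarrow> real (card (trees_on xs)) = catalan (length xs)"
proof (induction "length xs" arbitrary: xs rule: less_induct)
  case less
  show ?case
  proof (cases "length xs = 1")
    case True
    then obtain a where "xs = [a]" by (cases xs) auto
    then show ?thesis by (simp add: trees_on_singleton)
  next
    case False
    then have n: "2 \<le> length xs" using less(2) by (cases xs) (auto simp: Suc_le_eq)
    have "real (card (trees_on xs)) = (\<Sum>t\<in>trees_on xs. 1)" by simp
    also have "\<dots> = (\<Sum>i\<in>{1..<length xs}. real (card (trees_on (take i xs))) * real (card (trees_on (drop i xs))))"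
      by (subst sum_trees_on[OF n]) simp
    also have "\<dots> = (\<Sum>i\<in>{1..<length xs}. catalan i * catalan (length xs - i))"
    proof (rule sum.cong)
      fix i assume i: "i \<in> {1..<length xs}"
      then have "real (card (trees_on (take i xs))) = catalan (length (take i xs))"
        "real (card (trees_on (drop i xs))) = catalan (length (drop i xs))"
        by (intro less(1); auto)+
      then show "real (card (trees_on (take i xs))) * real (card (trees_on (drop i xs))) =
          catalan i * catalan (length xs - i)" using i by simp
    qed simp
    also have "\<dots> = catalan (length xs)" using catalan_convolution[OF n] by simp
    finally show ?thesis .
  qed
qed

section \<open>The small mass of a uniform binary tree\<close>

text \<open>For i \<ge> 1 this is binom(2 i - 2, i - 1) / 4^i, a quarter of the probability that a
  simple random walk is at its origin at time 2 i - 2. It is of order 1 / sqrt i.\<close>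

definition cb :: "nat \<Rightarrow> real" where
  "cb i = real i * catalan i / 4 ^ i"

lemma cb_nonneg: "0 \<le> cb i"
  by (simp add: cb_def catalan_nonneg)

lemma cb_Suc: "1 \<le> n \<Longrightarrow> cb (Suc n) * (2 * real n) = (2 * real n - 1) * cb n"
proof -
  assume n: "1 \<le> n"
  have "cb (Suc n) = ((real n + 1) * catalan (Suc n)) / 4 ^ Suc n" by (simp add: cb_def add.commute)
  also have "\<dots> = (4 * real n - 2) * catalan n / 4 ^ Suc n" using catalan_Suc[OF n] by simp
  finally have eq: "cb (Suc n) = (4 * real n - 2) * catalan n / 4 ^ Suc n" .
  show ?thesis unfolding eq by (simp add: cb_def field_simps)
qed

definition cbsum :: "nat \<Rightarrow> real" where
  "cbsum n = (\<Sum>i\<in>{1..n}. cb i)"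

text \<open>The sum telescopes: \<open>cb_Suc\<close> says that 2 n cb(n + 1) - 2 (n - 1) cb(n) =
  cb(n).\<close>

lemma cbsum_eq: "1 \<le> n \<Longrightarrow> cbsum n = 2 * real n * cb (Suc n)"
proof (induction n rule: nat_induct_at_least)
  case base
  show ?case by (simp add: cbsum_def cb_def)
next
  case (Suc n)
  have "cbsum (Suc n) = cbsum n + cb (Suc n)" by (simp add: cbsum_def)
  also have "\<dots> = (2 * real (Suc n) - 1) * cb (Suc n)"
    using Suc by (simp add: algebra_simps)
  also have "\<dots> = 2 * real (Suc n) * cb (Suc (Suc n))"
    using cb_Suc[of "Suc n"] by (simp add: mult.commute)
  finally show ?case .
qed

lemma cbsum_Suc: "1 \<le> n \<Longrightarrow> cbsum (Suc n) = cbsum n * (1 + 1 / (2 * real n))"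
  using cbsum_eq[of n] by (simp add: cbsum_def field_simps)

text \<open>An elementary replacement for asymptotics. Both bounds are equalities at n = 1, and the
  squared growth factor (1 + 1 / (2 n))^2 lies between (n + 1) / n and (2 n + 1) / (2 n -
  1).\<close>

lemma cbsum_bounds:
  assumes "1 \<le> n"
  shows "real n / 16 \<le> (cbsum n)\<^sup>2 \<and> (cbsum n)\<^sup>2 \<le> (2 * real n - 1) / 16"
  using assms
proof (induction n rule: nat_induct_at_least)
  case base
  show ?case by (simp add: cbsum_def cb_def power2_eq_square)
next
  case (Suc n)
  define x where "x = real n"
  have x: "1 \<le> x" using Suc(1) by (simp add: x_def)
  have eq: "(cbsum (Suc n))\<^sup>2 = (cbsum n)\<^sup>2 * (1 + 1 / (2 * x))\<^sup>2"
    using cbsum_Suc[OF Suc(1)] by (simp add: power_mult_distrib x_def)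
  have "(x + 1) / 16 \<le> x / 16 * (1 + 1 / (2 * x))\<^sup>2"
    using x by (simp add: field_simps power2_eq_square)
  also have "\<dots> \<le> (cbsum n)\<^sup>2 * (1 + 1 / (2 * x))\<^sup>2"
    using Suc(2) by (intro mult_right_mono) (auto simp: x_def)
  finally have 1: "(x + 1) / 16 \<le> (cbsum (Suc n))\<^sup>2" using eq by simp
  have "(cbsum n)\<^sup>2 * (1 + 1 / (2 * x))\<^sup>2 \<le> (2 * x - 1) / 16 * (1 + 1 / (2 * x))\<^sup>2"
    using Suc(2) by (intro mult_right_mono) (auto simp: x_def)
  also have "\<dots> = (2 * x + 1) / 16 * ((2 * x - 1) * (2 * x + 1) / (4 * x\<^sup>2))"
    using x by (simp add: field_simps power2_eq_square)
  also have "\<dots> \<le> (2 * x + 1) / 16 * 1"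
    using x by (intro mult_left_mono) (simp_all add: field_simps power2_eq_square)
  finally have "(cbsum (Suc n))\<^sup>2 \<le> (2 * x + 1) / 16" using eq by simp
  then show ?case using 1 by (simp add: x_def add.commute)
qed

lemma cbsum_nonneg: "0 \<le> cbsum n"
  unfolding cbsum_def by (intro sum_nonneg cb_nonneg)

text \<open>The conclusion rearranges to (1 + e) cbsum(s - 1) \<le> e cbsum(m - 1), whose squares
  are compared by \<open>cbsum_bounds\<close>; the factor 2 in the hypothesis is the gap between its
  two bounds.\<close>

lemma cbsum_ratio:
  assumes "0 < e" "1 \<le> s" "1 < m" "2 * (1 + e)\<^sup>2 * (real s - 1) \<le> e\<^sup>2 * (real m - 1)"
  shows "cbsum (s - 1) \<le> e * (cbsum (m - 1) - cbsum (s - 1))"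
proof -
  have "((1 + e) * cbsum (s - 1))\<^sup>2 \<le> (e * cbsum (m - 1))\<^sup>2"
  proof (cases "s = 1")
    case True then show ?thesis by (simp add: cbsum_def)
  next
    case False
    have "((1 + e) * cbsum (s - 1))\<^sup>2 \<le> (1 + e)\<^sup>2 * ((2 * real (s - 1) - 1) / 16)"
      unfolding power_mult_distrib using cbsum_bounds[of "s - 1"] False assms(2)
      by (intro mult_left_mono) auto
    also have "\<dots> \<le> (1 + e)\<^sup>2 * ((2 * (real s - 1)) / 16)"
      using assms(2) by (intro mult_left_mono) (auto simp: of_nat_diff)
    also have "\<dots> = 2 * (1 + e)\<^sup>2 * (real s - 1) / 16" by simp
    also have "\<dots> \<le> e\<^sup>2 * (real m - 1) / 16" by (intro divide_right_mono assms) simp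
    also have "\<dots> = e\<^sup>2 * (real (m - 1) / 16)" using assms(3) by (simp add: of_nat_diff)
    also have "\<dots> \<le> (e * cbsum (m - 1))\<^sup>2"
      unfolding power_mult_distrib using cbsum_bounds[of "m - 1"] assms(3)
      by (intro mult_left_mono) auto
    finally show ?thesis .
  qed
  then have "(1 + e) * cbsum (s - 1) \<le> e * cbsum (m - 1)"
    by (rule power2_le_imp_le) (use assms(1) cbsum_nonneg in auto)
  then show ?thesis by (simp add: algebra_simps)
qed

lemma catalan_pow_mono:
  assumes "i \<le> j" "j < k"
  shows "4 ^ i * catalan (k - i) \<le> 4 ^ j * catalan (k - j)"
  using assms
proof (induction j rule: dec_induct)
  case (step j)
  have "4 ^ i * catalan (k - i) \<le> 4 ^ j * catalan (k - j)" using step by simp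
  also have "\<dots> \<le> 4 ^ j * (4 * catalan (k - Suc j))"
    using catalan_Suc_le[of "k - Suc j"] step by (intro mult_left_mono) (auto simp: Suc_diff_Suc)
  finally show ?case by simp
qed simp

text \<open>As \<open>4\<^sup>i catalan (k - i)\<close> increases with \<open>i\<close>, passing from the weights
  \<open>i catalan i catalan (k - i)\<close> to \<open>cb i\<close> only favours the small indices.\<close>

lemma small_index_sum_le:
  assumes "0 \<le> e" "1 \<le> s" "s < m" "m \<le> k"
    and ratio: "cbsum (s - 1) \<le> e * (cbsum (m - 1) - cbsum (s - 1))"
  shows "(\<Sum>i\<in>{1..<s}. real i * catalan i * catalan (k - i)) \<le>
    e * (\<Sum>i\<in>{1..<m}. real i * catalan i * catalan (k - i))"
proof -
  \<comment> \<open>The value of the monotone factor at the boundary index: an upper bound for i < s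
    and a lower bound for i \<ge> s.\<close>
  define a where "a = 4 ^ s * catalan (k - s)"
  have a0: "0 \<le> a" by (simp add: a_def catalan_nonneg)
  have w: "real i * catalan i * catalan (k - i) = cb i * (4 ^ i * catalan (k - i))" for i
    by (simp add: cb_def)
  have "{1..s - 1} = {1..<s}" "{1..m - 1} = {1..<m}" using assms by auto
  then have F: "cbsum (s - 1) = (\<Sum>i\<in>{1..<s}. cb i)" "cbsum (m - 1) = (\<Sum>i\<in>{1..<m}. cb i)"
    by (simp_all add: cbsum_def)
  have F': "cbsum (m - 1) - cbsum (s - 1) = (\<Sum>i\<in>{s..<m}. cb i)"
    unfolding F using sum.atLeastLessThan_concat[of 1 s m cb] assms by simp
  have "(\<Sum>i\<in>{1..<s}. real i * catalan i * catalan (k - i)) \<le> (\<Sum>i\<in>{1..<s}. cb i * a)"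
    unfolding w a_def using assms
    by (intro sum_mono mult_left_mono catalan_pow_mono cb_nonneg) auto
  also have "\<dots> = cbsum (s - 1) * a" unfolding F by (simp add: sum_distrib_right)
  also have "\<dots> \<le> e * (cbsum (m - 1) - cbsum (s - 1)) * a"
    by (intro mult_right_mono ratio a0)
  also have "\<dots> = e * (\<Sum>i\<in>{s..<m}. cb i * a)" unfolding F' by (simp add: sum_distrib_right)
  also have "\<dots> \<le> e * (\<Sum>i\<in>{s..<m}. real i * catalan i * catalan (k - i))"
    unfolding w a_def using assms
    by (intro mult_left_mono sum_mono catalan_pow_mono cb_nonneg) auto
  also have "\<dots> \<le> e * (\<Sum>i\<in>{1..<m}. real i * catalan i * catalan (k - i))"
    using assms by (intro mult_left_mono sum_mono2) (auto simp: catalan_nonneg)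
  finally show ?thesis .
qed

text \<open>Divided by the number of trees, this bounds the mean of \<open>small_mass\<close>. In
  the induction, \<open>h\<close> is the exact value below \<open>m\<close> and the claimed linear
  bound from \<open>m\<close> on. At a root split the values of \<open>h\<close> below
  \<open>m\<close> weigh at most e times the indices themselves, by
  \<open>small_index_sum_le\<close>; so \<open>h i\<close> may be replaced by e i in the sum, and a
  linear function is reproduced by the convolution
  (\<open>sum_weighted_convolution\<close>).\<close>

lemma sum_small_mass_le:
  fixes xs :: "'l list"
  assumes "0 \<le> e" "1 \<le> s" "s < m" "m \<le> length xs"
    and ratio: "cbsum (s - 1) \<le> e * (cbsum (m - 1) - cbsum (s - 1))"
  shows "(\<Sum>t\<in>trees_on xs. real (small_mass s m t)) \<le> e * length xs * catalan (length xs)"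
proof -
  define h where "h k = (if k < s then real k else if k < m then 0 else e * real k)" for k
  have "(\<Sum>t\<in>trees_on xs. real (small_mass s m t)) \<le> h (length xs) * catalan (length xs)"
    if "xs \<noteq> []" for xs :: "'l list"
    using that
  proof (induction "length xs" arbitrary: xs rule: less_induct)
    case less
    let ?k = "length xs" and ?c = catalan
    show ?case
    proof (cases "?k < m")
      case True
      have "real (small_mass s m t) = h ?k" if "t \<in> trees_on xs" for t
        using that True assms by (cases t) (auto simp: trees_on_def h_def)
      then show ?thesis by (simp add: card_trees_on less(2))
    next
      case False
      have k: "2 \<le> ?k" using False assms by simp
      have IH: "(\<Sum>t\<in>trees_on ys. real (small_mass s m t)) \<le> h (length ys) * ?c (length ys)"
        if "length ys < ?k" "ys \<noteq> []" for ys :: "'l list"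
        using less(1) that by auto
      have "(\<Sum>t\<in>trees_on xs. real (small_mass s m t)) =
          (\<Sum>i\<in>{1..<?k}. \<Sum>l\<in>trees_on (take i xs). \<Sum>r\<in>trees_on (drop i xs).
             real (small_mass s m l) + real (small_mass s m r))"
        unfolding sum_trees_on[OF k]
      proof (intro sum.cong refl)
        fix i l r assume "l \<in> trees_on (take i xs)" "r \<in> trees_on (drop i xs)"
        then have "nleaves (Node () [l, r]) = ?k" by (simp add: trees_on_def)
        then have "small_mass s m (Node () [l, r]) = small_mass s m l + small_mass s m r"
          using False assms by auto
        then show "real (small_mass s m (Node () [l, r])) = real (small_mass s m l) + real (small_mass s m r)"
          by simp
      qed
      also have "\<dots> = (\<Sum>i\<in>{1..<?k}. 
           (\<Sum>l\<in>trees_on (take i xs). real (small_mass s m l)) * real (card (trees_on (drop i xs))) +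
           real (card (trees_on (take i xs))) * (\<Sum>r\<in>trees_on (drop i xs). real (small_mass s m r)))"
        by (simp add: sum.distrib sum_distrib_right sum_distrib_left mult.commute)
      also have "\<dots> \<le> (\<Sum>i\<in>{1..<?k}. h i * ?c i * ?c (?k - i) + ?c i * (h (?k - i) * ?c (?k - i)))"
      proof (rule sum_mono)
        fix i assume i: "i \<in> {1..<?k}"
        then have "take i xs \<noteq> []" "drop i xs \<noteq> []" "length (take i xs) = i" by auto
        then have "(\<Sum>l\<in>trees_on (take i xs). real (small_mass s m l)) \<le> h i * ?c i"
          "(\<Sum>r\<in>trees_on (drop i xs). real (small_mass s m r)) \<le> h (?k - i) * ?c (?k - i)"
          "real (card (trees_on (take i xs))) = ?c i"
          "real (card (trees_on (drop i xs))) = ?c (?k - i)"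
          using IH[of "take i xs"] IH[of "drop i xs"] i card_trees_on[of "take i xs"]
            card_trees_on[of "drop i xs"] by simp_all
        then show "(\<Sum>l\<in>trees_on (take i xs). real (small_mass s m l)) * real (card (trees_on (drop i xs))) +
           real (card (trees_on (take i xs))) * (\<Sum>r\<in>trees_on (drop i xs). real (small_mass s m r))
           \<le> h i * ?c i * ?c (?k - i) + ?c i * (h (?k - i) * ?c (?k - i))"
          by (simp only:) (intro add_mono mult_right_mono mult_left_mono catalan_nonneg)
      qed
      also have "\<dots> = (\<Sum>i\<in>{1..<?k}. h i * ?c i * ?c (?k - i)) +
          (\<Sum>i\<in>{1..<?k}. h (?k - i) * ?c (?k - i) * ?c (?k - (?k - i)))"
        unfolding sum.distrib by (intro arg_cong2[of _ _ _ _ "(+)"] sum.cong) auto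
      also have "(\<Sum>i\<in>{1..<?k}. h (?k - i) * ?c (?k - i) * ?c (?k - (?k - i))) =
          (\<Sum>i\<in>{1..<?k}. h i * ?c i * ?c (?k - i))"
        by (rule sum.reindex_bij_witness[of _ "\<lambda>i. ?k - i" "\<lambda>i. ?k - i"]) auto
      finally have 1: "(\<Sum>t\<in>trees_on xs. real (small_mass s m t)) \<le>
          2 * (\<Sum>i\<in>{1..<?k}. h i * ?c i * ?c (?k - i))" by simp
      define w where "w i = real i * ?c i * ?c (?k - i)" for i
      define g where "g i = h i * ?c i * ?c (?k - i)" for i
      have "(\<Sum>i\<in>{1..<s}. g i) = (\<Sum>i\<in>{1..<s}. w i)" "(\<Sum>i\<in>{s..<m}. g i) = 0"
        by (auto simp: g_def w_def h_def intro!: sum.cong)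
      moreover have "(\<Sum>i\<in>{m..<?k}. g i) = (\<Sum>i\<in>{m..<?k}. e * w i)"
        using assms(3) by (intro sum.cong) (auto simp: g_def w_def h_def)
      moreover have "(\<Sum>i\<in>{1..<?k}. g i) = ((\<Sum>i\<in>{1..<s}. g i) + (\<Sum>i\<in>{s..<m}. g i)) + (\<Sum>i\<in>{m..<?k}. g i)"
        using False assms(2,3) by (simp add: sum.atLeastLessThan_concat)
      ultimately have "(\<Sum>i\<in>{1..<?k}. h i * ?c i * ?c (?k - i)) = (\<Sum>i\<in>{1..<s}. w i) + e * (\<Sum>i\<in>{m..<?k}. w i)"
        by (simp add: g_def sum_distrib_left)
      also have "\<dots> \<le> e * (\<Sum>i\<in>{1..<m}. w i) + e * (\<Sum>i\<in>{m..<?k}. w i)"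
        using small_index_sum_le[OF assms(1-3) _ ratio, of ?k] False by (simp add: w_def)
      also have "\<dots> = e * (\<Sum>i\<in>{1..<?k}. w i)"
        using sum.atLeastLessThan_concat[of 1 m ?k w] False assms by (simp flip: distrib_left)
      finally have "2 * (\<Sum>i\<in>{1..<?k}. h i * ?c i * ?c (?k - i)) \<le> e * (2 * (\<Sum>i\<in>{1..<?k}. w i))"
        by simp
      also have "2 * (\<Sum>i\<in>{1..<?k}. w i) = real ?k * ?c ?k"
        unfolding w_def sum_weighted_convolution using catalan_convolution[OF k] by simp
      also have "e * (real ?k * ?c ?k) = h ?k * ?c ?k"
        using False assms by (simp add: h_def)
      finally show ?thesis using 1 by simp
    qed
  qed
  moreover have "xs \<noteq> []" "h (length xs) = e * length xs" using assms by (auto simp: h_def)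
  ultimately show ?thesis by metis
qed

section \<open>Signs of a random tree\<close>

text \<open>The signs in in-order: entry i belongs to the last common ancestor of leaves i and i +
  1, counted from 0.\<close>

fun ascents :: "('l, sign) plane_tree \<Rightarrow> bool list" where
  "ascents (Node q [l, r]) = ascents l @ (q = Plus) # ascents r"
| "ascents _ = []"

lemma length_ascents: "binary_tree t \<Longrightarrow> Suc (length (ascents t)) = nleaves t"
  by (induction t rule: binary_tree_induct) auto

definition position :: "'a \<Rightarrow> 'a list \<Rightarrow> nat" where
  "position x xs = length (takeWhile ((\<noteq>) x) xs)"

lemma position_append:
  "position x (xs @ ys) = (if x \<in> set xs then position x xs else length xs + position x ys)"
  by (auto simp: position_def takeWhile_append)

lemma position_less: "x \<in> set xs \<Longrightarrow> position x xs < length xs"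
  by (induction xs) (auto simp: position_def)

lemma nth_position: "x \<in> set xs \<Longrightarrow> xs ! position x xs = x"
  by (induction xs) (auto simp: position_def)

lemma tree_perm_eq_position:
  assumes "binary_tree t" "distinct (leaves t)" "a \<in> set (leaves t)"
  shows "tree_perm t a = Suc (position a (leaves (reverse_minus t)))"
proof -
  let ?xs = "leaves (reverse_minus t)"
  have a: "a \<in> set ?xs" using assms by (simp add: set_leaves_reverse_minus)
  have "distinct ?xs"
    using assms mset_leaves_reverse_minus[OF assms(1)] by (metis mset_eq_imp_distinct_iff)
  then have "(THE j. j < length ?xs \<and> ?xs ! j = a) = position a ?xs"
    using position_less[OF a] nth_position[OF a] by (intro the_equality) (auto simp: nth_eq_iff_index_eq)
  then show ?thesis using assms(3) by (simp add: tree_perm_def)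
qed

text \<open>Two neighbouring leaves either lie in one child, whose leaves are displaced together, or
  on both sides of the root, whose sign decides their order.\<close>

lemma ascents_iff:
  assumes "binary_tree t" "distinct (leaves t)" "Suc i < nleaves t"
  shows "ascents t ! i \<longleftrightarrow> position (leaves t ! i) (leaves (reverse_minus t)) <
    position (leaves t ! Suc i) (leaves (reverse_minus t))"
  using assms
proof (induction t arbitrary: i rule: binary_tree_induct)
  case (Node q l r)
  let ?a = "nleaves l"
  have set: "set (leaves (reverse_minus l)) = set (leaves l)" "set (leaves (reverse_minus r)) = set (leaves r)"
    using Node.hyps by (auto simp: set_leaves_reverse_minus)
  have len: "nleaves (reverse_minus l) = nleaves l" "nleaves (reverse_minus r) = nleaves r"
    using Node.hyps by (auto simp: nleaves_reverse_minus)
  have disj: "set (leaves l) \<inter> set (leaves r) = {}" using Node.prems by auto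
  have la: "Suc (length (ascents l)) = ?a" using length_ascents[OF Node.hyps(1)] .
  have pos: "0 < ?a" "0 < nleaves r" using nleaves_pos[OF Node.hyps(1)] nleaves_pos[OF Node.hyps(2)] .
  consider "Suc i < ?a" | "Suc i = ?a" | "?a \<le> i" by linarith
  then show ?case
  proof cases
    case 1
    then have "leaves l ! i \<in> set (leaves l)" "leaves l ! Suc i \<in> set (leaves l)" by auto
    moreover then have "leaves l ! i \<notin> set (leaves r)" "leaves l ! Suc i \<notin> set (leaves r)"
      using disj by auto
    moreover have "ascents (Node q [l, r]) ! i = ascents l ! i" using 1 la by (auto simp: nth_append)
    ultimately show ?thesis using 1 Node.IH(1)[of i] Node.prems set
      by (cases q) (auto simp: nth_append position_append)
  next
    case 2
    have "leaves l ! i \<in> set (leaves l)" "leaves r ! 0 \<in> set (leaves r)" using 2 pos by auto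
    moreover then have "leaves l ! i \<notin> set (leaves r)" "leaves r ! 0 \<notin> set (leaves l)"
      using disj by auto
    moreover have "ascents (Node q [l, r]) ! i = (q = Plus)"
      using 2 la by (auto simp: nth_append)
    moreover have "(leaves l @ leaves r) ! i = leaves l ! i" "(leaves l @ leaves r) ! Suc i = leaves r ! 0"
      using 2 by (auto simp: nth_append)
    ultimately show ?thesis using set len
        position_less[of "leaves l ! i" "leaves (reverse_minus l)"]
        position_less[of "leaves r ! 0" "leaves (reverse_minus r)"]
      by (cases q) (auto simp: position_append)
  next
    case 3
    define j where "j = i - ?a"
    have j: "i = ?a + j" "Suc j < nleaves r" using 3 Node.prems by (auto simp: j_def)
    then have "leaves r ! j \<in> set (leaves r)" "leaves r ! Suc j \<in> set (leaves r)" by auto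
    moreover then have "leaves r ! j \<notin> set (leaves l)" "leaves r ! Suc j \<notin> set (leaves l)"
      using disj by auto
    moreover have "ascents (Node q [l, r]) ! i = ascents r ! j"
      using j la by (auto simp: nth_append)
    moreover have "(leaves l @ leaves r) ! i = leaves r ! j" "(leaves l @ leaves r) ! Suc i = leaves r ! Suc j"
      using j by (auto simp: nth_append)
    ultimately show ?thesis using j Node.IH(2)[of j] Node.prems set
      by (cases q) (auto simp: position_append)
  qed
qed simp

lemma random_signs_binary:
  "random_signs p (Node u [l, r]) = bind_pmf (sign_pmf p) (\<lambda>q. bind_pmf (random_signs p l) (\<lambda>l'.
     bind_pmf (random_signs p r) (\<lambda>r'. return_pmf (Node q [l', r']))))"
  by (simp add: bind_assoc_pmf bind_return_pmf)

text \<open>Allows \<open>small_mass\<close> to be averaged over trees without signs.\<close>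

lemma set_pmf_random_signs:
  "binary_tree t \<Longrightarrow> t' \<in> set_pmf (random_signs p t) \<Longrightarrow>
     binary_tree t' \<and> leaves t' = leaves t \<and> small_mass s m t' = small_mass s m t"
proof (induction t arbitrary: t' rule: binary_tree_induct)
  case (Node u l r)
  from Node.prems obtain q l' r' where *: "t' = Node q [l', r']"
    "l' \<in> set_pmf (random_signs p l)" "r' \<in> set_pmf (random_signs p r)"
    unfolding random_signs_binary by auto
  from Node.IH(1)[OF *(2)] Node.IH(2)[OF *(3)] show ?case by (simp add: *(1))
qed simp

lemma sequence_pmf_append:
  "sequence_pmf (qs @ rs) =
     bind_pmf (sequence_pmf qs) (\<lambda>xs. bind_pmf (sequence_pmf rs) (\<lambda>ys. return_pmf (xs @ ys)))"
  by (induction qs) (simp_all add: bind_return_pmf bind_return_pmf' bind_assoc_pmf)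

lemma map_take_sequence_pmf: "map_pmf (take n) (sequence_pmf qs) = sequence_pmf (take n qs)"
proof (induction qs arbitrary: n)
  case (Cons q qs)
  show ?case
  proof (cases n)
    case 0
    then show ?thesis by (simp add: map_pmf_const)
  next
    case (Suc n')
    have "map_pmf (take n) (sequence_pmf (q # qs)) =
        bind_pmf q (\<lambda>x. map_pmf ((#) x) (map_pmf (take n') (sequence_pmf qs)))"
      by (simp add: Suc map_bind_pmf pmf.map_comp comp_def flip: map_pmf_def)
    also have "\<dots> = sequence_pmf (take n (q # qs))"
      unfolding Cons by (simp add: Suc map_pmf_def)
    finally show ?thesis .
  qed
qed simp

lemma map_drop_sequence_pmf: "map_pmf (drop n) (sequence_pmf qs) = sequence_pmf (drop n qs)"
proof (induction qs arbitrary: n)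
  case (Cons q qs)
  show ?case
  proof (cases n)
    case (Suc n')
    have "map_pmf (drop n) (sequence_pmf (q # qs)) =
        bind_pmf q (\<lambda>x. map_pmf (drop n') (sequence_pmf qs))"
      by (simp add: Suc map_bind_pmf pmf.map_comp comp_def flip: map_pmf_def)
    then show ?thesis by (simp add: Cons Suc)
  qed (simp add: pmf.map_id0 map_pmf_ident)
qed simp

lemma pmf_sequence_replicate: "pmf (sequence_pmf (replicate r q)) (replicate r x) = pmf q x ^ r"
proof (induction r)
  case (Suc r)
  have "sequence_pmf (replicate (Suc r) q) =
      map_pmf (\<lambda>(x, xs). x # xs) (pair_pmf q (sequence_pmf (replicate r q)))"
    by (simp add: pair_pmf_def map_pmf_def bind_assoc_pmf bind_return_pmf)
  moreover have "pmf (map_pmf (\<lambda>(x, xs). x # xs) (pair_pmf q (sequence_pmf (replicate r q))))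
      ((\<lambda>(x, xs). x # xs) (x, replicate r x)) = pmf (pair_pmf q (sequence_pmf (replicate r q))) (x, replicate r x)"
    by (rule pmf_map_inj') (auto simp: inj_on_def)
  ultimately show ?case using Suc by (simp add: pmf_pair)
qed simp

lemma length_sequence_pmf: "xs \<in> set_pmf (sequence_pmf qs) \<Longrightarrow> length xs = length qs"
  by (induction qs arbitrary: xs) auto

lemma prob_sequence_window:
  assumes "a + r \<le> n"
  shows "measure_pmf.prob (sequence_pmf (replicate n q)) {bs. \<forall>j\<in>{a..<a + r}. bs ! j = x} = pmf q x ^ r"
proof -
  let ?P = "sequence_pmf (replicate n q)"
  have "measure_pmf.prob ?P {bs. \<forall>j\<in>{a..<a + r}. bs ! j = x} =
      measure_pmf.prob ?P ((\<lambda>bs. take r (drop a bs)) -` {replicate r x})"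
  proof (rule measure_pmf.finite_measure_eq_AE)
    show "AE bs in ?P. (bs \<in> {bs. \<forall>j\<in>{a..<a + r}. bs ! j = x}) =
        (bs \<in> (\<lambda>bs. take r (drop a bs)) -` {replicate r x})"
    proof (rule AE_pmfI)
      fix bs assume "bs \<in> set_pmf ?P"
      then have len: "length bs = n" using length_sequence_pmf by fastforce
      then have "take r (drop a bs) = replicate r x \<longleftrightarrow> (\<forall>i<r. bs ! (a + i) = x)"
        using assms by (auto simp: list_eq_iff_nth_eq)
      also have "\<dots> \<longleftrightarrow> (\<forall>j\<in>{a..<a + r}. bs ! j = x)"
        by (metis add_diff_inverse_nat add_less_cancel_left atLeastLessThan_iff le_add1 leD)
      finally show "(bs \<in> {bs. \<forall>j\<in>{a..<a + r}. bs ! j = x}) =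
        (bs \<in> (\<lambda>bs. take r (drop a bs)) -` {replicate r x})" by simp
    qed
  qed simp_all
  also have "\<dots> = measure_pmf.prob (map_pmf (take r) (map_pmf (drop a) ?P)) {replicate r x}"
    by (simp add: pmf.map_comp comp_def)
  also have "map_pmf (take r) (map_pmf (drop a) ?P) = sequence_pmf (replicate r q)"
    using assms by (simp add: map_take_sequence_pmf map_drop_sequence_pmf)
  finally show ?thesis by (simp add: measure_pmf_single pmf_sequence_replicate)
qed

lemma ascents_random_signs:
  "binary_tree t \<Longrightarrow>
    map_pmf ascents (random_signs p t) = sequence_pmf (replicate (nleaves t - 1) (bernoulli_pmf p))"
proof (induction t rule: binary_tree_induct)
  case (Node u l r)
  let ?b = "bernoulli_pmf p"
  have n: "nleaves (Node u [l, r]) - 1 = (nleaves l - 1) + Suc (nleaves r - 1)"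
  proof -
    have "nleaves (Node u [l, r]) = nleaves l + nleaves r" by simp
    then show ?thesis
      using nleaves_pos[OF Node.hyps(1)] nleaves_pos[OF Node.hyps(2)] by linarith
  qed
  have "map_pmf ascents (random_signs p (Node u [l, r])) =
      bind_pmf ?b (\<lambda>b. bind_pmf (random_signs p l) (\<lambda>l'. bind_pmf (random_signs p r) (\<lambda>r'.
        return_pmf (ascents l' @ b # ascents r'))))"
    unfolding random_signs_binary sign_pmf_def
    by (simp add: map_bind_pmf bind_map_pmf if_distrib)
      (rule bind_pmf_cong, auto)
  also have "\<dots> = bind_pmf ?b (\<lambda>b. bind_pmf (map_pmf ascents (random_signs p l)) (\<lambda>x.
      bind_pmf (map_pmf ascents (random_signs p r)) (\<lambda>y. return_pmf (x @ b # y))))"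
    by (simp add: bind_map_pmf)
  \<comment> \<open>The root sign is drawn first but listed between those of the children;
    independence lets the draws be exchanged.\<close>
  also have "\<dots> = bind_pmf (map_pmf ascents (random_signs p l)) (\<lambda>x. bind_pmf ?b (\<lambda>b.
      bind_pmf (map_pmf ascents (random_signs p r)) (\<lambda>y. return_pmf (x @ b # y))))"
    by (rule bind_commute_pmf)
  also have "\<dots> = sequence_pmf (replicate (nleaves l - 1) ?b @ (?b # replicate (nleaves r - 1) ?b))"
    unfolding sequence_pmf_append Node.IH by (simp add: bind_assoc_pmf bind_return_pmf)
  also have "replicate (nleaves l - 1) ?b @ (?b # replicate (nleaves r - 1) ?b) =
      replicate (nleaves (Node u [l, r]) - 1) ?b"
    unfolding n replicate_add by simp
  finally show ?case .
qed simp

lemma binary_trees_eq_trees_on: "binary_trees k = trees_on [1..<Suc k]"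
  by (simp add: binary_trees_def trees_on_def)

text \<open>The law of the signs in in-order is the same for every shape with k leaves, so the
  random choice of the shape averages out.\<close>

lemma ascents_random_signed_tree:
  assumes "1 \<le> k"
  shows "map_pmf ascents (random_signed_tree k p) = sequence_pmf (replicate (k - 1) (bernoulli_pmf p))"
proof -
  have "map_pmf ascents (random_signed_tree k p) =
      bind_pmf (pmf_of_set (binary_trees k)) (\<lambda>t. map_pmf ascents (random_signs p t))"
    by (simp add: random_signed_tree_def map_bind_pmf)
  also have "\<dots> = bind_pmf (pmf_of_set (binary_trees k))
      (\<lambda>t. sequence_pmf (replicate (k - 1) (bernoulli_pmf p)))"
  proof (rule bind_pmf_cong)
    fix t :: "(nat, unit) plane_tree" assume "t \<in> set_pmf (pmf_of_set (binary_trees k))"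
    then have "t \<in> binary_trees k"
      using assms finite_binary_trees binary_trees_nonempty by simp
    then have "binary_tree t" "nleaves t = k" by (auto simp: binary_trees_def)
    then show "map_pmf ascents (random_signs p t) = sequence_pmf (replicate (k - 1) (bernoulli_pmf p))"
      using ascents_random_signs by blast
  qed simp
  finally show ?thesis by simp
qed

lemma set_pmf_random_signed_tree:
  assumes "1 \<le> k" "t \<in> set_pmf (random_signed_tree k p)"
  shows "binary_tree t \<and> leaves t = [1..<Suc k]"
proof -
  from assms obtain u where u: "u \<in> binary_trees k" "t \<in> set_pmf (random_signs p u)"
    using finite_binary_trees binary_trees_nonempty[of k] by (auto simp: random_signed_tree_def)
  then show ?thesis
    using set_pmf_random_signs[of u t p 0 0] by (auto simp: binary_trees_def)
qed

definition monotone_run :: "bool \<Rightarrow> nat \<Rightarrow> nat \<Rightarrow> (nat \<Rightarrow> nat) \<Rightarrow> bool" where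
  "monotone_run b r k \<sigma> \<longleftrightarrow> (\<exists>i\<ge>1. i + r \<le> k \<and> (\<forall>j\<in>{i..<i + r}. (\<sigma> j < \<sigma> (Suc j)) = b))"

text \<open>Union bound over the starting point of the run.\<close>

lemma prob_monotone_run:
  assumes "1 \<le> k"
  shows "measure_pmf.prob (map_pmf tree_perm (random_signed_tree k p)) {\<sigma>. monotone_run b r k \<sigma>}
    \<le> real k * pmf (bernoulli_pmf p) b ^ r"
proof -
  let ?P = "random_signed_tree k p"
  have "measure_pmf.prob (map_pmf tree_perm ?P) {\<sigma>. monotone_run b r k \<sigma>} =
      measure_pmf.prob ?P {t. monotone_run b r k (tree_perm t)}"
    by (simp add: vimage_def)
  also have "\<dots> \<le> measure_pmf.prob (map_pmf ascents ?P)
      (\<Union>i\<in>{i. i + r \<le> k - 1 \<and> i < k}. {bs. \<forall>j\<in>{i..<i + r}. bs ! j = b})"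
    unfolding measure_map_pmf
  proof (rule measure_pmf.finite_measure_mono_AE)
    show "AE t in ?P. t \<in> {t. monotone_run b r k (tree_perm t)} \<longrightarrow>
        t \<in> ascents -` (\<Union>i\<in>{i. i + r \<le> k - 1 \<and> i < k}. {bs. \<forall>j\<in>{i..<i + r}. bs ! j = b})"
    proof (rule AE_pmfI, safe)
      fix t assume "t \<in> set_pmf ?P" "monotone_run b r k (tree_perm t)"
      then have t: "binary_tree t" "leaves t = [1..<Suc k]"
        using set_pmf_random_signed_tree[OF assms] by blast+
      have asc: "ascents t ! j = (tree_perm t (Suc j) < tree_perm t (Suc (Suc j)))" if "Suc j < k" for j
        using ascents_iff[of t j] tree_perm_eq_position[of t] t that by (simp del: upt_Suc)
      obtain i where i: "1 \<le> i" "i + r \<le> k" "\<forall>j\<in>{i..<i + r}. (tree_perm t j < tree_perm t (Suc j)) = b"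
        using \<open>monotone_run b r k (tree_perm t)\<close> unfolding monotone_run_def by blast
      \<comment> \<open>The permutation counts from 1 and \<open>ascents\<close> from 0.\<close>
      have "\<forall>j\<in>{i - 1..<i - 1 + r}. ascents t ! j = b"
      proof
        fix j assume j: "j \<in> {i - 1..<i - 1 + r}"
        then have "Suc j \<in> {i..<i + r}" using i(1) by auto
        moreover have "Suc j < k" using j i by auto
        ultimately show "ascents t ! j = b" using i(3) asc by blast
      qed
      moreover have "i - 1 + r \<le> k - 1" "i - 1 < k" using i by auto
      ultimately show "t \<in> ascents -` (\<Union>i\<in>{i. i + r \<le> k - 1 \<and> i < k}. {bs. \<forall>j\<in>{i..<i + r}. bs ! j = b})"
        by blast
    qed
  qed simp
  also have "\<dots> \<le> (\<Sum>i\<in>{i. i + r \<le> k - 1 \<and> i < k}.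
      measure_pmf.prob (map_pmf ascents ?P) {bs. \<forall>j\<in>{i..<i + r}. bs ! j = b})"
    by (rule measure_pmf.finite_measure_subadditive_finite) auto
  also have "\<dots> = (\<Sum>i\<in>{i. i + r \<le> k - 1 \<and> i < k}. pmf (bernoulli_pmf p) b ^ r)"
    unfolding ascents_random_signed_tree[OF assms] by (intro sum.cong refl prob_sequence_window) auto
  also have "\<dots> = real (card {i. i + r \<le> k - 1 \<and> i < k}) * pmf (bernoulli_pmf p) b ^ r" by simp
  also have "\<dots> \<le> real k * pmf (bernoulli_pmf p) b ^ r"
  proof (intro mult_right_mono)
    have "card {i. i + r \<le> k - 1 \<and> i < k} \<le> card {..<k}" by (rule card_mono) auto
    then show "real (card {i. i + r \<le> k - 1 \<and> i < k}) \<le> real k" by simp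
  qed simp
  finally show ?thesis .
qed

section \<open>Box covers of a random permutation\<close>

definition perm_points :: "nat \<Rightarrow> (nat \<Rightarrow> nat) \<Rightarrow> (real \<times> real) set" where
  "perm_points k \<sigma> = (\<lambda>i. (real i / real k, real (\<sigma> i) / real k)) ` {1..k}"

lemma box_cover_perm_points:
  assumes "1 \<le> k" "binary_tree t" "leaves t = [1..<Suc k]" "box_cover N c d (tree_points t)"
  shows "box_cover N (c / k) (d / k) (perm_points k (tree_perm t))"
proof -
  have "box_cover N (1 / k * c) (1 / k * d) ((*\<^sub>R) (1 / k) ` (+) (1, 1) ` tree_points t)"
    by (intro box_cover_scale box_cover_translation assms) simp
  moreover have "perm_points k (tree_perm t) \<subseteq> (*\<^sub>R) (1 / k) ` (+) (1, 1) ` tree_points t"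
  proof
    fix z assume "z \<in> perm_points k (tree_perm t)"
    then obtain i where i: "1 \<le> i" "i \<le> k" "z = (real i / real k, real (tree_perm t i) / real k)"
      by (auto simp: perm_points_def)
    let ?j = "position i (leaves (reverse_minus t))"
    have mem: "i \<in> set (leaves t)" using i assms(3) by auto
    then have mem': "i \<in> set (leaves (reverse_minus t))" using assms(2) by (simp add: set_leaves_reverse_minus)
    have "tree_perm t i = Suc ?j"
      using tree_perm_eq_position[OF assms(2) _ mem] assms(3) by simp
    moreover have "(real (i - 1), real ?j) \<in> tree_points t"
      using i assms(2,3) position_less[OF mem'] nth_position[OF mem']
      by (intro tree_pointsI) (auto simp: nleaves_reverse_minus simp del: upt_Suc)
    moreover have "real (i - 1) = real i - 1" using i by (simp add: of_nat_diff)
    ultimately have "z = (1 / real k) *\<^sub>R ((1, 1) + (real (i - 1), real ?j))"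
      unfolding i(3) by simp
    then show "z \<in> (*\<^sub>R) (1 / k) ` (+) (1, 1) ` tree_points t"
      using \<open>_ \<in> tree_points t\<close> by blast
  qed
  ultimately show ?thesis by (auto elim: box_cover_mono)
qed

text \<open>Markov's inequality, carried out by counting trees since the signs do not affect
  \<open>small_mass\<close>.\<close>

lemma prob_small_mass:
  fixes a e :: real
  assumes "1 \<le> k" "0 < a"
    and "(\<Sum>t\<in>trees_on [1..<Suc k]. real (small_mass s m t)) \<le> e * k * catalan k"
  shows "measure_pmf.prob (random_signed_tree k p) {t. a * k \<le> small_mass s m t} \<le> e / a"
proof -
  let ?T = "binary_trees k"
  have fin: "finite ?T" "?T \<noteq> {}" using finite_binary_trees binary_trees_nonempty[OF assms(1)] by auto
  have c: "real (card ?T) = catalan k" "0 < catalan k"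
    using card_trees_on[of "[1..<Suc k]"] assms(1) by (auto simp: binary_trees_eq_trees_on catalan_pos)
  have "map_pmf (small_mass s m) (random_signs p t) = return_pmf (small_mass s m t)" if "t \<in> ?T" for t
  proof -
    have "map_pmf (small_mass s m) (random_signs p t) = map_pmf (\<lambda>_. small_mass s m t) (random_signs p t)"
      using that set_pmf_random_signs[of t _ p s m] by (intro map_pmf_cong) (auto simp: binary_trees_def)
    then show ?thesis by (simp add: map_pmf_const)
  qed
  then have "map_pmf (small_mass s m) (random_signed_tree k p) = map_pmf (small_mass s m) (pmf_of_set ?T)"
    unfolding random_signed_tree_def map_bind_pmf
    by (subst map_pmf_def) (intro bind_pmf_cong, use fin in auto)
  then have "measure_pmf.prob (map_pmf (small_mass s m) (random_signed_tree k p)) {x. a * k \<le> x} =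
      measure_pmf.prob (map_pmf (small_mass s m) (pmf_of_set ?T)) {x. a * k \<le> x}" by simp
  then have "measure_pmf.prob (random_signed_tree k p) {t. a * k \<le> small_mass s m t} =
      measure_pmf.prob (pmf_of_set ?T) {t. a * k \<le> small_mass s m t}"
    by (simp add: vimage_def)
  also have "\<dots> = real (card {t \<in> ?T. a * k \<le> small_mass s m t}) / catalan k"
    using fin c by (simp add: measure_pmf_of_set Int_def)
  also have "\<dots> \<le> e / a"
  proof -
    have "a * k * real (card {t \<in> ?T. a * k \<le> small_mass s m t}) =
        (\<Sum>t\<in>{t \<in> ?T. a * k \<le> small_mass s m t}. a * k)" by simp
    also have "\<dots> \<le> (\<Sum>t\<in>{t \<in> ?T. a * k \<le> small_mass s m t}. real (small_mass s m t))"
      by (intro sum_mono) auto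
    also have "\<dots> \<le> (\<Sum>t\<in>?T. real (small_mass s m t))"
      by (intro sum_mono2 fin) auto
    also have "\<dots> \<le> e * k * catalan k" using assms(3) by (simp add: binary_trees_eq_trees_on)
    finally have "a * real (card {t \<in> ?T. a * k \<le> small_mass s m t}) \<le> e * catalan k"
      using assms(1) by (simp add: mult.assoc mult.left_commute mult_le_cancel_left_pos)
    then show ?thesis using c(2) assms(2) by (simp add: field_simps)
  qed
  finally show ?thesis .
qed

lemma prob_box_cover:
  assumes "0 < \<delta>" "0 < \<epsilon>" "0 < \<gamma>"
  shows "\<exists>N k0. \<forall>k\<ge>k0. 1 - \<gamma> \<le> measure_pmf.prob (map_pmf tree_perm (random_signed_tree k p))
    {\<sigma>. box_cover N (sqrt 2 + \<epsilon>) \<delta> (perm_points k \<sigma>)}"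
proof -
  \<comment> \<open>Once the small mass is below a k, its share 4 a of the total is at most
    \<epsilon>, and 2 a \<le> \<delta> limits a single box.\<close>
  define a where "a = min (\<epsilon> / 4) (\<delta> / 2)"
  have a: "0 < a" "4 * a \<le> \<epsilon>" "2 * a \<le> \<delta>" using assms by (auto simp: a_def min_def)
  \<comment> \<open>The failure probability e / a in Markov's inequality becomes \<gamma>.\<close>
  define e where "e = a * \<gamma>"
  have e: "0 < e" using a assms by (simp add: e_def)
  \<comment> \<open>The ratio of s - 1 to m - 1 that \<open>cbsum_ratio\<close> asks for.\<close>
  define \<rho> where "\<rho> = e\<^sup>2 / (2 * (1 + e)\<^sup>2)"
  have \<rho>: "0 < \<rho>" "\<rho> \<le> 1 / 2" "2 * (1 + e)\<^sup>2 * \<rho> = e\<^sup>2"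
  proof -
    have "e\<^sup>2 \<le> (1 + e)\<^sup>2" "0 < (1 + e)\<^sup>2" using e by (auto intro!: power_mono)
    then show "0 < \<rho>" "\<rho> \<le> 1 / 2" "2 * (1 + e)\<^sup>2 * \<rho> = e\<^sup>2" using e by (auto simp: \<rho>_def)
  qed
  \<comment> \<open>m is \<theta> k up to rounding; as \<theta> k \<ge> 2, this still gives 2 m
    \<le> 4 \<theta> k \<le> \<delta> k.\<close>
  define \<theta> where "\<theta> = min (\<delta> / 4) (1 / 2)"
  have \<theta>: "0 < \<theta>" "4 * \<theta> \<le> \<delta>" "\<theta> \<le> 1 / 2" using assms by (auto simp: \<theta>_def min_def)
  \<comment> \<open>s is \<eta> k up to rounding. The factor 1/2 pays for rounding m, because
    \<theta> k / 2 \<le> m - 1.\<close>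
  define \<eta> where "\<eta> = \<rho> * \<theta> / 2"
  have \<eta>: "0 < \<eta>" using \<rho> \<theta> by (simp add: \<eta>_def)
  \<comment> \<open>Bounds 10 k / s for all k at once, since s > \<eta> k.\<close>
  define N where "N = nat \<lceil>10 / \<eta>\<rceil>"
  have N: "10 / \<eta> \<le> real N" unfolding N_def by linarith
  have "1 - \<gamma> \<le> measure_pmf.prob (map_pmf tree_perm (random_signed_tree k p))
    {\<sigma>. box_cover N (sqrt 2 + \<epsilon>) \<delta> (perm_points k \<sigma>)}" if k0: "nat \<lceil>2 / \<theta>\<rceil> \<le> k" for k
  proof -
    have "2 / \<theta> \<le> real k" using k0 by linarith
    then have tk: "2 \<le> \<theta> * k" using \<theta> by (simp add: field_simps)
    have "\<theta> * k \<le> 1 / 2 * k" using \<theta> by (intro mult_right_mono) auto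
    then have k: "4 \<le> k" using tk by simp
    define m where "m = nat \<lfloor>\<theta> * k\<rfloor> + 1"
    define s where "s = nat \<lfloor>\<eta> * k\<rfloor> + 1"
    have m: "\<theta> * k < real m" "real m \<le> \<theta> * k + 1" using tk unfolding m_def by linarith+
    have "0 \<le> \<eta> * k" using \<eta> by simp
    then have s: "\<eta> * k < real s" "real s \<le> \<eta> * k + 1" unfolding s_def by linarith+
    have "\<eta> * k = \<rho> * (\<theta> * k / 2)" by (simp add: \<eta>_def)
    also have "\<dots> \<le> \<rho> * (real m - 1)" using \<rho> m tk by (intro mult_left_mono) auto
    finally have sm: "real s - 1 \<le> \<rho> * (real m - 1)" using s by simp
    have "\<rho> * (real m - 1) \<le> 1 / 2 * (real m - 1)" using \<rho> by (intro mult_right_mono) (auto simp: m_def)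
    also have "\<dots> = real m / 2 - 1 / 2" by (simp add: field_simps)
    finally have slm: "s < m" "1 < m" using sm m tk s_def by linarith+
    have s1: "1 \<le> s" by (simp add: s_def)
    have "real m \<le> k" using m \<open>\<theta> * k \<le> 1 / 2 * k\<close> k by linarith
    then have mk: "m \<le> k" by simp
    have "2 * (1 + e)\<^sup>2 * (real s - 1) \<le> 2 * (1 + e)\<^sup>2 * (\<rho> * (real m - 1))"
      by (intro mult_left_mono sm) simp
    also have "\<dots> = e\<^sup>2 * (real m - 1)" unfolding mult.assoc[symmetric] \<rho>(3) ..
    finally have ratio: "cbsum (s - 1) \<le> e * (cbsum (m - 1) - cbsum (s - 1))"
      by (rule cbsum_ratio[OF e s1 slm(2)])
    have "(\<Sum>t\<in>trees_on [1..<Suc k]. real (small_mass s m t)) \<le> e * k * catalan k"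
      using sum_small_mass_le[OF _ s1 slm(1) _ ratio, of "[1..<Suc k]"] mk e
      by (simp del: upt_Suc)
    then have "measure_pmf.prob (random_signed_tree k p) {t. a * k \<le> small_mass s m t} \<le> \<gamma>"
      using prob_small_mass[of k a s m e p] a k by (simp add: e_def)
    then have "1 - \<gamma> \<le> 1 - measure_pmf.prob (random_signed_tree k p) {t. a * k \<le> small_mass s m t}" by simp
    also have "\<dots> = measure_pmf.prob (random_signed_tree k p) (- {t. a * k \<le> small_mass s m t})"
      using measure_pmf.prob_compl[of "{t. a * k \<le> small_mass s m t}" "random_signed_tree k p"]
      by (simp add: Compl_eq_Diff_UNIV)
    also have "\<dots> \<le> measure_pmf.prob (random_signed_tree k p)
        (tree_perm -` {\<sigma>. box_cover N (sqrt 2 + \<epsilon>) \<delta> (perm_points k \<sigma>)})"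
    proof (intro measure_pmf.finite_measure_mono_AE AE_pmfI impI)
      fix t assume "t \<in> set_pmf (random_signed_tree k p)" "t \<in> - {t. a * k \<le> small_mass s m t}"
      then have t: "binary_tree t" "leaves t = [1..<Suc k]" "real (small_mass s m t) < a * k"
        using set_pmf_random_signed_tree[of k t p] k by auto
      have nt: "nleaves t = k" using t(2) by (metis diff_Suc_1 length_upt)
      have "2 * real m \<le> \<delta> * k"
      proof -
        have "4 * \<theta> * k \<le> \<delta> * k" using \<theta> by (intro mult_right_mono) auto
        then show ?thesis using m tk by linarith
      qed
      moreover have "2 * real (small_mass s m t) \<le> \<delta> * k"
      proof -
        have "2 * (a * k) = 2 * a * k" by simp
        also have "\<dots> \<le> \<delta> * k" using a by (intro mult_right_mono) auto
        finally show ?thesis using t(3) by linarith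
      qed
      ultimately obtain N' where N': "real N' \<le> 10 * real k / s"
        "box_cover N' (sqrt 2 * k + 4 * real (small_mass s m t)) (\<delta> * k) (tree_points t)"
        using box_cover_tree[of t s m "\<delta> * k"] t(1) s1 slm(1) mk unfolding nt t(2)
        by (auto simp del: upt_Suc)
      have "10 * real k / s \<le> 10 * real k / (\<eta> * k)"
        using s(1) s1 \<eta> k by (intro divide_left_mono) auto
      also have "\<dots> = 10 / \<eta>" using k by simp
      finally have "10 * real k / s \<le> 10 / \<eta>" .
      then have "N' \<le> N" using N'(1) N by linarith
      moreover have "(sqrt 2 * k + 4 * real (small_mass s m t)) / k \<le> sqrt 2 + \<epsilon>"
      proof -
        have "4 * real (small_mass s m t) \<le> 4 * a * k" using t(3) by simp
        also have "\<dots> \<le> \<epsilon> * k" using a by (intro mult_right_mono) auto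
        finally show ?thesis using k by (simp add: field_simps)
      qed
      moreover have "box_cover N' ((sqrt 2 * k + 4 * real (small_mass s m t)) / k) (\<delta> * k / k)
          (perm_points k (tree_perm t))"
        using box_cover_perm_points[OF _ t(1,2) N'(2)] k by simp
      ultimately have "box_cover N (sqrt 2 + \<epsilon>) \<delta> (perm_points k (tree_perm t))"
        using k by (elim box_cover_mono) auto
      then show "t \<in> tree_perm -` {\<sigma>. box_cover N (sqrt 2 + \<epsilon>) \<delta> (perm_points k \<sigma>)}"
        by simp
    qed simp
    finally show ?thesis by simp
  qed
  then show ?thesis by blast
qed

section \<open>Passage from sampled permutations to the random permuton\<close>

section \<open>Sampling from a random permuton\<close>

lemma permutonsD:
  assumes "\<nu> \<in> permutons"
  shows "sets \<nu> = sets borel" "prob_space \<nu>" "AE z in \<nu>. z \<in> {0..1} \<times> {0..1}"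
    "distr \<nu> borel fst = uniform_measure lborel {0..1}"
    "distr \<nu> borel snd = uniform_measure lborel {0..1}" "space \<nu> = UNIV"
  using assms sets_eq_imp_space_eq[of \<nu> borel] by (auto simp: permutons_def)

lemma topspace_weak_permuton_topology: "topspace weak_permuton_topology \<subseteq> permutons"
  unfolding weak_permuton_topology_def topology_generated_by_topspace by auto

lemma openin_weak_permuton_topology: "{S. openin weak_permuton_topology S} \<subseteq> Pow permutons"
  using topspace_weak_permuton_topology openin_subset by fastforce

lemma space_permuton_space: "space permuton_space = permutons"
  unfolding permuton_space_def by (rule space_measure_of[OF openin_weak_permuton_topology])

lemma measurable_integral_permuton:
  fixes f :: "real \<times> real \<Rightarrow> real"
  assumes \<mu>: "\<mu> \<in> measurable M permuton_space" and f: "continuous_on UNIV f" "bounded (range f)"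
  shows "(\<lambda>\<omega>. LINT z|\<mu> \<omega>. f z) \<in> borel_measurable M"
proof (rule borel_measurableI)
  fix V :: "real set" assume V: "open V"
  let ?A = "{\<nu> \<in> permutons. (LINT z|\<nu>. f z) \<in> V}"
  have "openin weak_permuton_topology ?A"
    unfolding weak_permuton_topology_def by (rule topology_generated_by_Basis) (use f V in blast)
  then have "?A \<in> sets permuton_space"
    unfolding permuton_space_def sets_measure_of[OF openin_weak_permuton_topology] by auto
  then have "\<mu> -` ?A \<inter> space M \<in> sets M" by (rule measurable_sets[OF \<mu>])
  also have "\<mu> -` ?A \<inter> space M = (\<lambda>\<omega>. LINT z|\<mu> \<omega>. f z) -` V \<inter> space M"
    using measurable_space[OF \<mu>] space_permuton_space by auto
  finally show "(\<lambda>\<omega>. LINT z|\<mu> \<omega>. f z) -` V \<inter> space M \<in> sets M" .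
qed

lemma random_permuton_space:
  assumes "random_permuton M \<mu>" "\<omega> \<in> space M"
  shows "\<mu> \<omega> \<in> permutons"
  using assms measurable_space[of \<mu> M permuton_space \<omega>]
  by (simp add: random_permuton_def space_permuton_space)

text \<open>Turns measurability for the weak topology into measurability as a kernel: open sets form
  a generating class stable under intersection, and their measures are limits of integrals of
  continuous functions.\<close>

lemma measurable_random_permuton:
  assumes \<mu>: "random_permuton M \<mu>"
  shows "\<mu> \<in> measurable M (prob_algebra borel)"
proof (rule measurable_prob_algebra_generated[where \<Omega> = UNIV and G = "{S. open S}"])
  show "Int_stable {S :: (real \<times> real) set. open S}" by (auto simp: Int_stable_def)
  show "sets borel = sigma_sets UNIV {S :: (real \<times> real) set. open S}"
    by (simp add: borel_def)
  fix \<omega> assume "\<omega> \<in> space M"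
  from permutonsD[OF random_permuton_space[OF \<mu> this]]
  show "prob_space (\<mu> \<omega>)" "sets (\<mu> \<omega>) = sets borel" by auto
next
  fix U :: "(real \<times> real) set" assume "U \<in> {S. open S}"
  then have U: "open U" by simp
  show "(\<lambda>\<omega>. emeasure (\<mu> \<omega>) U) \<in> borel_measurable M"
  proof (cases "U = UNIV")
    case True
    have "emeasure (\<mu> \<omega>) U = 1" if "\<omega> \<in> space M" for \<omega>
      using permutonsD[OF random_permuton_space[OF \<mu> that]] prob_space.emeasure_space_1 True by metis
    then have "(\<lambda>\<omega>. emeasure (\<mu> \<omega>) U) \<in> borel_measurable M \<longleftrightarrow> (\<lambda>\<omega>. 1 :: ennreal) \<in> borel_measurable M"
      by (rule measurable_cong)
    then show ?thesis by simp
  next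
    case False
    \<comment> \<open>These functions tend to the indicator of U. For U = UNIV they would vanish,
      since \<open>infdist\<close> to the empty set is 0; hence the case distinction.\<close>
    define f where "f n z = min 1 (real n * infdist z (- U))" for n :: nat and z :: "real \<times> real"
    have fcont: "continuous_on UNIV (f n)" for n
      unfolding f_def by (intro continuous_intros)
    have f01: "0 \<le> f n z" "f n z \<le> 1" for n z by (auto simp: f_def infdist_nonneg)
    have "bounded (range (f n))" for n
      by (rule boundedI[of _ 1]) (use f01 in auto)
    then have meas: "(\<lambda>\<omega>. LINT z|\<mu> \<omega>. f n z) \<in> borel_measurable M" for n
      using \<mu> fcont by (intro measurable_integral_permuton) (auto simp: random_permuton_def)
    have lim: "(\<lambda>n. f n z) \<longlonglongrightarrow> indicator U z" for z
    proof (cases "z \<in> U")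
      case True
      have "closed (- U)" "- U \<noteq> {}" using U False by auto
      then have pos: "0 < infdist z (- U)"
        using True in_closed_iff_infdist_zero[of "- U" z] infdist_nonneg[of z "- U"] by (simp add: less_le)
      obtain n0 :: nat where n0: "1 / infdist z (- U) < n0" using reals_Archimedean2 by blast
      have "f n z = 1" if "n0 \<le> n" for n
      proof -
        have "1 / infdist z (- U) \<le> real n" using n0 that by linarith
        then show ?thesis using pos by (simp add: f_def field_simps)
      qed
      then show ?thesis using True
        by (intro tendsto_eventually eventually_sequentiallyI[of n0]) simp
    next
      case False
      then show ?thesis by (simp add: f_def)
    qed
    have conv: "(\<lambda>n. LINT z|\<mu> \<omega>. f n z) \<longlonglongrightarrow> measure (\<mu> \<omega>) U" if "\<omega> \<in> space M" for \<omega>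
    proof -
      note p = permutonsD[OF random_permuton_space[OF \<mu> that]]
      interpret prob_space "\<mu> \<omega>" by (rule p)
      have bm: "borel_measurable (\<mu> \<omega>) = (borel_measurable borel :: (real \<times> real \<Rightarrow> real) set)"
        by (rule measurable_cong_sets[OF p(1) refl])
      have "(\<lambda>n. LINT z|\<mu> \<omega>. f n z) \<longlonglongrightarrow> (LINT z|\<mu> \<omega>. indicator U z)"
      proof (rule integral_dominated_convergence[where w = "\<lambda>_. 1"])
        show "f n \<in> borel_measurable (\<mu> \<omega>)" for n
          unfolding bm using fcont by (rule borel_measurable_continuous_onI)
        show "indicator U \<in> borel_measurable (\<mu> \<omega>)"
          using U p(1) by (intro borel_measurable_indicator) simp
        show "AE x in \<mu> \<omega>. (\<lambda>i. f i x) \<longlonglongrightarrow> indicator U x" using lim by simp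
        show "AE x in \<mu> \<omega>. norm (f i x) \<le> 1" for i using f01 by simp
      qed simp
      then show ?thesis using U p(1) by simp
    qed
    have "(\<lambda>\<omega>. measure (\<mu> \<omega>) U) \<in> borel_measurable M"
      by (rule borel_measurable_LIMSEQ_real[OF conv meas])
    then have "(\<lambda>\<omega>. ennreal (measure (\<mu> \<omega>) U)) \<in> borel_measurable M" by simp
    moreover have "emeasure (\<mu> \<omega>) U = ennreal (measure (\<mu> \<omega>) U)" if "\<omega> \<in> space M" for \<omega>
    proof -
      interpret prob_space "\<mu> \<omega>" by (rule permutonsD[OF random_permuton_space[OF \<mu> that]])
      show ?thesis by (rule emeasure_eq_measure)
    qed
    ultimately show ?thesis by (simp cong: measurable_cong)
  qed
qed auto

abbreviation sample_space :: "nat \<Rightarrow> (nat \<Rightarrow> real \<times> real) measure" where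
  "sample_space k \<equiv> \<Pi>\<^sub>M i\<in>{1..k}. borel"

lemma sets_PiM_borel:
  "sets \<nu> = sets borel \<Longrightarrow> sets (\<Pi>\<^sub>M i\<in>{1..k}. \<nu>) = sets (sample_space k)"
  by (rule sets_PiM_cong) auto

text \<open>Rectangles generate the product sigma-algebra, and on them the product measure is a
  finite product of measurable functions of \<omega>.\<close>

lemma measurable_PiM_kernel:
  assumes \<mu>: "random_permuton M \<mu>"
  shows "(\<lambda>\<omega>. \<Pi>\<^sub>M i\<in>{1..k}. \<mu> \<omega>) \<in> measurable M (prob_algebra (sample_space k))"
proof (rule measurable_prob_algebra_generated[OF sets_PiM])
  let ?B = "\<lambda>i :: nat. borel :: (real \<times> real) measure"
  show "Int_stable (prod_algebra {1..k} ?B)" by (rule Int_stable_prod_algebra)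
  show "prod_algebra {1..k} ?B \<subseteq> Pow (\<Pi>\<^sub>E i\<in>{1..k}. space (?B i))"
    by (rule prod_algebra_sets_into_space)
  fix \<omega> assume \<omega>: "\<omega> \<in> space M"
  note p = permutonsD[OF random_permuton_space[OF \<mu> \<omega>]]
  show "prob_space (\<Pi>\<^sub>M i\<in>{1..k}. \<mu> \<omega>)" by (intro prob_space_PiM p)
  show "sets (\<Pi>\<^sub>M i\<in>{1..k}. \<mu> \<omega>) = sets (sample_space k)" by (rule sets_PiM_borel[OF p(1)])
next
  fix A assume "A \<in> prod_algebra {1..k} (\<lambda>i :: nat. borel :: (real \<times> real) measure)"
  then obtain E where E: "A = Pi\<^sub>E {1..k} E" "E \<in> (\<Pi> i\<in>{1..k}. sets borel)"
    by (rule prod_algebraE_all)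
  have "emeasure (\<Pi>\<^sub>M i\<in>{1..k}. \<mu> \<omega>) A = (\<Prod>i\<in>{1..k}. emeasure (\<mu> \<omega>) (E i))" if "\<omega> \<in> space M" for \<omega>
  proof -
    note p = permutonsD[OF random_permuton_space[OF \<mu> that]]
    interpret prob_space "\<mu> \<omega>" by (rule p)
    interpret product_prob_space "\<lambda>_. \<mu> \<omega>" "{1..k}" by standard
    show ?thesis unfolding E(1) by (rule emeasure_PiM) (use E(2) p(1) in auto)
  qed
  moreover have "(\<lambda>\<omega>. \<Prod>i\<in>{1..k}. emeasure (\<mu> \<omega>) (E i)) \<in> borel_measurable M"
  proof (rule borel_measurable_prod_ennreal)
    fix i assume "i \<in> {1..k}"
    then have "E i \<in> sets borel" using E(2) by auto
    then show "(\<lambda>\<omega>. emeasure (\<mu> \<omega>) (E i)) \<in> borel_measurable M"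
      using measurable_prob_algebraD[OF measurable_random_permuton[OF \<mu>]] measurable_emeasure_kernel
      by blast
  qed
  ultimately show "(\<lambda>\<omega>. emeasure (\<Pi>\<^sub>M i\<in>{1..k}. \<mu> \<omega>) A) \<in> borel_measurable M"
    by (simp cong: measurable_cong)
qed

text \<open>\<^const>\<open>points_perm\<close> depends only on the finitely many comparisons of coordinates, whatever
  value \<open>THE\<close> takes in case of ties.\<close>

lemma measurable_points_perm: "points_perm k \<in> measurable (sample_space k) (count_space UNIV)"
proof -
  let ?N = "sample_space k"
  let ?S = "{1..k} \<times> {1..k}"
  define T where "T z = ({(i, j) \<in> ?S. fst (z i) < fst (z j)}, {(i, j) \<in> ?S. snd (z i) < snd (z j)})"
    for z :: "nat \<Rightarrow> real \<times> real"
  define R where "R t = (THE \<alpha>. \<alpha> permutes {1..k} \<and>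
     (\<forall>i\<in>{1..k}. \<forall>j\<in>{1..k}. \<alpha> i < \<alpha> j \<longleftrightarrow> (i, j) \<in> t))" for t
  have R: "rank_perm k (\<lambda>i. fst (z i)) = R (fst (T z))" "rank_perm k (\<lambda>i. snd (z i)) = R (snd (T z))" for z
    unfolding rank_perm_def R_def T_def by (auto intro!: arg_cong[of _ _ The] cong: conj_cong)
  have eq: "points_perm k = (\<lambda>t. R (snd t) \<circ> inv (R (fst t))) \<circ> T"
    by (rule ext) (simp add: points_perm_def R)
  have comp: "(\<lambda>z. f (z i)) \<in> borel_measurable ?N"
    if "i \<in> {1..k}" "continuous_on UNIV f" for i and f :: "real \<times> real \<Rightarrow> real"
    using measurable_component_singleton[OF that(1)] borel_measurable_continuous_onI[OF that(2)]
    by (rule measurable_compose)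
  have less: "{z \<in> space ?N. (f (z i) < f (z j)) = b} \<in> sets ?N"
    if "f = fst \<or> f = snd" "i \<in> {1..k}" "j \<in> {1..k}" for i j b and f :: "real \<times> real \<Rightarrow> real"
  proof -
    have "continuous_on UNIV f" using that(1) by (auto intro!: continuous_intros)
    then show ?thesis using comp[OF that(2)] comp[OF that(3)]
      by (cases b) (auto simp: not_less intro: borel_measurable_less borel_measurable_le)
  qed
  have "T \<in> measurable ?N (count_space (Pow ?S \<times> Pow ?S))"
  proof (subst measurable_count_space_eq2, simp, intro conjI ballI)
    show "T \<in> space ?N \<rightarrow> Pow ?S \<times> Pow ?S" by (auto simp: T_def)
    fix t assume "t \<in> Pow ?S \<times> Pow ?S"
    then have t: "fst t \<subseteq> ?S" "snd t \<subseteq> ?S" by auto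
    have "T -` {t} \<inter> space ?N = {z \<in> space ?N. \<forall>i\<in>{1..k}. \<forall>j\<in>{1..k}.
        (fst (z i) < fst (z j) \<longleftrightarrow> (i, j) \<in> fst t) \<and> (snd (z i) < snd (z j) \<longleftrightarrow> (i, j) \<in> snd t)}"
    proof -
      have "T z = t \<longleftrightarrow> (\<forall>i\<in>{1..k}. \<forall>j\<in>{1..k}.
        (fst (z i) < fst (z j) \<longleftrightarrow> (i, j) \<in> fst t) \<and> (snd (z i) < snd (z j) \<longleftrightarrow> (i, j) \<in> snd t))" for z
        using t unfolding T_def prod_eq_iff by fastforce
      then show ?thesis by auto
    qed
    also have "\<dots> \<in> sets ?N"
      by (intro sets.sets_Collect_finite_All sets.sets_Collect_conj less) auto
    finally show "T -` {t} \<inter> space ?N \<in> sets ?N" .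
  qed
  then show ?thesis unfolding eq by (rule measurable_comp) simp
qed

lemma emeasure_subperm_law:
  assumes \<mu>: "random_permuton M \<mu>"
  shows "emeasure (subperm_law M \<mu> k) A =
    (\<integral>\<^sup>+\<omega>. emeasure (\<Pi>\<^sub>M i\<in>{1..k}. \<mu> \<omega>) {z \<in> space (sample_space k). points_perm k z \<in> A} \<partial>M)"
proof -
  interpret prob_space M using \<mu> by (simp add: random_permuton_def)
  note ker = measurable_prob_algebraD[OF measurable_PiM_kernel[OF \<mu>, of k]]
  let ?B = "M \<bind> (\<lambda>\<omega>. \<Pi>\<^sub>M i\<in>{1..k}. \<mu> \<omega>)"
  have sB: "sets ?B = sets (sample_space k)" 
    by (rule sets_bind[OF _ not_empty])
       (rule sets_PiM_borel[OF permutonsD(1)[OF random_permuton_space[OF \<mu>]]])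
  then have spB: "space ?B = space (sample_space k)" by (rule sets_eq_imp_space_eq)
  have "points_perm k \<in> measurable ?B (count_space UNIV)"
    using measurable_points_perm measurable_cong_sets[OF sB refl] by blast
  then have "emeasure (subperm_law M \<mu> k) A = emeasure ?B (points_perm k -` A \<inter> space ?B)"
    unfolding subperm_law_def by (intro emeasure_distr) auto
  also have "points_perm k -` A \<inter> space ?B = {z \<in> space (sample_space k). points_perm k z \<in> A}"
    unfolding spB by auto
  also have "emeasure ?B \<dots> = (\<integral>\<^sup>+\<omega>. emeasure (\<Pi>\<^sub>M i\<in>{1..k}. \<mu> \<omega>) {z \<in> space (sample_space k). points_perm k z \<in> A} \<partial>M)"
  proof (rule emeasure_bind[OF not_empty ker])
    have "points_perm k -` A \<inter> space (sample_space k) \<in> sets (sample_space k)"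
      by (rule measurable_sets[OF measurable_points_perm]) simp
    then show "{z \<in> space (sample_space k). points_perm k z \<in> A} \<in> sets (sample_space k)"
      by (simp add: vimage_def Int_def conj_commute)
  qed
  finally show ?thesis .
qed

text \<open>The conditional probability given the permuton; its mean over \<omega> is what the tree
  model prescribes.\<close>

definition pattern_prob :: "(real \<times> real) measure \<Rightarrow> nat \<Rightarrow> ((nat \<Rightarrow> nat) \<Rightarrow> bool) \<Rightarrow> real" where
  "pattern_prob \<nu> k P = measure (\<Pi>\<^sub>M i\<in>{1..k}. \<nu>) {z \<in> space (sample_space k). P (points_perm k z)}"

lemma sets_pattern: "{z \<in> space (sample_space k). P (points_perm k z)} \<in> sets (sample_space k)"
proof -
  have "points_perm k -` Collect P \<inter> space (sample_space k) \<in> sets (sample_space k)"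
    by (rule measurable_sets[OF measurable_points_perm]) simp
  then show ?thesis by (simp add: vimage_def Int_def conj_commute)
qed

lemma measurable_pattern_prob:
  assumes "random_permuton M \<mu>"
  shows "(\<lambda>\<omega>. pattern_prob (\<mu> \<omega>) k P) \<in> borel_measurable M"
proof -
  have "(\<lambda>\<omega>. emeasure (\<Pi>\<^sub>M i\<in>{1..k}. \<mu> \<omega>) {z \<in> space (sample_space k). P (points_perm k z)}) \<in> borel_measurable M"
    using measurable_emeasure_kernel[OF measurable_prob_algebraD[OF measurable_PiM_kernel[OF assms]] sets_pattern] .
  then show ?thesis unfolding pattern_prob_def measure_def by simp
qed

lemma pattern_prob_bounds:
  assumes "random_permuton M \<mu>" "\<omega> \<in> space M"
  shows "0 \<le> pattern_prob (\<mu> \<omega>) k P" "pattern_prob (\<mu> \<omega>) k P \<le> 1"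
proof -
  interpret P: prob_space "\<Pi>\<^sub>M i\<in>{1..k}. \<mu> \<omega>"
    by (intro prob_space_PiM permutonsD[OF random_permuton_space[OF assms]])
  show "0 \<le> pattern_prob (\<mu> \<omega>) k P" "pattern_prob (\<mu> \<omega>) k P \<le> 1"
    unfolding pattern_prob_def by (rule measure_nonneg, rule P.prob_le_1)
qed

text \<open>The only place where the prescribed laws of the sampled permutations enter.\<close>

lemma integral_pattern_prob:
  assumes "brownian_separable_permuton p M \<mu>" "1 \<le> k"
  shows "integrable M (\<lambda>\<omega>. pattern_prob (\<mu> \<omega>) k P)"
    and "(LINT \<omega>|M. pattern_prob (\<mu> \<omega>) k P) =
      measure_pmf.prob (map_pmf tree_perm (random_signed_tree k p)) {\<sigma>. P \<sigma>}"
proof -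
  have \<mu>: "random_permuton M \<mu>" using assms by (simp add: brownian_separable_permuton_def)
  interpret prob_space M using \<mu> by (simp add: random_permuton_def)
  show int: "integrable M (\<lambda>\<omega>. pattern_prob (\<mu> \<omega>) k P)"
    by (rule integrable_const_bound[of _ 1]) 
       (use pattern_prob_bounds[OF \<mu>] measurable_pattern_prob[OF \<mu>] in auto)
  have "ennreal (LINT \<omega>|M. pattern_prob (\<mu> \<omega>) k P) = (\<integral>\<^sup>+\<omega>. ennreal (pattern_prob (\<mu> \<omega>) k P) \<partial>M)"
    by (rule nn_integral_eq_integral[symmetric, OF int]) (use pattern_prob_bounds[OF \<mu>] in auto)
  also have "\<dots> = (\<integral>\<^sup>+\<omega>. emeasure (\<Pi>\<^sub>M i\<in>{1..k}. \<mu> \<omega>) {z \<in> space (sample_space k). points_perm k z \<in> Collect P} \<partial>M)"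
  proof (rule nn_integral_cong)
    fix \<omega> assume \<omega>: "\<omega> \<in> space M"
    interpret P: prob_space "\<Pi>\<^sub>M i\<in>{1..k}. \<mu> \<omega>"
      by (intro prob_space_PiM permutonsD[OF random_permuton_space[OF \<mu> \<omega>]])
    show "ennreal (pattern_prob (\<mu> \<omega>) k P) =
      emeasure (\<Pi>\<^sub>M i\<in>{1..k}. \<mu> \<omega>) {z \<in> space (sample_space k). points_perm k z \<in> Collect P}"
      unfolding pattern_prob_def by (simp only: P.emeasure_eq_measure mem_Collect_eq)
  qed
  also have "\<dots> = emeasure (subperm_law M \<mu> k) {\<sigma>. P \<sigma>}"
    unfolding emeasure_subperm_law[OF \<mu>] ..
  also have "subperm_law M \<mu> k = measure_pmf (map_pmf tree_perm (random_signed_tree k p))"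
    using assms by (simp add: brownian_separable_permuton_def)
  finally have "ennreal (LINT \<omega>|M. pattern_prob (\<mu> \<omega>) k P) =
      ennreal (measure_pmf.prob (map_pmf tree_perm (random_signed_tree k p)) {\<sigma>. P \<sigma>})"
    unfolding measure_pmf.emeasure_eq_measure .
  moreover have "0 \<le> (LINT \<omega>|M. pattern_prob (\<mu> \<omega>) k P)"
    by (rule integral_nonneg_AE) (use pattern_prob_bounds[OF \<mu>] in auto)
  ultimately show "(LINT \<omega>|M. pattern_prob (\<mu> \<omega>) k P) =
      measure_pmf.prob (map_pmf tree_perm (random_signed_tree k p)) {\<sigma>. P \<sigma>}"
    by (simp only: ennreal_inj[OF _ measure_nonneg])
qed

section \<open>Ranks\<close>

text \<open>An explicit counterpart of \<open>rank_perm\<close>, with which it agrees on distinct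
  values.\<close>

definition sample_rank :: "nat \<Rightarrow> (nat \<Rightarrow> real) \<Rightarrow> nat \<Rightarrow> nat" where
  "sample_rank k x i = card {j \<in> {1..k}. x j \<le> x i}"

lemma rank_less_iff:
  assumes "i \<in> {1..k}" "j \<in> {1..k}"
  shows "sample_rank k x i < sample_rank k x j \<longleftrightarrow> x i < x j"
proof -
  have mono: "sample_rank k x i \<le> sample_rank k x j" if "x i \<le> x j" for i j
    unfolding sample_rank_def by (rule card_mono) (use that in auto)
  have "sample_rank k x i < sample_rank k x j" if "x i < x j"
  proof -
    have "j \<in> {l \<in> {1..k}. x l \<le> x j} - {l \<in> {1..k}. x l \<le> x i}"
      "{l \<in> {1..k}. x l \<le> x i} \<subseteq> {l \<in> {1..k}. x l \<le> x j}"
      using that assms by auto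
    then have "{l \<in> {1..k}. x l \<le> x i} \<subset> {l \<in> {1..k}. x l \<le> x j}" by blast
    then show ?thesis unfolding sample_rank_def by (intro psubset_card_mono) simp_all
  qed
  then show ?thesis using mono[of j i] by force
qed

lemma rank_bij:
  assumes "inj_on x {1..k}"
  shows "bij_betw (sample_rank k x) {1..k} {1..k}"
proof -
  have "inj_on (sample_rank k x) {1..k}"
  proof (rule inj_onI)
    fix i j assume *: "i \<in> {1..k}" "j \<in> {1..k}" "sample_rank k x i = sample_rank k x j"
    then have "x i = x j" using rank_less_iff[of i k j x] rank_less_iff[of j k i x] by auto
    then show "i = j" by (rule inj_onD[OF assms _ *(1,2)])
  qed
  moreover have "sample_rank k x ` {1..k} \<subseteq> {1..k}"
  proof
    fix r assume "r \<in> sample_rank k x ` {1..k}"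
    then obtain i where i: "i \<in> {1..k}" "r = sample_rank k x i" by blast
    have "sample_rank k x i \<le> card {1..k}" unfolding sample_rank_def by (rule card_mono) auto
    moreover have "{j \<in> {1..k}. x j \<le> x i} \<noteq> {}" using i by auto
    then have "0 < sample_rank k x i" unfolding sample_rank_def by (simp add: card_gt_0_iff)
    ultimately show "r \<in> {1..k}" using i by simp
  qed
  ultimately show ?thesis
    unfolding bij_betw_def by (simp add: endo_inj_surj)
qed

text \<open>The description is met by one permutation only: any \<beta> with the required order maps
  the indices j with x j \<le> x i onto {1..\<beta> i}, so \<beta> i is their number.\<close>

lemma rank_perm_eq:
  assumes "inj_on x {1..k}" "i \<in> {1..k}"
  shows "rank_perm k x permutes {1..k}" "rank_perm k x i = sample_rank k x i"
proof -
  define \<alpha> where "\<alpha> i = (if i \<in> {1..k} then sample_rank k x i else i)" for i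
  have bij: "bij_betw \<alpha> {1..k} {1..k}"
    using rank_bij[OF assms(1)] by (subst bij_betw_cong[of _ _ "sample_rank k x"]) (auto simp: \<alpha>_def)
  have perm: "\<alpha> permutes {1..k}"
    by (rule bij_imp_permutes[OF bij]) (auto simp: \<alpha>_def)
  have ord: "\<forall>i\<in>{1..k}. \<forall>j\<in>{1..k}. \<alpha> i < \<alpha> j \<longleftrightarrow> x i < x j"
    using rank_less_iff by (auto simp: \<alpha>_def)
  have "\<beta> = \<alpha>" if \<beta>: "\<beta> permutes {1..k}" "\<forall>i\<in>{1..k}. \<forall>j\<in>{1..k}. \<beta> i < \<beta> j \<longleftrightarrow> x i < x j" for \<beta>
  proof
    fix i show "\<beta> i = \<alpha> i"
    proof (cases "i \<in> {1..k}")
      case True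
      have "\<beta> ` {j \<in> {1..k}. x j \<le> x i} = {1..\<beta> i}"
      proof (intro equalityI subsetI)
        fix y assume "y \<in> \<beta> ` {j \<in> {1..k}. x j \<le> x i}"
        then obtain j where j: "j \<in> {1..k}" "x j \<le> x i" "y = \<beta> j" by blast
        have "\<beta> j \<in> {1..k}" using permutes_in_image[OF \<beta>(1), of j] j(1) by simp
        moreover have "\<not> \<beta> i < \<beta> j" using \<beta>(2)[rule_format, OF True j(1)] j(2) by simp
        ultimately show "y \<in> {1..\<beta> i}" using j(3) by simp
      next
        fix y assume y: "y \<in> {1..\<beta> i}"
        then have "y \<in> {1..k}" using permutes_in_image[OF \<beta>(1), of i] True by auto
        then obtain j where j: "j \<in> {1..k}" "y = \<beta> j"
          using permutes_image[OF \<beta>(1)] by blast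
        have "\<not> \<beta> i < \<beta> j" using y j(2) by simp
        then have "x j \<le> x i" using \<beta>(2)[rule_format, OF True j(1)] by simp
        then show "y \<in> \<beta> ` {j \<in> {1..k}. x j \<le> x i}" using j by blast
      qed
      then have "\<beta> i = card (\<beta> ` {j \<in> {1..k}. x j \<le> x i})" by simp
      also have "\<dots> = card {j \<in> {1..k}. x j \<le> x i}"
        by (rule card_image) (use permutes_inj_on[OF \<beta>(1)] in auto)
      finally show ?thesis using True by (simp add: \<alpha>_def sample_rank_def)
    next
      case False
      then show ?thesis using permutes_not_in[OF \<beta>(1)] permutes_not_in[OF perm] by simp
    qed
  qed
  then have "rank_perm k x = \<alpha>"
    unfolding rank_perm_def using perm ord by (intro the_equality conjI) (assumption, assumption, blast)
  then show "rank_perm k x permutes {1..k}" "rank_perm k x i = sample_rank k x i"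
    using perm assms(2) by (simp_all add: \<alpha>_def)
qed

text \<open>Identifies the graph of the sampled permutation with the pairs of ranks of the sample
  points, which can be compared with the points themselves.\<close>

lemma points_perm_rank:
  assumes "inj_on (\<lambda>i. fst (z i)) {1..k}" "inj_on (\<lambda>i. snd (z i)) {1..k}" "i \<in> {1..k}"
  shows "points_perm k z (sample_rank k (\<lambda>i. fst (z i)) i) = sample_rank k (\<lambda>i. snd (z i)) i"
proof -
  have "inv (rank_perm k (\<lambda>i. fst (z i))) (rank_perm k (\<lambda>i. fst (z i)) i) = i"
    using permutes_inj[OF rank_perm_eq(1)[OF assms(1,3)]] by (rule inv_f_f)
  then show ?thesis
    using rank_perm_eq(2)[OF assms(1,3)] rank_perm_eq(2)[OF assms(2,3)] by (simp add: points_perm_def)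
qed

section \<open>The law of large numbers\<close>

lemma indep_vars_PiM_coordinates:
  assumes "prob_space \<nu>" "I \<noteq> {}"
  shows "prob_space.indep_vars (\<Pi>\<^sub>M i\<in>I. \<nu>) (\<lambda>_. \<nu>) (\<lambda>i z. z i) I"
proof -
  interpret P: prob_space "\<Pi>\<^sub>M i\<in>I. \<nu>" by (intro prob_space_PiM assms)
  show ?thesis
  proof (subst P.indep_vars_iff_distr_eq_PiM'[OF assms(2)])
    have "distr (\<Pi>\<^sub>M i\<in>I. \<nu>) (\<Pi>\<^sub>M i\<in>I. \<nu>) (\<lambda>x. \<lambda>i\<in>I. x i) = distr (\<Pi>\<^sub>M i\<in>I. \<nu>) (\<Pi>\<^sub>M i\<in>I. \<nu>) (\<lambda>x. x)"
      by (rule distr_cong) (auto simp: space_PiM PiE_restrict)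
    also have "\<dots> = (\<Pi>\<^sub>M i\<in>I. \<nu>)" by simp
    also have "\<dots> = (\<Pi>\<^sub>M i\<in>I. distr (\<Pi>\<^sub>M i\<in>I. \<nu>) \<nu> (\<lambda>x. x i))"
      by (rule PiM_cong) (use distr_PiM_component[of I "\<lambda>_. \<nu>"] assms(1) in auto)
    finally show "distr (\<Pi>\<^sub>M i\<in>I. \<nu>) (\<Pi>\<^sub>M i\<in>I. \<nu>) (\<lambda>x. \<lambda>i\<in>I. x i) = (\<Pi>\<^sub>M i\<in>I. distr (\<Pi>\<^sub>M i\<in>I. \<nu>) \<nu> (\<lambda>x. x i))" .
  qed auto
qed

text \<open>Hoeffding's inequality for indicators, in a form that shows the geometric decay in
  k.\<close>

lemma empirical_deviation:
  assumes \<nu>: "prob_space \<nu>" and D: "D \<in> sets \<nu>" and k: "1 \<le> k" and \<tau>: "0 < \<tau>"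
  shows "measure (\<Pi>\<^sub>M i\<in>{1..k}. \<nu>) {z \<in> space (\<Pi>\<^sub>M i\<in>{1..k}. \<nu>).
      \<tau> * k \<le> \<bar>real (card {i \<in> {1..k}. z i \<in> D}) - k * measure \<nu> D\<bar>} \<le> 2 * exp (- 2 * \<tau>\<^sup>2) ^ k"
proof -
  let ?P = "\<Pi>\<^sub>M i\<in>{1..k}. \<nu>"
  interpret P: prob_space ?P by (intro prob_space_PiM \<nu>)
  let ?X = "\<lambda>i z. indicat_real D (z i)"
  have dist1: "distr ?P borel (?X i) = distr \<nu> borel (indicat_real D)" if "i \<in> {1..k}" for i
  proof -
    have "distr ?P borel (?X i) = distr (distr ?P \<nu> (\<lambda>z. z i)) borel (indicat_real D)"
      by (subst distr_distr) (use that D in \<open>auto simp: comp_def\<close>)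
    also have "distr ?P \<nu> (\<lambda>z. z i) = \<nu>"
      using distr_PiM_component[of "{1..k}" "\<lambda>_. \<nu>" i] \<nu> that by simp
    finally show ?thesis .
  qed
  interpret H: Hoeffding_ineq_iid ?P "{1..k}" ?X "?X 1" 0 1 "P.expectation (?X 1)"
  proof unfold_locales
    have "P.indep_vars (\<lambda>_. \<nu>) (\<lambda>i z. z i) {1..k}"
      by (rule indep_vars_PiM_coordinates[OF \<nu>]) (use k in auto)
    then show "P.indep_vars (\<lambda>_. borel) ?X {1..k}"
      by (rule P.indep_vars_compose2) (use D in auto)
    show "distr ?P borel (?X i) = distr ?P borel (?X 1)" if "i \<in> {1..k}" for i
      using dist1[OF that] dist1[of 1] k by simp
    show "?X 1 \<in> borel_measurable ?P" 
    proof (rule measurable_compose[where N = \<nu>])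
      show "(\<lambda>z. z 1) \<in> measurable ?P \<nu>" by (rule measurable_component_singleton) (use k in auto)
    qed (use D in auto)
  qed (auto simp: indicator_def)
  have "P.expectation (?X 1) = integral\<^sup>L (distr ?P \<nu> (\<lambda>z. z 1)) (indicat_real D)"
    by (rule integral_distr[symmetric]) (use k D in auto)
  also have "distr ?P \<nu> (\<lambda>z. z 1) = \<nu>"
    using distr_PiM_component[of "{1..k}" "\<lambda>_. \<nu>" 1] \<nu> k by simp
  finally have ex: "P.expectation (?X 1) = measure \<nu> D"
    using D \<nu> sets.sets_into_space[OF D] by (simp add: Int_absorb1 Int_commute)
  have sum: "(\<Sum>i\<in>{1..k}. ?X i z) = real (card {i \<in> {1..k}. z i \<in> D})" for z
    by (simp add: indicator_def sum.If_cases Int_def)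
  have "P.prob {z \<in> space ?P. \<tau> * k \<le> \<bar>real (card {i \<in> {1..k}. z i \<in> D}) - k * measure \<nu> D\<bar>} \<le>
      2 * exp (- 2 * (\<tau> * k)\<^sup>2 / (k * (1 - 0)\<^sup>2))"
    using H.Hoeffding_ineq_abs_ge[of "\<tau> * k"] \<tau> k unfolding sum ex by simp
  also have "- 2 * (\<tau> * k)\<^sup>2 / (k * (1 - 0)\<^sup>2) = real k * (- 2 * \<tau>\<^sup>2)"
    using k by (simp add: power2_eq_square)
  finally show ?thesis by (simp only: exp_of_nat_mult)
qed

lemma measure_coordinate:
  assumes \<nu>: "\<nu> \<in> permutons" and c: "c = fst \<or> c = snd" and B: "B \<in> sets borel"
  shows "{u. c u \<in> B} \<in> sets borel" "measure \<nu> {u. c u \<in> B} = measure lborel ({0..1} \<inter> B)"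
proof -
  have c': "c \<in> borel_measurable borel"
    using c by (auto intro!: borel_measurable_continuous_onI continuous_intros)
  from measurable_sets[OF this B] show sets: "{u. c u \<in> B} \<in> sets borel" by (simp add: vimage_def)
  have m: "c \<in> measurable \<nu> borel"
    using c' permutonsD(1)[OF \<nu>] measurable_cong_sets by blast
  have d: "distr \<nu> borel c = uniform_measure lborel {0..1}"
    using c permutonsD[OF \<nu>] by auto
  have "measure \<nu> {u. c u \<in> B} = measure (distr \<nu> borel c) B"
    using measure_distr[OF m B] permutonsD(6)[OF \<nu>] by (simp add: vimage_def)
  also have "\<dots> = measure lborel ({0..1} \<inter> B)"
    unfolding d by (subst measure_uniform_measure) (use B in auto)
  finally show "measure \<nu> {u. c u \<in> B} = measure lborel ({0..1} \<inter> B)" .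
qed

lemma emeasure_PiM_two:
  assumes "prob_space \<nu>" "i \<in> I" "j \<in> I" "i \<noteq> j" "A \<in> sets \<nu>"
  shows "emeasure (\<Pi>\<^sub>M i\<in>I. \<nu>) {z \<in> space (\<Pi>\<^sub>M i\<in>I. \<nu>). z i \<in> A \<and> z j \<in> A} = emeasure \<nu> A * emeasure \<nu> A"
proof -
  interpret prob_space \<nu> by fact
  interpret product_prob_space "\<lambda>_. \<nu>" I by standard
  show ?thesis using emeasure_PiM_Collect[of "{i, j}" "\<lambda>_. A"] assms by simp
qed

text \<open>The diagonal of the unit square lies in n squares of side 1 / n, each of product measure
  at most 1 / n^2 by the uniform marginal; altogether 1 / n.\<close>

lemma AE_no_tie:
  assumes \<nu>: "\<nu> \<in> permutons" and c: "c = fst \<or> c = snd" and ij: "i \<in> {1..k}" "j \<in> {1..k}" "i \<noteq> j"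
  shows "AE z in \<Pi>\<^sub>M i\<in>{1..k}. \<nu>. c (z i) \<noteq> c (z j)"
proof -
  note p = permutonsD[OF \<nu>]
  let ?P = "\<Pi>\<^sub>M i\<in>{1..k}. \<nu>"
  interpret prob_space \<nu> by (rule p)
  interpret P: prob_space ?P by (intro prob_space_PiM p)
  define T where "T = {z \<in> space ?P. c (z i) = c (z j) \<and> c (z i) \<in> {0..1}}"
  have c': "c \<in> borel_measurable borel"
    using c by (auto intro!: borel_measurable_continuous_onI continuous_intros)
  have c\<nu>: "c \<in> borel_measurable \<nu>" using c' p(1) measurable_cong_sets by blast
  have m: "(\<lambda>z. c (z l)) \<in> borel_measurable ?P" if "l \<in> {1..k}" for l
    by (rule measurable_compose[OF measurable_component_singleton[OF that] c\<nu>])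
  have T: "T \<in> sets ?P"
  proof -
    have 1: "{z \<in> space ?P. c (z i) = c (z j)} \<in> sets ?P"
      by (rule borel_measurable_eq[OF m m]) (use ij in auto)
    have 2: "{z \<in> space ?P. c (z i) \<in> {0..1}} \<in> sets ?P"
      using measurable_sets[OF m[OF ij(1)], of "{0..1}"] by (simp add: vimage_def Int_def conj_commute)
    have "T = {z \<in> space ?P. c (z i) = c (z j)} \<inter> {z \<in> space ?P. c (z i) \<in> {0..1}}"
      unfolding T_def by blast
    then show ?thesis using sets.Int[OF 1 2] by simp
  qed
  have bound: "measure ?P T \<le> 1 / real n" if n: "0 < n" for n :: nat
  proof -
    define I where "I q = {u. c u \<in> {real q / n..(real q + 1) / n}}" for q
    have I: "I q \<in> sets \<nu>" for q unfolding I_def p(1) by (rule measure_coordinate[OF \<nu> c]) simp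
    have mI: "measure \<nu> (I q) \<le> 1 / n" for q
    proof -
      have "measure \<nu> (I q) = measure lborel ({0..1} \<inter> {real q / n..(real q + 1) / n})"
        unfolding I_def by (rule measure_coordinate[OF \<nu> c]) simp
      also have "\<dots> \<le> measure lborel {real q / n..(real q + 1) / n}"
        by (intro measure_mono_fmeasurable fmeasurable_compact) auto
      also have "\<dots> = 1 / n" using n by (simp add: field_simps)
      finally show ?thesis .
    qed
    define W where "W q = {z \<in> space ?P. z i \<in> I q \<and> z j \<in> I q}" for q
    have W: "W q \<in> sets ?P" for q
      unfolding W_def using measurable_sets[OF measurable_component_singleton[OF ij(1)] I]
        measurable_sets[OF measurable_component_singleton[OF ij(2)] I]
      by (intro sets.sets_Collect_conj) (simp_all add: vimage_def Int_def conj_commute)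
    have mW: "measure ?P (W q) \<le> (1 / n) * (1 / n)" for q
    proof -
      have "emeasure ?P (W q) = emeasure \<nu> (I q) * emeasure \<nu> (I q)"
        unfolding W_def by (rule emeasure_PiM_two[OF p(2) ij I])
      then have "measure ?P (W q) = measure \<nu> (I q) * measure \<nu> (I q)"
        by (simp add: measure_def enn2real_mult)
      also have "\<dots> \<le> (1 / n) * (1 / n)" using mI by (intro mult_mono) auto
      finally show ?thesis .
    qed
    have "T \<subseteq> (\<Union>q\<in>{..<n}. W q) \<union> {}"
    proof
      fix z assume z: "z \<in> T"
      define x where "x = c (z i)"
      have x: "0 \<le> x" "x \<le> 1" "c (z j) = x" using z by (auto simp: T_def x_def)
      \<comment> \<open>The minimum puts the endpoint x = 1 into the last cell.\<close>
      define q where "q = min (nat \<lfloor>n * x\<rfloor>) (n - 1)"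
      have "q < n" using n by (auto simp: q_def)
      moreover have "real q / n \<le> x" 
      proof -
        have "real q \<le> n * x" unfolding q_def using x by (auto simp: min_def) linarith+
        then show ?thesis using n by (simp add: field_simps)
      qed
      moreover have "x \<le> (real q + 1) / n"
      proof (cases "nat \<lfloor>n * x\<rfloor> \<le> n - 1")
        case True
        then have "real q = real_of_int \<lfloor>n * x\<rfloor>" using x by (simp add: q_def)
        then have "n * x \<le> real q + 1" by linarith
        then show ?thesis using n by (simp add: field_simps)
      next
        case False
        then have "real q + 1 = n" using n by (simp add: q_def of_nat_diff)
        then show ?thesis using x n by simp
      qed
      ultimately show "z \<in> (\<Union>q\<in>{..<n}. W q) \<union> {}"
        using z x(3) by (auto simp: W_def I_def x_def T_def)
    qed
    then have "measure ?P T \<le> measure ?P (\<Union>q\<in>{..<n}. W q)"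
      using W by (intro P.finite_measure_mono) auto
    also have "\<dots> \<le> (\<Sum>q\<in>{..<n}. measure ?P (W q))"
      using W by (intro P.finite_measure_subadditive_finite) auto
    also have "\<dots> \<le> (\<Sum>q\<in>{..<n}. (1 / n) * (1 / n))" by (intro sum_mono mW)
    also have "\<dots> = 1 / n" using n by simp
    finally show ?thesis .
  qed
  have "measure ?P T \<le> 0"
  proof (rule field_le_epsilon)
    fix e :: real assume "0 < e"
    then obtain n :: nat where "0 < n" "1 / n < e"
      using reals_Archimedean[of e] by (metis inverse_eq_divide zero_less_Suc)
    then show "measure ?P T \<le> 0 + e" using bound[of n] by simp
  qed
  then have "emeasure ?P T = 0" by (simp add: P.emeasure_eq_measure measure_le_0_iff)
  then have "T \<in> null_sets ?P" using T by auto
  then have 1: "AE z in ?P. z \<notin> T" by (rule AE_not_in)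
  have "AE z in ?P. z i \<in> {0..1} \<times> {0..1}"
    using AE_PiM_component[of "{1..k}" "\<lambda>_. \<nu>" i "\<lambda>u. u \<in> {0..1} \<times> {0..1}"] p ij by simp
  with 1 AE_space show ?thesis
    by eventually_elim (use c in \<open>auto simp: T_def mem_Times_iff\<close>)
qed

lemma AE_inj_coordinate:
  fixes k :: nat
  assumes "\<nu> \<in> permutons" "c = fst \<or> c = snd"
  shows "AE z in \<Pi>\<^sub>M i\<in>{1..k}. \<nu>. inj_on (\<lambda>i. c (z i)) {1..k}"
proof -
  let ?P = "\<Pi>\<^sub>M i\<in>{1..k}. \<nu>"
  have "AE z in ?P. fst ij \<noteq> snd ij \<longrightarrow> c (z (fst ij)) \<noteq> c (z (snd ij))"
    if "ij \<in> {1..k} \<times> {1..k}" for ij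
  proof (cases "fst ij = snd ij")
    case True
    then show ?thesis by (intro AE_I2) blast
  next
    case False
    have "AE z in ?P. c (z (fst ij)) \<noteq> c (z (snd ij))"
      using that False by (intro AE_no_tie[OF assms]) (simp_all add: mem_Times_iff)
    then show ?thesis by (rule eventually_mono) blast
  qed
  then have *: "\<forall>ij\<in>{1..k} \<times> {1..k}. AE z in ?P. fst ij \<noteq> snd ij \<longrightarrow> c (z (fst ij)) \<noteq> c (z (snd ij))"
    by blast
  have fin: "finite ({1..k} \<times> {1..k})" by simp
  have "AE z in ?P. \<forall>ij\<in>{1..k} \<times> {1..k}. fst ij \<noteq> snd ij \<longrightarrow> c (z (fst ij)) \<noteq> c (z (snd ij))"
    by (rule eventually_ball_finite[OF fin *])
  then show ?thesis
  proof (rule eventually_mono)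
    fix z assume z: "\<forall>ij\<in>{1..k} \<times> {1..k}. fst ij \<noteq> snd ij \<longrightarrow> c (z (fst ij)) \<noteq> c (z (snd ij))"
    show "inj_on (\<lambda>i. c (z i)) {1..k}"
    proof (rule inj_onI, rule ccontr)
      fix i j assume "i \<in> {1..k}" "j \<in> {1..k}" "c (z i) = c (z j)" "i \<noteq> j"
      then show False using bspec[OF z, of "(i, j)"] by simp
    qed
  qed
qed

text \<open>The deterministic arguments below use a sample only through these properties.\<close>

definition good_sample :: "(real \<times> real) measure \<Rightarrow> (real \<times> real) set set \<Rightarrow> real \<Rightarrow> (real \<times> real) set \<Rightarrow>
    nat \<Rightarrow> (nat \<Rightarrow> real \<times> real) \<Rightarrow> bool" where
  "good_sample \<nu> \<D> \<tau> G k z \<longleftrightarrow> inj_on (\<lambda>i. fst (z i)) {1..k} \<and> inj_on (\<lambda>i. snd (z i)) {1..k} \<and>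
     (\<forall>i\<in>{1..k}. z i \<in> G) \<and> (\<forall>D\<in>\<D>. \<bar>real (card {i \<in> {1..k}. z i \<in> D}) - k * measure \<nu> D\<bar> < \<tau> * k)"

text \<open>The deviation bounds for the finitely many test sets sum to a quantity tending to 0. As
  G may be any conull set, measurable or not, an event E inside the good samples is obtained by
  removing a null set.\<close>

lemma good_samples_likely:
  assumes \<nu>: "\<nu> \<in> permutons" and D: "finite \<D>" "\<D> \<subseteq> sets borel" and \<tau>: "0 < \<tau>"
    and G: "AE u in \<nu>. u \<in> G"
  shows "\<exists>k0. \<forall>k\<ge>k0. \<exists>E\<in>sets (sample_space k). 1 / 2 < measure (\<Pi>\<^sub>M i\<in>{1..k}. \<nu>) E \<and>
    (\<forall>z\<in>E. good_sample \<nu> \<D> \<tau> G k z)"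
proof -
  note p = permutonsD[OF \<nu>]
  define q where "q = exp (- 2 * \<tau>\<^sup>2)"
  have q: "0 \<le> q" "q < 1" using \<tau> by (auto simp: q_def)
  have "(\<lambda>k. real (card \<D>) * (2 * q ^ k)) \<longlonglongrightarrow> real (card \<D>) * (2 * 0)"
    by (intro tendsto_intros LIMSEQ_power_zero) (use q in auto)
  then have "\<forall>\<^sub>F k in sequentially. real (card \<D>) * (2 * q ^ k) < 1 / 2"
    by (rule order_tendstoD) simp
  then obtain k0 where k0: "\<And>k. k0 \<le> k \<Longrightarrow> real (card \<D>) * (2 * q ^ k) < 1 / 2"
    unfolding eventually_sequentially by blast
  show ?thesis
  proof (intro exI[of _ "max 1 k0"] allI impI)
    fix k assume k: "max 1 k0 \<le> k"
    let ?P = "\<Pi>\<^sub>M i\<in>{1..k}. \<nu>"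
    interpret P: prob_space ?P by (intro prob_space_PiM p)
    define B where "B D = {z \<in> space ?P. \<tau> * k \<le> \<bar>real (card {i \<in> {1..k}. z i \<in> D}) - k * measure \<nu> D\<bar>}" for D
    have B: "B D \<in> sets ?P" if "D \<in> \<D>" for D
    proof -
      have D': "D \<in> sets \<nu>" using that D p(1) by auto
      have eq: "(\<lambda>z. real (card {i \<in> {1..k}. z i \<in> D})) = (\<lambda>z. \<Sum>i\<in>{1..k}. indicat_real D (z i))"
        by (rule ext) (simp add: indicator_def sum.If_cases Int_def)
      have [measurable]: "(\<lambda>z. real (card {i \<in> {1..k}. z i \<in> D})) \<in> borel_measurable ?P"
        unfolding eq by (intro borel_measurable_sum measurable_compose[OF measurable_component_singleton]
            borel_measurable_indicator D')
      show ?thesis unfolding B_def by measurable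
    qed
    have "measure ?P (\<Union>D\<in>\<D>. B D) \<le> (\<Sum>D\<in>\<D>. measure ?P (B D))"
      using B D by (intro P.finite_measure_subadditive_finite) auto
    also have "\<dots> \<le> (\<Sum>D\<in>\<D>. 2 * q ^ k)"
      unfolding B_def q_def using D p(1) k \<tau>
      by (intro sum_mono empirical_deviation p) auto
    also have "\<dots> < 1 / 2" using k0[of k] k by simp
    finally have small: "measure ?P (\<Union>D\<in>\<D>. B D) < 1 / 2" .
    have UB: "(\<Union>D\<in>\<D>. B D) \<in> sets ?P" using B D by (intro sets.finite_UN) auto
    have *: "\<forall>i\<in>{1..k}. AE z in ?P. z i \<in> G"
      using AE_PiM_component[of "{1..k}" "\<lambda>_. \<nu>" _ "\<lambda>u. u \<in> G"] p(2) G by blast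
    have fin: "finite {1..k}" by simp
    have "AE z in ?P. \<forall>i\<in>{1..k}. z i \<in> G"
      by (rule eventually_ball_finite[OF fin *])
    with AE_inj_coordinate[OF \<nu>, of fst k] AE_inj_coordinate[OF \<nu>, of snd k]
    have "AE z in ?P. inj_on (\<lambda>i. fst (z i)) {1..k} \<and> inj_on (\<lambda>i. snd (z i)) {1..k} \<and> (\<forall>i\<in>{1..k}. z i \<in> G)"
      by (simp add: AE_conj_iff)
    then obtain N where N: "{z \<in> space ?P. \<not> (inj_on (\<lambda>i. fst (z i)) {1..k} \<and>
        inj_on (\<lambda>i. snd (z i)) {1..k} \<and> (\<forall>i\<in>{1..k}. z i \<in> G))} \<subseteq> N" "N \<in> null_sets ?P"
      by (elim AE_E) (auto intro: null_setsI)
    define E where "E = space ?P - (\<Union>D\<in>\<D>. B D) - N"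
    have E: "E \<in> sets ?P" unfolding E_def using UB N(2) by auto
    have "measure ?P E = measure ?P (space ?P - (\<Union>D\<in>\<D>. B D))"
      unfolding E_def using N(2) UB by (intro measure_Diff_null_set) auto
    also have "\<dots> = 1 - measure ?P (\<Union>D\<in>\<D>. B D)" by (rule P.prob_compl[OF UB])
    finally have "1 / 2 < measure ?P E" using small by simp
    moreover have "good_sample \<nu> \<D> \<tau> G k z" if "z \<in> E" for z
      using that N(1) unfolding E_def good_sample_def B_def by (auto simp: not_le)
    ultimately show "\<exists>E\<in>sets (sample_space k). 1 / 2 < measure ?P E \<and> (\<forall>z\<in>E. good_sample \<nu> \<D> \<tau> G k z)"
      using E sets_PiM_borel[OF p(1)] by blast
  qed
qed

text \<open>Good samples fill an event of probability above 1/2, so a pattern of probability at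
  least 1/2 must occur in one of them. The first clause serves the covers, the second the monotone
  strips.\<close>

lemma good_sample_pattern_prob:
  assumes \<nu>: "\<nu> \<in> permutons" and D: "finite \<D>" "\<D> \<subseteq> sets borel" and \<tau>: "0 < \<tau>"
    and G: "AE u in \<nu>. u \<in> G"
  obtains k0 where "\<And>k P. k0 \<le> k \<Longrightarrow> 1 / 2 \<le> pattern_prob \<nu> k P \<Longrightarrow>
      \<exists>z. good_sample \<nu> \<D> \<tau> G k z \<and> P (points_perm k z)"
    and "\<And>k P. k0 \<le> k \<Longrightarrow> (\<And>z. good_sample \<nu> \<D> \<tau> G k z \<Longrightarrow> P (points_perm k z)) \<Longrightarrow>
      1 / 2 \<le> pattern_prob \<nu> k P"
proof -
  note p = permutonsD[OF \<nu>]
  obtain k0 where k0: "\<And>k. k0 \<le> k \<Longrightarrow> \<exists>E\<in>sets (sample_space k). 1 / 2 < measure (\<Pi>\<^sub>M i\<in>{1..k}. \<nu>) E \<and>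
    (\<forall>z\<in>E. good_sample \<nu> \<D> \<tau> G k z)" using good_samples_likely[OF assms] by blast
  show ?thesis
  proof (rule that[of k0])
    fix k and P :: "(nat \<Rightarrow> nat) \<Rightarrow> bool" assume k: "k0 \<le> k"
    let ?P = "\<Pi>\<^sub>M i\<in>{1..k}. \<nu>"
    interpret P: prob_space ?P by (intro prob_space_PiM p)
    let ?F = "{z \<in> space (sample_space k). P (points_perm k z)}"
    have F: "?F \<in> sets ?P" using sets_pattern sets_PiM_borel[OF p(1)] by blast
    obtain E where E: "E \<in> sets ?P" "1 / 2 < measure ?P E" "\<And>z. z \<in> E \<Longrightarrow> good_sample \<nu> \<D> \<tau> G k z"
      using k0[OF k] sets_PiM_borel[OF p(1)] by blast
    show "\<exists>z. good_sample \<nu> \<D> \<tau> G k z \<and> P (points_perm k z)" if "1 / 2 \<le> pattern_prob \<nu> k P"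
    proof (rule ccontr)
      assume "\<not> ?thesis"
      then have "E \<inter> ?F = {}" using E(3) by blast
      then have "measure ?P (E \<union> ?F) = measure ?P E + measure ?P ?F"
        using E(1) F by (intro P.finite_measure_Union)
      then show False using E(2) that P.prob_le_1[of "E \<union> ?F"] unfolding pattern_prob_def by linarith
    qed
    show "1 / 2 \<le> pattern_prob \<nu> k P" if "\<And>z. good_sample \<nu> \<D> \<tau> G k z \<Longrightarrow> P (points_perm k z)"
    proof -
      have "space ?P = space (sample_space k)" using sets_PiM_borel[OF p(1)] by (rule sets_eq_imp_space_eq)
      then have "E \<subseteq> ?F" using E(3) that sets.sets_into_space[OF E(1)] by blast
      then have "measure ?P E \<le> measure ?P ?F" using F by (rule P.finite_measure_mono)
      then show ?thesis using E(2) unfolding pattern_prob_def by linarith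
    qed
  qed
qed

section \<open>Box covers of the support\<close>

text \<open>Moving both corners of a box outwards by (r, r) lengthens the diagonal by at most 2 norm
  (r, r) \<le> 4 r. The total grows with the number of boxes, which is why \<open>box_cover\<close>
  records it.\<close>

lemma box_cover_thicken:
  assumes "box_cover N c d S" "0 \<le> r" and S': "\<And>u. u \<in> S' \<Longrightarrow> \<exists>v\<in>S. \<bar>fst u - fst v\<bar> \<le> r \<and> \<bar>snd u - snd v\<bar> \<le> r"
  shows "box_cover N (c + 4 * r * N) (d + 4 * r) S'"
proof -
  obtain R where R: "length R \<le> N" "(\<Sum>(u, v)\<leftarrow>R. dist u v) \<le> c"
    "\<forall>(u, v)\<in>set R. dist u v \<le> d" "S \<subseteq> (\<Union>(u, v)\<in>set R. cbox u v)"
    using assms(1) unfolding box_cover_def by blast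
  define f where "f = (\<lambda>(u, v). (u - (r, r), v + (r, r)) :: (real \<times> real) \<times> (real \<times> real))"
  have nr: "norm (r, r) \<le> 2 * r" using assms(2) sqrt_sum_squares_le_sum_abs[of r r] by (simp add: norm_Pair)
  have d: "dist (u - (r, r)) (v + (r, r)) \<le> dist u v + 4 * r" for u v :: "real \<times> real"
  proof -
    have "dist (u - (r, r)) (v + (r, r)) = norm ((u - v) - ((r, r) + (r, r)))"
      by (simp add: dist_norm algebra_simps)
    also have "\<dots> \<le> norm (u - v) + (norm (r, r) + norm (r, r))"
      using norm_triangle_ineq4[of "u - v" "(r, r) + (r, r)"] norm_triangle_ineq[of "(r, r)" "(r, r)"] by linarith
    finally show ?thesis using nr by (simp add: dist_norm)
  qed
  have "(\<Sum>(u, v)\<leftarrow>map f R. dist u v) \<le> (\<Sum>(u, v)\<leftarrow>R. dist u v) + 4 * r * length R"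
  proof (induction R)
    case (Cons a R)
    then show ?case using d[of "fst a" "snd a"]
      by (simp add: f_def case_prod_unfold algebra_simps)
  qed simp
  also have "\<dots> \<le> c + 4 * r * N"
    using R(1,2) assms(2) by (intro add_mono mult_left_mono) auto
  finally have 1: "(\<Sum>(u, v)\<leftarrow>map f R. dist u v) \<le> c + 4 * r * N" .
  have 2: "dist u v \<le> d + 4 * r" if "(u, v) \<in> set (map f R)" for u v
  proof -
    from that obtain u' v' where uv: "(u', v') \<in> set R" "u = u' - (r, r)" "v = v' + (r, r)"
      by (auto simp: f_def)
    then have "dist u' v' \<le> d" using R(3) by auto
    then show ?thesis using d[of u' v'] uv by simp
  qed
  have 3: "S' \<subseteq> (\<Union>(u, v)\<in>set (map f R). cbox u v)"
  proof
    fix w assume "w \<in> S'"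
    then obtain v where v: "v \<in> S" "\<bar>fst w - fst v\<bar> \<le> r" "\<bar>snd w - snd v\<bar> \<le> r" using S' by blast
    then obtain a b where ab: "(a, b) \<in> set R" "v \<in> cbox a b" using R(4) by auto
    have "w \<in> cbox (a - (r, r)) (b + (r, r))"
      using v(2,3) ab(2) by (cases a; cases b; cases w; cases v) (auto simp: cbox_Pair_eq)
    then show "w \<in> (\<Union>(u, v)\<in>set (map f R). cbox u v)"
      using ab(1) by (auto simp: f_def intro!: bexI[of _ "(a, b)"])
  qed
  have "\<forall>(u, v)\<in>set (map f R). dist u v \<le> d + 4 * r" using 2 by blast
  then show ?thesis unfolding box_cover_def
    using R(1) 1 3 by (intro exI[of _ "map f R"] conjI) (simp_all only: length_map)
qed

lemma measure_support_ball:
  assumes "\<nu> \<in> permutons" "u \<in> measure_support \<nu>" "0 < r"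
  shows "0 < measure \<nu> (ball u r)"
proof -
  interpret prob_space \<nu> by (rule permutonsD[OF assms(1)])
  have "0 < emeasure \<nu> (ball u r)" using assms(2,3) unfolding measure_support_def by auto
  then show ?thesis by (simp add: emeasure_eq_measure)
qed

text \<open>A grid version of the Glivenko-Cantelli theorem: of the error 2 / n, one half is the
  deviation of the empirical distribution function at the grid points, the other the mesh of the
  grid. The grid point after x may be (n + 1) / n.\<close>

lemma sample_rank_close:
  assumes \<nu>: "\<nu> \<in> permutons" and c: "c = fst \<or> c = snd" and n: "0 < n" and k: "0 < k"
    and z: "good_sample \<nu> \<D> (1 / real n) ({0..1} \<times> {0..1}) k z"
    and D: "\<And>q. q \<le> Suc n \<Longrightarrow> {u. c u \<in> {..real q / n}} \<in> \<D>" and i: "i \<in> {1..k}"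
  shows "\<bar>real (sample_rank k (\<lambda>i. c (z i)) i) / k - c (z i)\<bar> \<le> 2 / n"
proof -
  define x where "x = c (z i)"
  have "z i \<in> {0..1} \<times> {0..1}" using z i unfolding good_sample_def by blast
  then have x: "0 \<le> x" "x \<le> 1" using c by (auto simp: x_def mem_Times_iff)
  define q where "q = nat \<lfloor>n * x\<rfloor>"
  have "0 \<le> n * x" "n * x \<le> n" using x by (auto simp: mult_left_le)
  then have q: "real q \<le> n * x" "n * x \<le> real q + 1" "q \<le> n" unfolding q_def by linarith+
  then have q': "real q / n \<le> x" "x \<le> (real q + 1) / n" using n by (auto simp: field_simps)
  let ?C = "\<lambda>q. card {j \<in> {1..k}. c (z j) \<le> real q / n}"
  have dev: "\<bar>real (?C q) - k * measure \<nu> {u. c u \<in> {..real q / n}}\<bar> < 1 / n * k" if "q \<le> Suc n" for q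
    using z D[OF that] unfolding good_sample_def by auto
  have ms: "measure \<nu> {u. c u \<in> {..real q / n}} = min 1 (real q / n)" for q
  proof -
    have "measure \<nu> {u. c u \<in> {..real q / n}} = measure lborel ({0..1} \<inter> {..real q / n})"
      by (rule measure_coordinate[OF \<nu> c]) simp
    also have "{0..1} \<inter> {..real q / n} = {0..min 1 (real q / n)}" by auto
    finally show ?thesis by (simp add: min_def)
  qed
  have low: "?C q \<le> sample_rank k (\<lambda>i. c (z i)) i"
    unfolding sample_rank_def by (rule card_mono) (use q'(1) in \<open>auto simp: x_def\<close>)
  have up: "sample_rank k (\<lambda>i. c (z i)) i \<le> ?C (Suc q)"
    unfolding sample_rank_def by (rule card_mono) (use q'(2) in \<open>auto simp: x_def add.commute\<close>)
  have "real q / n \<le> 1" using q(3) n by (simp add: field_simps)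
  then have "k * (real q / n) - 1 / n * k \<le> real (?C q)"
    using dev[of q] q(3) unfolding ms by (simp add: min_def split: if_splits)
  then have lo: "(real q - 1) / n * k \<le> real (?C q)"
    by (simp add: diff_divide_distrib algebra_simps)
  have "real (?C (Suc q)) \<le> k * min 1 (real (Suc q) / n) + 1 / n * k"
    using dev[of "Suc q"] q(3) unfolding ms by linarith
  also have "k * min 1 (real (Suc q) / n) \<le> k * (real (Suc q) / n)"
    by (intro mult_left_mono) auto
  finally have hi: "real (?C (Suc q)) \<le> (real q + 2) / n * k"
    by (simp add: add_divide_distrib algebra_simps)
  have "(real q - 1) / n \<le> real (sample_rank k (\<lambda>i. c (z i)) i) / k"
    using lo low k by (simp add: pos_le_divide_eq) 
  moreover have "real (sample_rank k (\<lambda>i. c (z i)) i) / k \<le> (real q + 2) / n"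
    using hi up k by (simp add: pos_divide_le_eq)
  moreover have "x - 2 / n \<le> (real q - 1) / n" "(real q + 2) / n \<le> x + 2 / n"
    using q' by (simp_all add: add_divide_distrib diff_divide_distrib)
  ultimately show ?thesis unfolding x_def[symmetric] by linarith
qed

text \<open>For a good sample, every point of the support is close to a point of the scaled
  permutation, so enlarging the boxes of the latter covers the support.\<close>

lemma box_cover_support:
  assumes \<nu>: "\<nu> \<in> permutons" and \<tau>: "0 < \<tau>"
    and freq: "\<And>k0. \<exists>k\<ge>k0. 1 / 2 \<le> pattern_prob \<nu> k (\<lambda>\<sigma>. box_cover N c d (perm_points k \<sigma>))"
  shows "box_cover N (c + \<tau>) (d + \<tau>) (measure_support \<nu>)"
proof -
  note p = permutonsD[OF \<nu>]
  interpret prob_space \<nu> by (rule p)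
  \<comment> \<open>The distances below are at most 4 / n, so enlarging costs 4 * (4 / n) = 16 / n
    per box.\<close>
  obtain n :: nat where n0: "16 * (real N + 1) / \<tau> < n" using reals_Archimedean2 by blast
  have "0 < 16 * (real N + 1) / \<tau>" using \<tau> by simp
  then have n: "0 < n" using n0 by simp
  have "16 * (real N + 1) < \<tau> * n" using n0 \<tau> by (simp add: field_simps)
  then have nN: "16 / n * N \<le> \<tau>" "16 / n \<le> \<tau>" using n by (auto simp: field_simps)
  define cell where "cell a b = {u. fst u \<in> {real a / n..(real a + 1) / n}} \<inter> {u. snd u \<in> {real b / n..(real b + 1) / n}}"
    for a b :: nat
  define \<C> where "\<C> = (\<lambda>(a, b). cell a b) ` ({..n} \<times> {..n})"
  define \<D> where "\<D> = \<C> \<union> (\<lambda>q. {u. fst u \<in> {..real q / n}}) ` {..Suc n} \<union> (\<lambda>q. {u. snd u \<in> {..real q / n}}) ` {..Suc n}"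
  have finC: "finite \<C>" unfolding \<C>_def by simp
  have finD: "finite \<D>" unfolding \<D>_def using finC by simp
  have cell: "cell a b \<in> sets borel" for a b
    unfolding cell_def by (intro sets.Int measure_coordinate[OF \<nu>]) auto
  have setsD: "\<D> \<subseteq> sets borel"
    unfolding \<D>_def \<C>_def using cell measure_coordinate(1)[OF \<nu>] by (auto simp del: atMost_iff)
  \<comment> \<open>At most the least positive cell measure, so that every charged cell contains a
    sample point, and at most 1 / n, as \<open>sample_rank_close\<close> requires.\<close>
  define \<tau>' where "\<tau>' = Min (insert (1 / real n) (measure \<nu> ` {C \<in> \<C>. 0 < measure \<nu> C}))"
  have \<tau>': "0 < \<tau>'" "\<tau>' \<le> 1 / n"
    unfolding \<tau>'_def using finC n by (subst Min_gr_iff, auto intro!: Min_le)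
  have \<tau>'C: "\<tau>' \<le> measure \<nu> C" if "C \<in> \<C>" "0 < measure \<nu> C" for C
    unfolding \<tau>'_def using finC that by (intro Min_le) auto
  obtain k0 where k0: "\<And>k P. k0 \<le> k \<Longrightarrow> 1 / 2 \<le> pattern_prob \<nu> k P \<Longrightarrow>
      \<exists>z. good_sample \<nu> \<D> \<tau>' ({0..1} \<times> {0..1}) k z \<and> P (points_perm k z)"
  proof (rule good_sample_pattern_prob[OF \<nu> finD setsD \<tau>'(1) p(3)])
    fix k0 assume "\<And>k P. k0 \<le> k \<Longrightarrow> 1 / 2 \<le> pattern_prob \<nu> k P \<Longrightarrow>
      \<exists>z. good_sample \<nu> \<D> \<tau>' ({0..1} \<times> {0..1}) k z \<and> P (points_perm k z)"
    then show thesis by (rule that)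
  qed
  obtain k where k: "max 1 k0 \<le> k" "1 / 2 \<le> pattern_prob \<nu> k (\<lambda>\<sigma>. box_cover N c d (perm_points k \<sigma>))"
    using freq by blast
  have kpos: "0 < k" using k by simp
  have "k0 \<le> k" using k by simp
  from k0[OF this k(2)]
  obtain z where z: "good_sample \<nu> \<D> \<tau>' ({0..1} \<times> {0..1}) k z"
    "box_cover N c d (perm_points k (points_perm k z))" by blast
  have z': "good_sample \<nu> \<D> (1 / n) ({0..1} \<times> {0..1}) k z"
  proof -
    have "\<tau>' * k \<le> 1 / n * k" using \<tau>' by (intro mult_right_mono) auto
    then show ?thesis using z(1) unfolding good_sample_def by fastforce
  qed
  have inj: "inj_on (\<lambda>i. fst (z i)) {1..k}" "inj_on (\<lambda>i. snd (z i)) {1..k}"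
    using z(1) unfolding good_sample_def by auto
  \<comment> \<open>1 / n from u to a charged cell, 1 / n across the cell to a sample point, and 2 /
    n from there to its pair of scaled ranks.\<close>
  have "\<exists>v\<in>perm_points k (points_perm k z). \<bar>fst u - fst v\<bar> \<le> 4 / n \<and> \<bar>snd u - snd v\<bar> \<le> 4 / n"
    if u: "u \<in> measure_support \<nu>" for u
  proof -
    let ?Q = "{0..1} \<times> {0..1 :: real}"
    have "0 < measure \<nu> (ball u (1 / n))" by (rule measure_support_ball[OF \<nu> u]) (use n in simp)
    also have "measure \<nu> (ball u (1 / n)) \<le> measure \<nu> (\<Union>C\<in>{C \<in> \<C>. C \<inter> ball u (1 / n) \<noteq> {}}. C)"
    proof (rule finite_measure_mono_AE)
      show "AE x in \<nu>. x \<in> ball u (1 / real n) \<longrightarrow> x \<in> (\<Union>C\<in>{C \<in> \<C>. C \<inter> ball u (1 / n) \<noteq> {}}. C)"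
        using p(3)
      proof eventually_elim
        case (elim x)
        define a where "a = nat \<lfloor>n * fst x\<rfloor>"
        define b where "b = nat \<lfloor>n * snd x\<rfloor>"
        have "0 \<le> n * fst x" "n * fst x \<le> n" "0 \<le> n * snd x" "n * snd x \<le> n"
          using elim by (auto simp: mem_Times_iff mult_left_le)
        then have "real a \<le> n * fst x" "n * fst x \<le> real a + 1" "a \<le> n"
          "real b \<le> n * snd x" "n * snd x \<le> real b + 1" "b \<le> n"
          unfolding a_def b_def by linarith+
        then have "x \<in> cell a b" "cell a b \<in> \<C>"
          using n unfolding cell_def \<C>_def by (auto simp: field_simps)
        then show ?case by blast
      qed
      show "(\<Union>C\<in>{C \<in> \<C>. C \<inter> ball u (1 / n) \<noteq> {}}. C) \<in> sets \<nu>"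
        using finC setsD p(1) by (intro sets.finite_UN) (auto simp: \<D>_def)
    qed
    also have "\<dots> \<le> (\<Sum>C\<in>{C \<in> \<C>. C \<inter> ball u (1 / n) \<noteq> {}}. measure \<nu> C)"
      using finC setsD p(1) by (intro finite_measure_subadditive_finite) (auto simp: \<D>_def)
    finally have pos: "0 < (\<Sum>C\<in>{C \<in> \<C>. C \<inter> ball u (1 / n) \<noteq> {}}. measure \<nu> C)" .
    have "\<exists>C\<in>{C \<in> \<C>. C \<inter> ball u (1 / n) \<noteq> {}}. 0 < measure \<nu> C"
    proof (rule ccontr)
      assume "\<not> ?thesis"
      then have "(\<Sum>C\<in>{C \<in> \<C>. C \<inter> ball u (1 / n) \<noteq> {}}. measure \<nu> C) \<le> 0"
        by (intro sum_nonpos) (meson not_less)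
      then show False using pos by linarith
    qed
    then obtain C where C: "C \<in> \<C>" "C \<inter> ball u (1 / n) \<noteq> {}" "0 < measure \<nu> C" by blast
    have "\<bar>real (card {i \<in> {1..k}. z i \<in> C}) - k * measure \<nu> C\<bar> < \<tau>' * k"
      using z(1) C(1) unfolding good_sample_def \<D>_def by blast
    moreover have "\<tau>' * k \<le> k * measure \<nu> C" 
      using mult_right_mono[OF \<tau>'C[OF C(1,3)], of "real k"] by (simp add: mult.commute)
    ultimately have "0 < real (card {i \<in> {1..k}. z i \<in> C})" by linarith
    then have "{i \<in> {1..k}. z i \<in> C} \<noteq> {}" by (metis card.empty less_irrefl of_nat_0)
    then obtain i where i: "i \<in> {1..k}" "z i \<in> C" by blast
    obtain w where w: "w \<in> C" "dist u w < 1 / n" using C(2) by auto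
    obtain a b where "C = cell a b" using C(1) by (auto simp: \<C>_def)
    then have "\<bar>fst w - fst (z i)\<bar> \<le> 1 / n" "\<bar>snd w - snd (z i)\<bar> \<le> 1 / n"
      using w(1) i(2) unfolding cell_def by (auto simp: add_divide_distrib abs_if)
    moreover have "\<bar>fst u - fst w\<bar> \<le> 1 / n" "\<bar>snd u - snd w\<bar> \<le> 1 / n"
      using w(2) dist_fst_le[of u w] dist_snd_le[of u w] by (auto simp: dist_real_def)
    ultimately have uz: "\<bar>fst u - fst (z i)\<bar> \<le> 2 / n" "\<bar>snd u - snd (z i)\<bar> \<le> 2 / n" by linarith+
    let ?r = "sample_rank k (\<lambda>i. fst (z i)) i" and ?s = "sample_rank k (\<lambda>i. snd (z i)) i"
    have D': "q \<le> Suc n \<Longrightarrow> {u. fst u \<in> {..real q / n}} \<in> \<D>" "q \<le> Suc n \<Longrightarrow> {u. snd u \<in> {..real q / n}} \<in> \<D>" for q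
      unfolding \<D>_def by blast+
    have "\<bar>real ?r / k - fst (z i)\<bar> \<le> 2 / n"
      by (rule sample_rank_close[OF \<nu> _ n kpos z' D'(1) i(1)]) auto
    moreover have "\<bar>real ?s / k - snd (z i)\<bar> \<le> 2 / n"
      by (rule sample_rank_close[OF \<nu> _ n kpos z' D'(2) i(1)]) auto
    moreover have "(real ?r / k, real ?s / k) \<in> perm_points k (points_perm k z)"
    proof -
      have "?r \<in> {1..k}" using rank_bij[OF inj(1)] i(1) bij_betwE by blast
      then show ?thesis unfolding perm_points_def
        using points_perm_rank[OF inj i(1)] by (intro image_eqI[of _ _ ?r]) auto
    qed
    ultimately show ?thesis using uz
      by (intro bexI[of _ "(real ?r / k, real ?s / k)"]) auto
  qed
  then have "box_cover N (c + 4 * (4 / n) * N) (d + 4 * (4 / n)) (measure_support \<nu>)"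
    by (intro box_cover_thicken[OF z(2)]) auto
  then show ?thesis by (rule box_cover_mono) (use nN in auto)
qed

section \<open>Almost sure properties of the permuton\<close>

text \<open>The event that 1/2 \<le> f k for all k \<ge> k0 lies in the same event for one large k,
  where Markov's inequality gives 2 \<gamma>; the former events increase with k0.\<close>

lemma (in prob_space) prob_eventually_ge_half:
  fixes f :: "nat \<Rightarrow> 'a \<Rightarrow> real"
  assumes int: "\<And>k. K \<le> k \<Longrightarrow> integrable M (f k)"
    and nonneg: "\<And>k \<omega>. \<omega> \<in> space M \<Longrightarrow> 0 \<le> f k \<omega>"
    and meas: "\<And>k. f k \<in> borel_measurable M"
    and le: "\<And>k. K \<le> k \<Longrightarrow> (LINT \<omega>|M. f k \<omega>) \<le> \<gamma>"
  shows "{\<omega> \<in> space M. \<exists>k0. \<forall>k\<ge>k0. 1 / 2 \<le> f k \<omega>} \<in> events"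
    and "prob {\<omega> \<in> space M. \<exists>k0. \<forall>k\<ge>k0. 1 / 2 \<le> f k \<omega>} \<le> 2 * \<gamma>"
proof -
  define A where "A k0 = {\<omega> \<in> space M. \<forall>k\<ge>k0. 1 / 2 \<le> f k \<omega>}" for k0
  have eq: "{\<omega> \<in> space M. \<exists>k0. \<forall>k\<ge>k0. 1 / 2 \<le> f k \<omega>} = (\<Union>k0. A k0)"
    by (auto simp: A_def)
  note [measurable] = meas
  have A: "A k0 \<in> events" for k0 unfolding A_def by measurable
  show "{\<omega> \<in> space M. \<exists>k0. \<forall>k\<ge>k0. 1 / 2 \<le> f k \<omega>} \<in> events"
    unfolding eq using A by auto
  have "prob (A k0) \<le> 2 * \<gamma>" for k0
  proof -
    define k where "k = max k0 K"
    have k: "k0 \<le> k" "K \<le> k" by (auto simp: k_def)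
    have "prob (A k0) \<le> prob {\<omega> \<in> space M. 1 / 2 \<le> f k \<omega>}"
      by (rule finite_measure_mono) (use k(1) in \<open>auto simp: A_def\<close>)
    also have "\<dots> \<le> (LINT \<omega>|M. f k \<omega>) / (1 / 2)"
      by (rule integral_Markov_inequality_measure[where A = "{}"]) (use int[OF k(2)] nonneg in auto)
    also have "\<dots> \<le> 2 * \<gamma>" using le[OF k(2)] by simp
    finally show ?thesis .
  qed
  moreover have "(\<lambda>k0. prob (A k0)) \<longlonglongrightarrow> prob (\<Union>k0. A k0)"
    by (rule finite_Lim_measure_incseq) (use A in \<open>auto simp: incseq_def A_def\<close>)
  ultimately have "prob (\<Union>k0. A k0) \<le> 2 * \<gamma>" by (meson LIMSEQ_le_const2)
  then show "prob {\<omega> \<in> space M. \<exists>k0. \<forall>k\<ge>k0. 1 / 2 \<le> f k \<omega>} \<le> 2 * \<gamma>" unfolding eq .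
qed

text \<open>The exceptional set is only enclosed in events, since the properties of the support to
  which this is applied are not known to be measurable.\<close>

lemma (in prob_space) AE_if_small_exception:
  assumes "\<And>e. 0 < e \<Longrightarrow> \<exists>B\<in>events. prob B \<le> e \<and> (\<forall>\<omega>\<in>space M. \<not> P \<omega> \<longrightarrow> \<omega> \<in> B)"
  shows "AE \<omega> in M. P \<omega>"
proof -
  have "\<forall>n. \<exists>B\<in>events. prob B \<le> 1 / real (Suc n) \<and> (\<forall>\<omega>\<in>space M. \<not> P \<omega> \<longrightarrow> \<omega> \<in> B)"
    by (intro allI assms) simp
  then obtain B where B: "\<And>n. B n \<in> events" "\<And>n. prob (B n) \<le> 1 / real (Suc n)"
    "\<And>n \<omega>. \<omega> \<in> space M \<Longrightarrow> \<not> P \<omega> \<Longrightarrow> \<omega> \<in> B n" by metis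
  define C where "C = (\<Inter>n. B n)"
  have C: "C \<in> events" unfolding C_def using B(1) by auto
  have "prob C \<le> 0"
  proof (rule field_le_epsilon)
    fix e :: real assume "0 < e"
    then obtain n where n: "1 / real (Suc n) < e"
      using reals_Archimedean[of e] by (auto simp: inverse_eq_divide)
    have "prob C \<le> prob (B n)" by (rule finite_measure_mono) (use B(1) in \<open>auto simp: C_def\<close>)
    then show "prob C \<le> 0 + e" using B(2)[of n] n by simp
  qed
  then have "emeasure M C = 0" by (simp add: emeasure_eq_measure measure_le_0_iff)
  then have "C \<in> null_sets M" using C by auto
  moreover have "{\<omega> \<in> space M. \<not> P \<omega>} \<subseteq> C" using B(3) by (auto simp: C_def)
  ultimately show ?thesis by (rule AE_I')
qed

text \<open>Applied to the probability that the cover fails. Off the small event it is below 1/2 for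
  arbitrarily large k, as \<open>box_cover_support\<close> demands. The number N depends on the
  allowed failure probability, so it is quantified after \<omega>.\<close>

lemma AE_box_cover_support:
  assumes br: "brownian_separable_permuton p M \<mu>" and \<epsilon>: "0 < \<epsilon>"
  shows "AE \<omega> in M. \<exists>N. box_cover N (sqrt 2 + \<epsilon>) \<epsilon> (measure_support (\<mu> \<omega>))"
proof -
  have \<mu>: "random_permuton M \<mu>" using br by (simp add: brownian_separable_permuton_def)
  interpret prob_space M using \<mu> by (simp add: random_permuton_def)
  show ?thesis
  proof (rule AE_if_small_exception)
    fix e :: real assume e: "0 < e"
    obtain N k0 where k0: "\<And>k. k0 \<le> k \<Longrightarrow> 1 - e / 2 \<le> measure_pmf.prob (map_pmf tree_perm (random_signed_tree k p))
      {\<sigma>. box_cover N (sqrt 2 + \<epsilon> / 2) (\<epsilon> / 2) (perm_points k \<sigma>)}"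
      using prob_box_cover[of "\<epsilon> / 2" "\<epsilon> / 2" "e / 2" p] e \<epsilon> by auto
    define f where "f k \<omega> = 1 - pattern_prob (\<mu> \<omega>) k (\<lambda>\<sigma>. box_cover N (sqrt 2 + \<epsilon> / 2) (\<epsilon> / 2) (perm_points k \<sigma>))"
      for k \<omega>
    define B where "B = {\<omega> \<in> space M. \<exists>k0. \<forall>k\<ge>k0. 1 / 2 \<le> f k \<omega>}"
    have int: "integrable M (f k)" "(LINT \<omega>|M. f k \<omega>) \<le> e / 2" if "max 1 k0 \<le> k" for k
    proof -
      have k: "1 \<le> k" "k0 \<le> k" using that by auto
      show "integrable M (f k)" unfolding f_def
        by (intro Bochner_Integration.integrable_diff integral_pattern_prob[OF br k(1)]) simp
      have "(LINT \<omega>|M. f k \<omega>) = 1 - measure_pmf.prob (map_pmf tree_perm (random_signed_tree k p))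
          {\<sigma>. box_cover N (sqrt 2 + \<epsilon> / 2) (\<epsilon> / 2) (perm_points k \<sigma>)}"
        unfolding f_def integral_pattern_prob(2)[OF br k(1), symmetric]
        by (subst Bochner_Integration.integral_diff)
           (use integral_pattern_prob(1)[OF br k(1)] in \<open>simp_all add: prob_space\<close>)
      then show "(LINT \<omega>|M. f k \<omega>) \<le> e / 2" using k0[OF k(2)] by linarith
    qed
    have nonneg: "0 \<le> f k \<omega>" if "\<omega> \<in> space M" for k \<omega>
      using pattern_prob_bounds(2)[OF \<mu> that] by (simp add: f_def)
    have meas: "f k \<in> borel_measurable M" for k
      unfolding f_def by (intro borel_measurable_diff measurable_pattern_prob[OF \<mu>]) simp
    note B = prob_eventually_ge_half[of "max 1 k0" f "e / 2", OF int(1) nonneg meas int(2), folded B_def]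
    have "\<omega> \<in> B" if \<omega>: "\<omega> \<in> space M"
      and no: "\<not> (\<exists>N. box_cover N (sqrt 2 + \<epsilon>) \<epsilon> (measure_support (\<mu> \<omega>)))" for \<omega>
    proof (rule ccontr)
      assume "\<omega> \<notin> B"
      then have neg: "\<exists>k\<ge>k0. f k \<omega> < 1 / 2" for k0 using \<omega> by (auto simp: B_def not_le)
      have "box_cover N (sqrt 2 + \<epsilon> / 2 + \<epsilon> / 2) (\<epsilon> / 2 + \<epsilon> / 2) (measure_support (\<mu> \<omega>))"
      proof (rule box_cover_support[OF random_permuton_space[OF \<mu> \<omega>]])
        fix k0
        obtain k where "k0 \<le> k" "f k \<omega> < 1 / 2" using neg by blast
        then show "\<exists>k\<ge>k0. 1 / 2 \<le> pattern_prob (\<mu> \<omega>) k (\<lambda>\<sigma>. box_cover N (sqrt 2 + \<epsilon> / 2) (\<epsilon> / 2) (perm_points k \<sigma>))"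
          by (intro exI[of _ k] conjI) (simp_all add: f_def)
      qed (use \<epsilon> in simp)
      then have "box_cover N (sqrt 2 + \<epsilon>) \<epsilon> (measure_support (\<mu> \<omega>))" by (simp add: add.assoc)
      then show False using no by blast
    qed
    then show "\<exists>B\<in>events. prob B \<le> e \<and> (\<forall>\<omega>\<in>space M.
        \<not> (\<exists>N. box_cover N (sqrt 2 + \<epsilon>) \<epsilon> (measure_support (\<mu> \<omega>))) \<longrightarrow> \<omega> \<in> B)"
      using B by (intro bexI[of _ B]) auto
  qed
qed

text \<open>Over the open interval from a to c, the mass is carried by a set without descents
  (\<open>b\<close> true) or without ascents (\<open>b\<close> false).\<close>

definition monotone_strip :: "bool \<Rightarrow> real \<Rightarrow> real \<Rightarrow> (real \<times> real) measure \<Rightarrow> bool" where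
  "monotone_strip b a c \<nu> \<longleftrightarrow> (\<exists>G. (AE u in \<nu>. u \<in> G) \<and>
     (\<forall>u\<in>G. \<forall>v\<in>G. a < fst u \<longrightarrow> fst u < fst v \<longrightarrow> fst v < c \<longrightarrow> (snd u < snd v) = b))"

text \<open>The sample points over the interval have consecutive horizontal ranks, starting at
  \<open>card L + 1\<close>; so the r < card S steps between them are consecutive steps of the
  sampled permutation.\<close>

lemma monotone_run_sample:
  assumes inj: "inj_on (\<lambda>i. fst (z i)) {1..k}" "inj_on (\<lambda>i. snd (z i)) {1..k}"
    and mono: "\<And>i j. i \<in> {1..k} \<Longrightarrow> j \<in> {1..k} \<Longrightarrow> a < fst (z i) \<Longrightarrow> fst (z i) < fst (z j) \<Longrightarrow>
      fst (z j) < c \<Longrightarrow> (snd (z i) < snd (z j)) = b"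
    and r: "r < card {i \<in> {1..k}. a < fst (z i) \<and> fst (z i) < c}" and ac: "a < c"
  shows "monotone_run b r k (points_perm k z)"
proof -
  let ?x = "\<lambda>i. fst (z i)" and ?y = "\<lambda>i. snd (z i)"
  define L where "L = {i \<in> {1..k}. ?x i \<le> a}"
  define S where "S = {i \<in> {1..k}. a < ?x i \<and> ?x i < c}"
  have fin: "finite L" "finite S" by (auto simp: L_def S_def)
  have LS: "card (L \<union> S) = card L + card S"
    by (rule card_Un_disjoint) (use fin in \<open>auto simp: L_def S_def\<close>)
  have "card (L \<union> S) \<le> card {1..k}" by (rule card_mono) (auto simp: L_def S_def)
  then have k: "card L + card S \<le> k" using LS by simp
  have rS: "r < card S" using r by (simp add: S_def)
  have gt: "a < ?x i" if "i \<in> {1..k}" "card L < sample_rank k ?x i" for i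
  proof (rule ccontr)
    assume "\<not> a < ?x i"
    then have "sample_rank k ?x i \<le> card L"
      unfolding sample_rank_def L_def by (intro card_mono) auto
    then show False using that by simp
  qed
  have lt: "?x i < c" if "i \<in> {1..k}" "sample_rank k ?x i \<le> card L + card S" for i
  proof (rule ccontr)
    assume c: "\<not> ?x i < c"
    have "i \<notin> L \<union> S" using c ac by (auto simp: L_def S_def)
    then have "card (insert i (L \<union> S)) = Suc (card L + card S)" using fin LS by simp
    moreover have "card (insert i (L \<union> S)) \<le> sample_rank k ?x i"
      unfolding sample_rank_def by (rule card_mono) (use c ac that(1) in \<open>auto simp: L_def S_def\<close>)
    ultimately show False using that by simp
  qed
  have "(points_perm k z j < points_perm k z (Suc j)) = b" if j: "j \<in> {Suc (card L)..<Suc (card L) + r}" for j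
  proof -
    have jk: "j \<in> {1..k}" "Suc j \<in> {1..k}" "Suc j \<le> card L + card S" using j k rS by auto
    obtain i where i: "i \<in> {1..k}" "sample_rank k ?x i = j"
      using rank_bij[OF inj(1)] jk(1) unfolding bij_betw_def by (metis imageE)
    obtain i' where i': "i' \<in> {1..k}" "sample_rank k ?x i' = Suc j"
      using rank_bij[OF inj(1)] jk(2) unfolding bij_betw_def by (metis imageE)
    have "?x i < ?x i'" using rank_less_iff[OF i(1) i'(1), of ?x] i i' by simp
    moreover have "a < ?x i" using gt[OF i(1)] i(2) j by simp
    moreover have "?x i' < c" using lt[OF i'(1)] i'(2) jk by simp
    ultimately have "(?y i < ?y i') = b" using mono i(1) i'(1) by blast
    then show ?thesis
      using points_perm_rank[OF inj i(1)] points_perm_rank[OF inj i'(1)] i(2) i'(2)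
        rank_less_iff[OF i(1) i'(1), of ?y] by simp
  qed
  moreover have "Suc (card L) + r \<le> k" using k rS by linarith
  ultimately show ?thesis
    unfolding monotone_run_def by (intro exI[of _ "Suc (card L)"]) simp
qed

text \<open>About (c - a) k sample points fall into the strip; the tolerance (c - a) / 4 leaves more
  than half of them.\<close>

lemma monotone_strip_pattern_prob:
  assumes \<nu>: "\<nu> \<in> permutons" and m: "monotone_strip b a c \<nu>" and ac: "0 \<le> a" "a < c" "c \<le> 1"
  shows "\<exists>k0. \<forall>k\<ge>k0. 1 / 2 \<le> pattern_prob \<nu> k (monotone_run b (nat \<lfloor>(c - a) / 2 * k\<rfloor>) k)"
proof -
  obtain G where G: "AE u in \<nu>. u \<in> G"
    "\<And>u v. u \<in> G \<Longrightarrow> v \<in> G \<Longrightarrow> a < fst u \<Longrightarrow> fst u < fst v \<Longrightarrow> fst v < c \<Longrightarrow> (snd u < snd v) = b"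
    using m unfolding monotone_strip_def by blast
  define D where "D = {u :: real \<times> real. fst u \<in> {a<..<c}}"
  have D: "D \<in> sets borel" "measure \<nu> D = c - a"
  proof -
    show "D \<in> sets borel" unfolding D_def by (rule measure_coordinate[OF \<nu>]) auto
    have "measure \<nu> D = measure lborel ({0..1} \<inter> {a<..<c})"
      unfolding D_def by (rule measure_coordinate[OF \<nu>]) auto
    also have "{0..1} \<inter> {a<..<c} = {a<..<c}" using ac by auto
    finally show "measure \<nu> D = c - a" using ac by simp
  qed
  have fin: "finite {D}" and sub: "{D} \<subseteq> sets borel" and pos: "0 < (c - a) / 4" using D ac by auto
  obtain k0 where k0: "\<And>k P. k0 \<le> k \<Longrightarrow> (\<And>z. good_sample \<nu> {D} ((c - a) / 4) G k z \<Longrightarrow> P (points_perm k z)) \<Longrightarrow>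
      1 / 2 \<le> pattern_prob \<nu> k P"
  proof (rule good_sample_pattern_prob[OF \<nu> fin sub pos G(1)])
    fix k0 assume "\<And>k P. k0 \<le> k \<Longrightarrow> (\<And>z. good_sample \<nu> {D} ((c - a) / 4) G k z \<Longrightarrow> P (points_perm k z)) \<Longrightarrow>
      1 / 2 \<le> pattern_prob \<nu> k P"
    then show thesis by (rule that)
  qed
  show ?thesis
  proof (intro exI[of _ "max 1 k0"] allI impI, rule k0)
    fix k z assume k: "max 1 k0 \<le> k" and z: "good_sample \<nu> {D} ((c - a) / 4) G k z"
    have S: "{i \<in> {1..k}. z i \<in> D} = {i \<in> {1..k}. a < fst (z i) \<and> fst (z i) < c}"
      by (auto simp: D_def)
    have "\<bar>real (card {i \<in> {1..k}. z i \<in> D}) - k * (c - a)\<bar> < (c - a) / 4 * k"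
      using z D(2) unfolding good_sample_def by simp
    then have "k * (c - a) - (c - a) / 4 * k < real (card {i \<in> {1..k}. a < fst (z i) \<and> fst (z i) < c})"
      unfolding S by linarith
    moreover have "(c - a) / 2 * k \<le> k * (c - a) - (c - a) / 4 * k"
    proof -
      have "0 \<le> (c - a) * k" using ac by simp
      then show ?thesis by (simp add: field_simps)
    qed
    moreover have "0 \<le> (c - a) / 2 * k" using ac by simp
    ultimately have r: "nat \<lfloor>(c - a) / 2 * k\<rfloor> < card {i \<in> {1..k}. a < fst (z i) \<and> fst (z i) < c}"
      by linarith
    have zG: "\<forall>i\<in>{1..k}. z i \<in> G" and inj: "inj_on (\<lambda>i. fst (z i)) {1..k}" "inj_on (\<lambda>i. snd (z i)) {1..k}"
      using z unfolding good_sample_def by blast+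
    show "monotone_run b (nat \<lfloor>(c - a) / 2 * k\<rfloor>) k (points_perm k z)"
      by (rule monotone_run_sample[OF inj _ r ac(2)]) (use zG G(2) in blast)
  qed simp
qed

text \<open>This is where p strictly between 0 and 1 matters: both signs have probability q < 1. A
  monotone strip would make long runs have probability at least 1/2 for all large k, while their
  mean probability is at most k q^r, which tends to 0.\<close>

lemma AE_not_monotone_strip:
  assumes br: "brownian_separable_permuton p M \<mu>" and p: "0 < p" "p < 1"
    and ac: "0 \<le> a" "a < c" "c \<le> 1"
  shows "AE \<omega> in M. \<not> monotone_strip b a c (\<mu> \<omega>)"
proof -
  have \<mu>: "random_permuton M \<mu>" using br by (simp add: brownian_separable_permuton_def)
  interpret prob_space M using \<mu> by (simp add: random_permuton_def)
  define q where "q = pmf (bernoulli_pmf p) b"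
  have q: "0 < q" "q < 1" using p by (cases b; simp add: q_def)+
  \<comment> \<open>\<open>q ^ r k\<close> is at most \<open>x ^ k\<close> times 1 / q, the factor
    lost by rounding \<open>r k\<close> down.\<close>
  define x where "x = q powr ((c - a) / 2)"
  have x: "0 \<le> x" "x < 1"
    using q ac powr_less_mono2[of "(c - a) / 2" q 1] by (auto simp: x_def)
  define r where "r k = nat \<lfloor>(c - a) / 2 * real k\<rfloor>" for k
  have qr: "q ^ r k \<le> x ^ k / q" for k
  proof -
    have "(c - a) / 2 * real k - 1 \<le> real (r k)" unfolding r_def by linarith
    then have "q powr real (r k) \<le> q powr ((c - a) / 2 * real k - 1)"
      using q by (intro powr_mono') auto
    also have "\<dots> = x ^ k / q"
      using q by (simp add: powr_diff x_def powr_powr flip: powr_realpow)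
    finally show ?thesis using q by (simp add: powr_realpow)
  qed
  define f where "f k \<omega> = pattern_prob (\<mu> \<omega>) k (monotone_run b (r k) k)" for k \<omega>
  show ?thesis
  proof (rule AE_if_small_exception)
    fix e :: real assume e: "0 < e"
    have "(\<lambda>k. real k * x ^ k) \<longlonglongrightarrow> 0" by (rule powser_times_n_limit_0) (use x in simp)
    then have "(\<lambda>k. real k * x ^ k / q) \<longlonglongrightarrow> 0 / q" by (intro tendsto_divide) (use q in auto)
    then have "\<forall>\<^sub>F k in sequentially. real k * x ^ k / q < e / 2"
      by (rule order_tendstoD) (use e in simp)
    then obtain k0 where k0: "\<And>k. k0 \<le> k \<Longrightarrow> real k * x ^ k / q < e / 2"
      unfolding eventually_sequentially by blast
    define B where "B = {\<omega> \<in> space M. \<exists>k0. \<forall>k\<ge>k0. 1 / 2 \<le> f k \<omega>}"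
    have int: "integrable M (f k)" "(LINT \<omega>|M. f k \<omega>) \<le> e / 2" if "max 1 k0 \<le> k" for k
    proof -
      have k: "1 \<le> k" "k0 \<le> k" using that by auto
      show "integrable M (f k)" unfolding f_def by (rule integral_pattern_prob[OF br k(1)])
      have "(LINT \<omega>|M. f k \<omega>) \<le> real k * q ^ r k"
        unfolding f_def q_def integral_pattern_prob(2)[OF br k(1)] by (rule prob_monotone_run[OF k(1)])
      also have "\<dots> \<le> real k * (x ^ k / q)" by (intro mult_left_mono qr) simp
      also have "\<dots> = real k * x ^ k / q" by simp
      also have "\<dots> \<le> e / 2" using k0[OF k(2)] by (rule less_imp_le)
      finally show "(LINT \<omega>|M. f k \<omega>) \<le> e / 2" .
    qed
    have nonneg: "0 \<le> f k \<omega>" if "\<omega> \<in> space M" for k \<omega>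
      using pattern_prob_bounds(1)[OF \<mu> that] by (simp add: f_def)
    have meas: "f k \<in> borel_measurable M" for k
      unfolding f_def by (rule measurable_pattern_prob[OF \<mu>])
    note B = prob_eventually_ge_half[of "max 1 k0" f "e / 2", OF int(1) nonneg meas int(2), folded B_def]
    have "\<omega> \<in> B" if "\<omega> \<in> space M" "monotone_strip b a c (\<mu> \<omega>)" for \<omega>
      using monotone_strip_pattern_prob[OF random_permuton_space[OF \<mu> that(1)] that(2) ac] that(1)
      unfolding B_def f_def r_def by blast
    then show "\<exists>B\<in>events. prob B \<le> e \<and> (\<forall>\<omega>\<in>space M. \<not> \<not> monotone_strip b a c (\<mu> \<omega>) \<longrightarrow> \<omega> \<in> B)"
      using B by (intro bexI[of _ B]) auto
  qed
qed

section \<open>Geometry of the support of a fixed permuton\<close>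

section \<open>The support of a permuton\<close>

text \<open>For a set that is not measurable, \<open>emeasure\<close> is 0 by convention.\<close>

lemma emeasure_eq_0_if_AE:
  assumes "AE u in M. u \<notin> A"
  shows "emeasure M A = 0"
proof (cases "A \<in> sets M")
  case True
  then have "A = {u \<in> space M. u \<in> A}" using sets.sets_into_space by blast
  then show ?thesis using emeasure_eq_0_AE[OF assms] by simp
qed (rule emeasure_notin_sets)

lemma measure_eq_0_if_AE: "AE u in M. u \<notin> A \<Longrightarrow> measure M A = 0"
  unfolding measure_def by (simp add: emeasure_eq_0_if_AE)

lemma closed_measure_support: "closed (measure_support \<nu>)"
proof -
  have "open (- measure_support \<nu>)"
  proof (subst open_subopen, intro ballI)
    fix x assume "x \<in> - measure_support \<nu>"
    then obtain U where U: "open U" "x \<in> U" "\<not> 0 < emeasure \<nu> U"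
      unfolding measure_support_def by blast
    then have "U \<subseteq> - measure_support \<nu>" unfolding measure_support_def by blast
    then show "\<exists>T. open T \<and> x \<in> T \<and> T \<subseteq> - measure_support \<nu>" using U by blast
  qed
  then show ?thesis by (simp add: closed_def)
qed

lemma AE_measure_support:
  fixes \<nu> :: "'a::second_countable_topology measure"
  assumes "sets \<nu> = sets borel"
  shows "AE u in \<nu>. u \<in> measure_support \<nu>"
proof -
  obtain B :: "'a set set" where B: "countable B" "topological_basis B"
    using ex_countable_basis by blast
  define Z where "Z = (\<Union>U\<in>{U \<in> B. emeasure \<nu> U = 0}. U)"
  have "Z \<in> null_sets \<nu>"
    unfolding Z_def using B assms topological_basis_open[OF B(2)]
    by (intro null_sets_UN') (auto intro: countable_subset[OF _ B(1)])
  moreover have "{u \<in> space \<nu>. u \<notin> measure_support \<nu>} \<subseteq> Z"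
  proof
    fix u assume "u \<in> {u \<in> space \<nu>. u \<notin> measure_support \<nu>}"
    then obtain U where U: "open U" "u \<in> U" "emeasure \<nu> U = 0"
      unfolding measure_support_def by auto
    then obtain V where V: "V \<in> B" "u \<in> V" "V \<subseteq> U" using topological_basisE[OF B(2)] by metis
    have "emeasure \<nu> V \<le> emeasure \<nu> U" by (rule emeasure_mono) (use V U assms in auto)
    then show "u \<in> Z" using V U unfolding Z_def by auto
  qed
  ultimately show ?thesis by (rule AE_I')
qed

lemma measure_support_subset:
  assumes \<nu>: "\<nu> \<in> permutons"
  shows "measure_support \<nu> \<subseteq> {0..1} \<times> {0..1}"
proof
  fix u assume u: "u \<in> measure_support \<nu>"
  note p = permutonsD[OF \<nu>]
  let ?Q = "{0..1 :: real} \<times> {0..1 :: real}"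
  show "u \<in> ?Q"
  proof (rule ccontr)
    assume "u \<notin> ?Q"
    moreover have "open (- ?Q)" by (intro open_Compl closed_Times) auto
    ultimately have "0 < emeasure \<nu> (- ?Q)" using u unfolding measure_support_def by auto
    moreover have "emeasure \<nu> (- ?Q) = 0"
      by (rule emeasure_eq_0_if_AE) (use p(3) in simp)
    ultimately show False by simp
  qed
qed

lemma compact_measure_support: "\<nu> \<in> permutons \<Longrightarrow> compact (measure_support \<nu>)"
  using closed_measure_support measure_support_subset
  by (metis Int_absorb2 closed_Int_compact compact_Icc compact_Times)

text \<open>The projection is compact, and by the uniform marginal it misses only a null part of the
  unit interval. That part is relatively open, hence empty.\<close>

lemma coordinate_measure_support:
  assumes \<nu>: "\<nu> \<in> permutons" and c: "c = fst \<or> c = snd"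
  shows "c ` measure_support \<nu> = {0..1}"
proof
  show "c ` measure_support \<nu> \<subseteq> {0..1}" using measure_support_subset[OF \<nu>] c by auto
  let ?V = "- (c ` measure_support \<nu>)"
  have "continuous_on UNIV c" using c by (auto intro!: continuous_intros)
  then have "compact (c ` measure_support \<nu>)"
    by (intro compact_continuous_image compact_measure_support[OF \<nu>]) (auto intro: continuous_on_subset)
  then have V: "open ?V" by (simp add: compact_imp_closed open_Compl)
  have null: "measure lborel ({0..1} \<inter> ?V) = 0"
  proof -
    have "measure lborel ({0..1} \<inter> ?V) = measure \<nu> {u. c u \<in> ?V}"
      by (rule measure_coordinate(2)[OF \<nu> c, symmetric]) (use V in simp)
    also have "AE u in \<nu>. u \<notin> {u. c u \<in> ?V}"
      using AE_measure_support[OF permutonsD(1)[OF \<nu>]] by eventually_elim auto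
    then have "measure \<nu> {u. c u \<in> ?V} = 0"
      by (rule measure_eq_0_if_AE)
    finally show ?thesis .
  qed
  show "{0..1} \<subseteq> c ` measure_support \<nu>"
  proof (rule ccontr)
    assume "\<not> ?thesis"
    then obtain x where x: "x \<in> {0..1}" "x \<in> ?V" by blast
    obtain r where r: "0 < r" "ball x r \<subseteq> ?V" using V x(2) open_contains_ball by blast
    define a where "a = max 0 (x - r / 2)"
    define b where "b = min 1 (x + r / 2)"
    have ab: "a < b" using x r by (auto simp: a_def b_def)
    have "{a..b} \<subseteq> {0..1} \<inter> ?V"
    proof
      fix y assume y: "y \<in> {a..b}"
      then have "y \<in> ball x r" using r by (auto simp: a_def b_def dist_real_def abs_if)
      then show "y \<in> {0..1} \<inter> ?V" using r y by (auto simp: a_def b_def)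
    qed
    moreover have "{0..1} \<inter> ?V \<in> fmeasurable lborel"
      using V by (intro fmeasurable_Int_fmeasurable fmeasurable_compact) auto
    ultimately have "measure lborel {a..b} \<le> measure lborel ({0..1} \<inter> ?V)"
      by (intro measure_mono_fmeasurable) auto
    then show False using null ab by simp
  qed
qed

section \<open>Hausdorff measure and dimension\<close>

lemma diameter_cbox_nonempty: "cbox u v \<noteq> {} \<Longrightarrow> diameter (cbox u v) = dist u v"
  using box_ne_empty(1) diameter_cbox by blast

text \<open>One factor \<open>dist u v\<close> is kept, to be summed against the total bound c; the
  other s - 1 are estimated by d.\<close>

lemma diam_powr_cbox_le:
  fixes u v :: "real \<times> real"
  assumes "dist u v \<le> d" "1 \<le> s"
  shows "diam_powr s (cbox u v) \<le> ennreal (d powr (s - 1) * dist u v)"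
proof (cases "cbox u v = {}")
  case False
  have D: "diameter (cbox u v) = dist u v"
    using False by (rule diameter_cbox_nonempty)
  have "dist u v powr s \<le> d powr (s - 1) * dist u v"
  proof (cases "u = v")
    case False
    then have "dist u v powr s = dist u v powr (s - 1) * dist u v"
      by (simp add: powr_diff)
    also have "\<dots> \<le> d powr (s - 1) * dist u v"
      using assms by (intro mult_right_mono powr_mono2) auto
    finally show ?thesis .
  qed simp
  then show ?thesis using assms False D by (simp add: diam_powr_def ennreal_leI)
qed (simp add: diam_powr_def)

lemma hausdorff_premeasure_box_cover:
  assumes "box_cover N c d S" "d \<le> \<delta>" "1 \<le> s" "0 \<le> \<delta>"
  shows "hausdorff_premeasure s \<delta> S \<le> ennreal (d powr (s - 1) * c)"
proof -
  obtain R where R: "length R \<le> N" "(\<Sum>(u, v)\<leftarrow>R. dist u v) \<le> c"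
    "\<forall>(u, v)\<in>set R. dist u v \<le> d" "S \<subseteq> (\<Union>(u, v)\<in>set R. cbox u v)"
    using assms(1) unfolding box_cover_def by blast
  \<comment> \<open>The finite list is continued by empty sets, for which \<open>diam_powr\<close>
    is 0.\<close>
  define U where "U n = (if n < length R then cbox (fst (R ! n)) (snd (R ! n)) else {})" for n
  have Rn: "dist (fst (R ! n)) (snd (R ! n)) \<le> d" if "n < length R" for n
    using R(3) nth_mem[OF that] by (auto simp: case_prod_unfold)
  have "S \<subseteq> (\<Union>n. U n)"
  proof
    fix x assume "x \<in> S"
    then obtain w where "w \<in> set R" "x \<in> cbox (fst w) (snd w)" using R(4) by (auto simp: case_prod_unfold)
    then obtain n where "n < length R" "x \<in> cbox (fst (R ! n)) (snd (R ! n))" by (metis in_set_conv_nth)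
    then show "x \<in> (\<Union>n. U n)" by (auto simp: U_def)
  qed
  moreover have "bounded (U n) \<and> diameter (U n) \<le> \<delta>" for n
  proof (cases "n < length R \<and> U n \<noteq> {}")
    case True
    have Un: "U n = cbox (fst (R ! n)) (snd (R ! n))" using True by (simp add: U_def)
    then have "diameter (U n) = dist (fst (R ! n)) (snd (R ! n))"
      using True diameter_cbox_nonempty[of "fst (R ! n)" "snd (R ! n)"] by metis
    then show ?thesis using Rn[of n] True assms(2) by (auto simp: U_def)
  next
    case False
    then have "U n = {}" by (auto simp: U_def)
    then show ?thesis using assms(4) by simp
  qed
  ultimately have "hausdorff_premeasure s \<delta> S \<le> (\<Sum>n. diam_powr s (U n))"
    unfolding hausdorff_premeasure_def by (intro INF_lower) auto
  also have "\<dots> = (\<Sum>n<length R. diam_powr s (U n))"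
    by (rule suminf_finite) (auto simp: U_def diam_powr_def)
  also have "\<dots> \<le> (\<Sum>n<length R. ennreal (d powr (s - 1) * dist (fst (R ! n)) (snd (R ! n))))"
    by (rule sum_mono) (auto simp: U_def intro!: diam_powr_cbox_le Rn assms)
  also have "\<dots> = ennreal (d powr (s - 1) * (\<Sum>n<length R. dist (fst (R ! n)) (snd (R ! n))))"
    by (subst sum_ennreal) (auto simp: sum_distrib_left)
  also have "(\<Sum>n<length R. dist (fst (R ! n)) (snd (R ! n))) = (\<Sum>(u, v)\<leftarrow>R. dist u v)"
    by (simp add: sum_list_sum_nth case_prod_unfold atLeast0LessThan)
  also have "ennreal (d powr (s - 1) * (\<Sum>(u, v)\<leftarrow>R. dist u v)) \<le> ennreal (d powr (s - 1) * c)"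
    using R(2) by (intro ennreal_leI mult_left_mono) auto
  finally show ?thesis .
qed

lemma hausdorff_measure_1_le:
  assumes cov: "\<And>\<epsilon>. 0 < \<epsilon> \<Longrightarrow> \<exists>N. box_cover N (sqrt 2 + \<epsilon>) \<epsilon> S"
  shows "hausdorff_measure 1 S \<le> ennreal (sqrt 2)"
  unfolding hausdorff_measure_def
proof (rule SUP_least)
  fix \<delta> :: real assume "\<delta> \<in> {0<..}"
  then have \<delta>: "0 < \<delta>" by simp
  show "hausdorff_premeasure 1 \<delta> S \<le> ennreal (sqrt 2)"
  proof (rule ennreal_le_epsilon)
    fix e :: real assume e: "0 < e"
    define d where "d = min e \<delta>"
    have d: "0 < d" "d \<le> \<delta>" "d \<le> e" using e \<delta> by (auto simp: d_def)
    obtain N where "box_cover N (sqrt 2 + d) d S" using cov[OF d(1)] by blast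
    \<comment> \<open>For s = 1 the factor \<open>d powr 0\<close> is 1 because d > 0.\<close>
    from hausdorff_premeasure_box_cover[OF this d(2), of 1]
    have "hausdorff_premeasure 1 \<delta> S \<le> ennreal (sqrt 2 + d)" using d \<delta> by simp
    also have "\<dots> \<le> ennreal (sqrt 2 + e)" using d by (intro ennreal_leI) simp
    also have "\<dots> = ennreal (sqrt 2) + ennreal e" using e by (simp add: ennreal_plus)
    finally show "hausdorff_premeasure 1 \<delta> S \<le> ennreal (sqrt 2) + ennreal e" .
  qed
qed

lemma hausdorff_measure_gt_1_eq_0:
  assumes cov: "\<And>\<epsilon>. 0 < \<epsilon> \<Longrightarrow> \<exists>N. box_cover N (sqrt 2 + \<epsilon>) \<epsilon> S" and s: "1 < s"
  shows "hausdorff_measure s S = 0"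
proof -
  have "hausdorff_premeasure s \<delta> S \<le> 0" if \<delta>: "\<delta> \<in> {0<..}" for \<delta>
  proof (rule ennreal_le_epsilon)
    fix e :: real assume e: "0 < e"
    \<comment> \<open>Makes \<open>d powr (s - 1)\<close> at most e / 3, to be multiplied by sqrt 2
      + d \<le> 3.\<close>
    define d where "d = min \<delta> (min 1 ((e / 3) powr (1 / (s - 1))))"
    have d: "0 < d" "d \<le> \<delta>" "d \<le> 1" "d \<le> (e / 3) powr (1 / (s - 1))"
      using e \<delta> by (auto simp: d_def)
    have "d powr (s - 1) \<le> ((e / 3) powr (1 / (s - 1))) powr (s - 1)"
      using d s by (intro powr_mono2) auto
    also have "\<dots> = e / 3" using s e by (simp add: powr_powr)
    finally have "d powr (s - 1) * (sqrt 2 + d) \<le> e / 3 * (sqrt 2 + d)"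
      using d by (intro mult_right_mono) auto
    also have "\<dots> \<le> e / 3 * 3"
    proof (intro mult_left_mono)
      have "sqrt 2 \<le> 2" by (rule real_le_lsqrt) auto
      then show "sqrt 2 + d \<le> 3" using d by simp
    qed (use e in simp)
    finally have le: "d powr (s - 1) * (sqrt 2 + d) \<le> e" by simp
    obtain N where "box_cover N (sqrt 2 + d) d S" using cov[OF d(1)] by blast
    from hausdorff_premeasure_box_cover[OF this d(2), of s]
    have "hausdorff_premeasure s \<delta> S \<le> ennreal (d powr (s - 1) * (sqrt 2 + d))" using d s \<delta> by simp
    also have "\<dots> \<le> ennreal e" using le by (rule ennreal_leI)
    finally show "hausdorff_premeasure s \<delta> S \<le> 0 + ennreal e" by simp
  qed
  then have "hausdorff_measure s S \<le> 0" unfolding hausdorff_measure_def by (rule SUP_least)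
  then show ?thesis by simp
qed

text \<open>The sets of a Hausdorff cover are arbitrary, so their projections are replaced by
  interval hulls, which are measurable.\<close>

lemma emeasure_projection_le:
  fixes U :: "(real \<times> real) set"
  assumes U: "bounded U" "U \<noteq> {}"
  defines "J \<equiv> {Inf (fst ` U)..Sup (fst ` U)}"
  shows "fst ` U \<subseteq> J" "emeasure lborel J \<le> ennreal (diameter U)"
proof -
  have b: "bdd_above (fst ` U)" "bdd_below (fst ` U)"
    using bounded_fst[OF U(1)] by (auto simp: bounded_imp_bdd_above bounded_imp_bdd_below)
  show "fst ` U \<subseteq> J"
    unfolding J_def by (intro subsetI atLeastAtMost_iff[THEN iffD2] conjI cInf_lower cSup_upper b)
  have "x - diameter U \<le> y" if xy: "x \<in> fst ` U" "y \<in> fst ` U" for x y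
  proof -
    obtain u v where uv: "u \<in> U" "v \<in> U" "x = fst u" "y = fst v" using xy by blast
    have "\<bar>x - y\<bar> \<le> dist u v" using dist_fst_le[of u v] uv by (simp add: dist_real_def)
    also have "\<dots> \<le> diameter U" using diameter_bounded_bound[OF U(1)] uv by blast
    finally show ?thesis by simp
  qed
  then have "x - diameter U \<le> Inf (fst ` U)" if "x \<in> fst ` U" for x
    using U(2) that by (intro cInf_greatest) auto
  then have "Sup (fst ` U) \<le> Inf (fst ` U) + diameter U"
    using U(2) by (intro cSup_least) (auto simp: diff_le_eq)
  moreover have "Inf (fst ` U) \<le> Sup (fst ` U)"
    using U(2) b by (intro cInf_le_cSup) auto
  ultimately show "emeasure lborel J \<le> ennreal (diameter U)"
    unfolding J_def by (simp add: ennreal_leI)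
qed

text \<open>Covers of S project to covers of the unit interval without increasing diameters. At
  scale 1 a diameter is at most its s-th power, so one estimate treats all s \<le> 1.\<close>

lemma hausdorff_measure_le_1_pos:
  assumes S: "fst ` S = {0..1 :: real}" and s: "0 \<le> s" "s \<le> 1"
  shows "hausdorff_measure s (S :: (real \<times> real) set) \<noteq> 0"
proof -
  have "1 \<le> hausdorff_premeasure s 1 S"
    unfolding hausdorff_premeasure_def
  proof (rule INF_greatest)
    fix U :: "nat \<Rightarrow> (real \<times> real) set"
    assume "U \<in> {U. S \<subseteq> (\<Union>n. U n) \<and> (\<forall>n. bounded (U n) \<and> diameter (U n) \<le> 1)}"
    then have U: "S \<subseteq> (\<Union>n. U n)" "\<And>n. bounded (U n)" "\<And>n. diameter (U n) \<le> 1" by auto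
    define J where "J n = (if U n = {} then {} else {Inf (fst ` U n)..Sup (fst ` U n)})" for n
    have J: "fst ` U n \<subseteq> J n" "emeasure lborel (J n) \<le> diam_powr s (U n)" for n
    proof -
      show "fst ` U n \<subseteq> J n" using emeasure_projection_le(1)[OF U(2)[of n]] by (auto simp: J_def)
      show "emeasure lborel (J n) \<le> diam_powr s (U n)"
      proof (cases "U n = {}")
        case False
        have D: "0 \<le> diameter (U n)" using U(2) by (rule diameter_ge_0)
        have "emeasure lborel (J n) \<le> ennreal (diameter (U n))"
          using emeasure_projection_le(2)[OF U(2) False] False by (simp add: J_def)
        also have "\<dots> \<le> diam_powr s (U n)"
        proof (cases "s = 0")
          case True
          then show ?thesis using False U(3)[of n] by (simp add: diam_powr_def)
        next
          case s0: False
          have "diameter (U n) powr 1 \<le> diameter (U n) powr s"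
            using D U(3)[of n] s by (intro powr_mono') auto
          then show ?thesis using False s0 D by (simp add: diam_powr_def ennreal_leI)
        qed
        finally show ?thesis .
      qed (simp add: J_def diam_powr_def)
    qed
    have "1 = emeasure lborel {0..1 :: real}" by simp
    also have "\<dots> \<le> emeasure lborel (\<Union>n. J n)"
    proof (rule emeasure_mono)
      have "{0..1} = fst ` S" using S by simp
      also have "\<dots> \<subseteq> (\<Union>n. fst ` U n)" using U(1) by blast
      also have "\<dots> \<subseteq> (\<Union>n. J n)" using J(1) by blast
      finally show "{0..1} \<subseteq> (\<Union>n. J n)" .
    qed (auto simp: J_def)
    also have "\<dots> \<le> (\<Sum>n. emeasure lborel (J n))"
      by (rule emeasure_subadditive_countably) (auto simp: J_def)
    also have "\<dots> \<le> (\<Sum>n. diam_powr s (U n))" by (intro suminf_le J) auto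
    finally show "1 \<le> (\<Sum>n. diam_powr s (U n))" .
  qed
  also have "\<dots> \<le> hausdorff_measure s S"
    unfolding hausdorff_measure_def by (rule SUP_upper) simp
  finally show ?thesis by auto
qed

lemma hausdorff_dim_eq_1:
  assumes S: "fst ` S = {0..1 :: real}"
    and cov: "\<And>\<epsilon>. 0 < \<epsilon> \<Longrightarrow> \<exists>N. box_cover N (sqrt 2 + \<epsilon>) \<epsilon> S"
  shows "hausdorff_dim S = 1"
proof (rule antisym)
  show "hausdorff_dim S \<le> 1"
  proof (rule ennreal_le_epsilon)
    fix e :: real assume e: "0 < e"
    have "hausdorff_dim S \<le> ennreal (1 + e)"
      unfolding hausdorff_dim_def using hausdorff_measure_gt_1_eq_0[OF cov, of "1 + e"] e
      by (intro INF_lower) auto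
    then show "hausdorff_dim S \<le> 1 + ennreal e" using e by (simp add: ennreal_plus)
  qed
  show "1 \<le> hausdorff_dim S"
    unfolding hausdorff_dim_def
  proof (rule INF_greatest)
    fix s assume "s \<in> {s. 0 \<le> s \<and> hausdorff_measure s S = 0}"
    then have "1 \<le> s" using hausdorff_measure_le_1_pos[OF S, of s] by force
    then show "1 \<le> ennreal s" by (metis ennreal_1 ennreal_leI)
  qed
qed

section \<open>Fibres of the support\<close>

text \<open>Converts a diagonal sum sqrt 2 + \<epsilon> into a bound 2 + sqrt 2 \<epsilon> for all
  widths and heights together.\<close>

lemma coordinate_sum_le_dist:
  fixes u v :: "real \<times> real"
  shows "\<bar>fst u - fst v\<bar> + \<bar>snd u - snd v\<bar> \<le> sqrt 2 * dist u v"
proof (rule power2_le_imp_le)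
  let ?a = "\<bar>fst u - fst v\<bar>" and ?b = "\<bar>snd u - snd v\<bar>"
  have "(dist u v)\<^sup>2 = ?a\<^sup>2 + ?b\<^sup>2" by (simp add: dist_prod_def dist_real_def)
  moreover have "(?a + ?b)\<^sup>2 \<le> 2 * (?a\<^sup>2 + ?b\<^sup>2)"
  proof -
    have "(?a + ?b)\<^sup>2 = 2 * (?a\<^sup>2 + ?b\<^sup>2) - (?a - ?b)\<^sup>2"
      by (simp only: power2_eq_square algebra_simps)
    then show ?thesis by simp
  qed
  ultimately show "(?a + ?b)\<^sup>2 \<le> (sqrt 2 * dist u v)\<^sup>2"
    by (simp add: power_mult_distrib)
qed simp

lemma integrable_indicator_unit:
  fixes W :: "real set"
  assumes "W \<in> sets borel" "W \<subseteq> {0..1}"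
  shows "integrable lborel (indicat_real W)"
proof (rule integrable_real_indicator)
  have "emeasure lborel W \<le> emeasure lborel {0..1 :: real}" using assms by (intro emeasure_mono) auto
  also have "\<dots> < \<infinity>" by simp
  finally show "emeasure lborel W < \<infinity>" .
qed (use assms in simp)

text \<open>A cover by boxes whose diagonals sum to little more than \<open>sqrt 2\<close> covers almost every
  vertical line by one box only, since both its widths and its heights sum to at least \<open>1\<close>.\<close>

lemma small_set_of_thick_fibres:
  assumes S: "fst ` S = {0..1 :: real}" "snd ` S = {0..1 :: real}"
    and cov: "box_cover N (sqrt 2 + \<epsilon>) \<epsilon> S" and c: "c = fst \<or> c = snd"
  shows "\<exists>W\<in>sets borel. W \<subseteq> {0..1} \<and> measure lborel W \<le> sqrt 2 * \<epsilon> \<and>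
    (\<forall>u\<in>S. \<forall>v\<in>S. c u = c v \<longrightarrow> \<epsilon> < dist u v \<longrightarrow> c u \<in> W)"
proof -
  obtain R where R: "length R \<le> N" "(\<Sum>(u, v)\<leftarrow>R. dist u v) \<le> sqrt 2 + \<epsilon>"
    "\<forall>(u, v)\<in>set R. dist u v \<le> \<epsilon>" "S \<subseteq> (\<Union>(u, v)\<in>set R. cbox u v)"
    using cov unfolding box_cover_def by blast
  let ?n = "length R"
  define A where "A i = fst (R ! i)" for i
  define B where "B i = snd (R ! i)" for i
  have AB: "dist (A i) (B i) \<le> \<epsilon>" if "i < ?n" for i
    using R(3) nth_mem[OF that] by (auto simp: A_def B_def case_prod_unfold)
  have sum: "(\<Sum>i<?n. dist (A i) (B i)) \<le> sqrt 2 + \<epsilon>"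
    using R(2) by (simp add: sum_list_sum_nth case_prod_unfold atLeast0LessThan A_def B_def)
  have ex: "\<exists>i<?n. u \<in> cbox (A i) (B i)" if "u \<in> S" for u
  proof -
    obtain w where "w \<in> set R" "u \<in> cbox (fst w) (snd w)" using R(4) \<open>u \<in> S\<close> by (auto simp: case_prod_unfold)
    then show ?thesis unfolding A_def B_def by (metis in_set_conv_nth)
  qed
  define I where "I d i = {d (A i)..d (B i)} \<inter> {0..1}" for d :: "real \<times> real \<Rightarrow> real" and i
  have I: "I d i \<in> sets borel" "measure lborel (I d i) \<le> \<bar>d (A i) - d (B i)\<bar>" for d i
  proof -
    show "I d i \<in> sets borel" by (simp add: I_def)
    have "measure lborel (I d i) \<le> measure lborel {d (A i)..d (B i)}"
      unfolding I_def by (intro measure_mono_fmeasurable) (auto intro: fmeasurable_compact)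
    then show "measure lborel (I d i) \<le> \<bar>d (A i) - d (B i)\<bar>" by (auto split: if_splits)
  qed
  have intI: "integrable lborel (indicat_real (I d i))" for d i
    by (rule integrable_indicator_unit) (auto simp: I_def)
  have memI: "d u \<in> I d i" if "u \<in> S" "u \<in> cbox (A i) (B i)" "d = fst \<or> d = snd" for u i d
  proof -
    have "d u \<in> {0..1}" using S that by auto
    then show ?thesis using that(2,3)
      by (cases "A i"; cases "B i"; cases u) (auto simp: I_def cbox_Pair_eq)
  qed
  \<comment> \<open>The projected boxes cover the unit interval once and W at least twice; integrate
    the number of boxes over each coordinate.\<close>
  have key: "measure lborel W + 1 \<le> (\<Sum>i<?n. \<bar>d (A i) - d (B i)\<bar>)"
    if "W \<in> sets borel" "W \<subseteq> {0..1}" "\<And>x. x \<in> W \<Longrightarrow> 2 \<le> (\<Sum>i<?n. indicat_real (I d i) x)" "d = fst \<or> d = snd" for W d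
  proof -
    have W: "integrable lborel (indicat_real W)"
      by (rule integrable_indicator_unit[OF that(1,2)])
    have one: "integrable lborel (indicat_real {0..1 :: real})" by (rule integrable_indicator_unit) auto
    have "measure lborel W + 1 = (LINT x|lborel. indicat_real W x + indicat_real {0..1} x)"
      using W one by simp
    also have "\<dots> \<le> (LINT x|lborel. (\<Sum>i<?n. indicat_real (I d i) x))"
    proof (rule integral_mono)
      fix x :: real
      have nn: "0 \<le> (\<Sum>i<?n. indicat_real (I d i) x)" by (intro sum_nonneg) auto
      have "1 \<le> (\<Sum>i<?n. indicat_real (I d i) x)" if "x \<in> {0..1}"
      proof -
        have "x \<in> d ` S" using S \<open>d = fst \<or> d = snd\<close> that by auto
        then obtain u where u: "u \<in> S" "x = d u" by blast
        obtain i where i: "i < ?n" "u \<in> cbox (A i) (B i)" using ex[OF u(1)] by blast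
        have "1 = indicat_real (I d i) x" using memI[OF u(1) i(2) \<open>d = fst \<or> d = snd\<close>] u(2) by simp
        also have "\<dots> \<le> (\<Sum>i<?n. indicat_real (I d i) x)" by (rule member_le_sum) (use i in auto)
        finally show ?thesis .
      qed
      then show "indicat_real W x + indicat_real {0..1} x \<le> (\<Sum>i<?n. indicat_real (I d i) x)"
        using that(2,3) nn by (auto simp: indicator_def split: if_splits)
    qed (use W one intI in auto)
    also have "\<dots> = (\<Sum>i<?n. measure lborel (I d i))" using intI by simp
    also have "\<dots> \<le> (\<Sum>i<?n. \<bar>d (A i) - d (B i)\<bar>)" by (intro sum_mono I)
    finally show ?thesis .
  qed
  have tot: "(\<Sum>i<?n. \<bar>fst (A i) - fst (B i)\<bar>) + (\<Sum>i<?n. \<bar>snd (A i) - snd (B i)\<bar>) \<le> 2 + sqrt 2 * \<epsilon>"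
  proof -
    have "(\<Sum>i<?n. \<bar>fst (A i) - fst (B i)\<bar>) + (\<Sum>i<?n. \<bar>snd (A i) - snd (B i)\<bar>) \<le> (\<Sum>i<?n. sqrt 2 * dist (A i) (B i))"
      unfolding sum.distrib[symmetric] by (intro sum_mono coordinate_sum_le_dist)
    also have "\<dots> \<le> sqrt 2 * (sqrt 2 + \<epsilon>)"
      unfolding sum_distrib_left[symmetric] by (intro mult_left_mono sum) simp
    also have "\<dots> = 2 + sqrt 2 * \<epsilon>" by (simp add: distrib_left)
    finally show ?thesis .
  qed
  \<comment> \<open>With W empty, \<open>key\<close> bounds both the widths and the heights below by
    1, so neither sum can exceed 1 + sqrt 2 \<epsilon>.\<close>
  have "1 \<le> (\<Sum>i<?n. \<bar>d (A i) - d (B i)\<bar>)" if "d = fst \<or> d = snd" for d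
    using key[of "{}" d] that by simp
  from this[of fst] this[of snd] tot c
  have le: "(\<Sum>i<?n. \<bar>c (A i) - c (B i)\<bar>) \<le> 1 + sqrt 2 * \<epsilon>" by auto
  define W where "W = {x \<in> {0..1}. 2 \<le> (\<Sum>i<?n. indicat_real (I c i) x)}"
  have Wsets: "W \<in> sets borel"
  proof -
    have "(\<lambda>x. \<Sum>i<?n. indicat_real (I c i) x) \<in> borel_measurable borel"
      using I(1) by (intro borel_measurable_sum borel_measurable_indicator)
    then have "{x \<in> space borel. 2 \<le> (\<Sum>i<?n. indicat_real (I c i) x)} \<in> sets borel"
      by (intro borel_measurable_le) auto
    moreover have "W = {0..1} \<inter> {x \<in> space borel. 2 \<le> (\<Sum>i<?n. indicat_real (I c i) x)}"
      by (auto simp: W_def)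
    ultimately show ?thesis by simp
  qed
  have "measure lborel W \<le> sqrt 2 * \<epsilon>"
  proof -
    have "W \<subseteq> {0..1}" "\<And>x. x \<in> W \<Longrightarrow> 2 \<le> (\<Sum>i<?n. indicat_real (I c i) x)"
      unfolding W_def by blast+
    from key[OF Wsets this c] show ?thesis using le by linarith
  qed
  moreover have "c u \<in> W" if uv: "u \<in> S" "v \<in> S" "c u = c v" "\<epsilon> < dist u v" for u v
  proof -
    obtain i where i: "i < ?n" "u \<in> cbox (A i) (B i)" using ex[OF uv(1)] by blast
    obtain j where j: "j < ?n" "v \<in> cbox (A j) (B j)" using ex[OF uv(2)] by blast
    \<comment> \<open>Points more than \<epsilon> apart cannot share a box, so their common
      coordinate is counted twice.\<close>
    have "i \<noteq> j"
    proof
      assume "i = j"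
      then have "dist u v \<le> diameter (cbox (A i) (B i))"
        using i j by (intro diameter_bounded_bound) auto
      also have "\<dots> = dist (A i) (B i)"
        using i(2) by (intro diameter_cbox_nonempty) blast
      finally show False using AB[OF i(1)] uv(4) by simp
    qed
    have "2 = (\<Sum>l\<in>{i, j}. indicat_real (I c l) (c u))"
      using \<open>i \<noteq> j\<close> memI[OF uv(1) i(2) c] memI[OF uv(2) j(2) c] uv(3) by simp
    also have "\<dots> \<le> (\<Sum>l<?n. indicat_real (I c l) (c u))"
      by (rule sum_mono2) (use i j in auto)
    finally show ?thesis using S c uv(1) by (auto simp: W_def)
  qed
  moreover have "W \<subseteq> {0..1}" by (auto simp: W_def)
  ultimately show ?thesis using Wsets by blast
qed

text \<open>Fibres with two points more than 1 / (n + 1) apart form a null set for each n, since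
  finer covers enclose their coordinates in arbitrarily small sets.\<close>

lemma AE_singleton_fibre:
  assumes \<nu>: "\<nu> \<in> permutons" and c: "c = fst \<or> c = snd"
    and cov: "\<And>\<epsilon>. 0 < \<epsilon> \<Longrightarrow> \<exists>N. box_cover N (sqrt 2 + \<epsilon>) \<epsilon> (measure_support \<nu>)"
  shows "AE u in \<nu>. u \<in> measure_support \<nu> \<and> (\<forall>v\<in>measure_support \<nu>. c v = c u \<longrightarrow> v = u)"
proof -
  note p = permutonsD[OF \<nu>]
  interpret prob_space \<nu> by (rule p)
  let ?S = "measure_support \<nu>"
  have S: "fst ` ?S = {0..1}" "snd ` ?S = {0..1}" using coordinate_measure_support[OF \<nu>] by auto
  have "AE u in \<nu>. \<not> (u \<in> ?S \<and> (\<exists>v\<in>?S. c v = c u \<and> 1 / real (Suc n) < dist u v))" for n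
  proof (rule AE_if_small_exception)
    fix e :: real assume e: "0 < e"
    define d where "d = min (1 / real (Suc n)) (e / sqrt 2)"
    have d: "0 < d" "d \<le> 1 / real (Suc n)" "sqrt 2 * d \<le> e"
    proof -
      have "d \<le> e / sqrt 2" by (simp add: d_def)
      then show "sqrt 2 * d \<le> e" by (simp add: field_simps)
    qed (use e in \<open>auto simp: d_def\<close>)
    obtain N where N: "box_cover N (sqrt 2 + d) d ?S" using cov[OF d(1)] by blast
    obtain W where W: "W \<in> sets borel" "W \<subseteq> {0..1}" "measure lborel W \<le> sqrt 2 * d"
      "\<And>u v. u \<in> ?S \<Longrightarrow> v \<in> ?S \<Longrightarrow> c u = c v \<Longrightarrow> d < dist u v \<Longrightarrow> c u \<in> W"
      using small_set_of_thick_fibres[OF S N c] by blast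
    have "prob {u. c u \<in> W} = measure lborel W"
      using measure_coordinate(2)[OF \<nu> c W(1)] W(2) by (simp add: Int_absorb1)
    then have "prob {u. c u \<in> W} \<le> e" using W(3) d(3) by simp
    moreover have "{u. c u \<in> W} \<in> events" using measure_coordinate(1)[OF \<nu> c W(1)] p(1) by simp
    moreover have "u \<in> {u. c u \<in> W}"
      if bad: "\<not> \<not> (u \<in> ?S \<and> (\<exists>v\<in>?S. c v = c u \<and> 1 / real (Suc n) < dist u v))" for u
    proof -
      obtain v where "u \<in> ?S" "v \<in> ?S" "c v = c u" "1 / real (Suc n) < dist u v" using bad by blast
      then show ?thesis using W(4)[of u v] d(2) by auto
    qed
    ultimately show "\<exists>B\<in>events. prob B \<le> e \<and> (\<forall>u\<in>space \<nu>.
        \<not> \<not> (u \<in> ?S \<and> (\<exists>v\<in>?S. c v = c u \<and> 1 / real (Suc n) < dist u v)) \<longrightarrow> u \<in> B)" by blast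
  qed
  then have "AE u in \<nu>. \<forall>n. \<not> (u \<in> ?S \<and> (\<exists>v\<in>?S. c v = c u \<and> 1 / real (Suc n) < dist u v))"
    unfolding AE_all_countable by blast
  with AE_measure_support[OF p(1)] show ?thesis
  proof eventually_elim
    case (elim u)
    have "v = u" if v: "v \<in> ?S" "c v = c u" for v
    proof (rule ccontr)
      assume "v \<noteq> u"
      then have "0 < dist u v" by auto
      then obtain n where "1 / real (Suc n) < dist u v"
        using reals_Archimedean[of "dist u v"] by (auto simp: inverse_eq_divide)
      then show False using elim v by blast
    qed
    then show ?case using elim by blast
  qed
qed

section \<open>Total disconnectedness\<close>

text \<open>The quadrant with corner \<open>(fst p, snd q)\<close> not containing \<open>p\<close> and \<open>q\<close> is relatively
  clopen, because its boundary lines meet \<open>S\<close> only at \<open>p\<close> and at \<open>q\<close>.  The signs \<open>s\<close> and \<open>t\<close>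
  select one of the four kinds of quadrants.\<close>

lemma no_separated_triple:
  fixes s t :: real
  assumes "connected C" "C \<subseteq> S" "s = 1 \<or> s = - 1" "t = 1 \<or> t = - 1"
    and p: "p \<in> C" "\<And>v. v \<in> S \<Longrightarrow> fst v = fst p \<Longrightarrow> v = p"
    and q: "\<And>v. v \<in> S \<Longrightarrow> snd v = snd q \<Longrightarrow> v = q"
    and z: "z \<in> C" "s * fst z < s * fst p" "t * snd q < t * snd z"
    and pq: "s * fst p < s * fst q" "t * snd p < t * snd q"
  shows False
proof -
  define A where "A = {u :: real \<times> real. s * fst u \<le> s * fst p} \<inter> {u. t * snd q \<le> t * snd u}"
  define B where "B = {u :: real \<times> real. s * fst p \<le> s * fst u} \<union> {u. t * snd u \<le> t * snd q}"
  have "closed A" "closed B"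
    unfolding A_def B_def by (intro closed_Int closed_Un closed_Collect_le continuous_intros)+
  moreover have "C \<subseteq> A \<union> B" unfolding A_def B_def by auto
  moreover have "A \<inter> B \<inter> C = {}"
  proof -
    have "u \<notin> C" if uAB: "u \<in> A" "u \<in> B" for u
    proof
      assume "u \<in> C"
      then have "u \<in> S" using assms(2) by blast
      consider "s * fst u = s * fst p" "t * snd q \<le> t * snd u" | "t * snd u = t * snd q" "s * fst u \<le> s * fst p"
        using uAB unfolding A_def B_def by fastforce
      then show False
      proof cases
        case 1
        then have "fst u = fst p" using assms(3) by auto
        then show False using p(2)[OF \<open>u \<in> S\<close>] 1 pq by auto
      next
        case 2
        then have "snd u = snd q" using assms(4) by auto
        then show False using q[OF \<open>u \<in> S\<close>] 2 pq by auto
      qed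
    qed
    then show ?thesis by blast
  qed
  moreover have "z \<in> A \<inter> C" "p \<in> B \<inter> C" using z p pq by (auto simp: A_def B_def)
  ultimately show False using assms(1) unfolding connected_closed by blast
qed

text \<open>The four sign choices are the patterns 312, 132, 213 and 231. So any three points of H
  with distinct coordinates form an increasing or a decreasing triple.\<close>

definition no_quadrant_triple :: "(real \<times> real) set \<Rightarrow> bool" where
  "no_quadrant_triple H \<longleftrightarrow> (\<forall>s\<in>{1, - 1 :: real}. \<forall>t\<in>{1, - 1 :: real}. \<forall>z\<in>H. \<forall>p\<in>H. \<forall>q\<in>H.
     \<not> (s * fst z < s * fst p \<and> s * fst p < s * fst q \<and> t * snd p < t * snd q \<and> t * snd q < t * snd z))"

lemma no_quadrant_tripleD:
  assumes "no_quadrant_triple H" "z \<in> H" "p \<in> H" "q \<in> H"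
  shows "\<not> (fst z < fst p \<and> fst p < fst q \<and> snd p < snd q \<and> snd q < snd z)"
    "\<not> (fst z < fst p \<and> fst p < fst q \<and> snd q < snd p \<and> snd z < snd q)"
    "\<not> (fst p < fst z \<and> fst q < fst p \<and> snd p < snd q \<and> snd q < snd z)"
    "\<not> (fst p < fst z \<and> fst q < fst p \<and> snd q < snd p \<and> snd z < snd q)"
proof -
  have *: "\<not> (s * fst z < s * fst p \<and> s * fst p < s * fst q \<and> t * snd p < t * snd q \<and> t * snd q < t * snd z)"
    if "s \<in> {1, - 1}" "t \<in> {1, - 1}" for s t :: real
    using assms that unfolding no_quadrant_triple_def by blast
  show "\<not> (fst z < fst p \<and> fst p < fst q \<and> snd p < snd q \<and> snd q < snd z)"
    using *[of 1 1] by simp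
  show "\<not> (fst z < fst p \<and> fst p < fst q \<and> snd q < snd p \<and> snd z < snd q)"
    using *[of 1 "- 1"] by simp
  show "\<not> (fst p < fst z \<and> fst q < fst p \<and> snd p < snd q \<and> snd q < snd z)"
    using *[of "- 1" 1] by simp
  show "\<not> (fst p < fst z \<and> fst q < fst p \<and> snd q < snd p \<and> snd z < snd q)"
    using *[of "- 1" "- 1"] by simp
qed

definition concordant :: "real \<times> real \<Rightarrow> real \<times> real \<Rightarrow> bool" where
  "concordant u v \<longleftrightarrow> (fst u < fst v \<and> snd u < snd v) \<or> (fst v < fst u \<and> snd v < snd u)"

lemma concordant_sym: "concordant u v \<longleftrightarrow> concordant v u"
  by (auto simp: concordant_def)

text \<open>With an increasing pair present, the pattern 321 is impossible too, and only 123
  remains.\<close>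

lemma concordant_third:
  assumes no: "no_quadrant_triple H"
    and H: "u \<in> H" "v \<in> H" "w \<in> H"
    and ne: "fst w \<noteq> fst u" "fst w \<noteq> fst v" "snd w \<noteq> snd u" "snd w \<noteq> snd v"
    and uv: "fst u < fst v" "snd u < snd v"
  shows "concordant u w \<and> concordant v w"
proof -
  note n = no_quadrant_tripleD[OF no]
  consider "fst w < fst u" | "fst u < fst w" "fst w < fst v" | "fst v < fst w" using ne by linarith
  then show ?thesis
  proof cases
    case 1
    have "\<not> snd v < snd w" using n(1)[OF H(3,1,2)] 1 uv by blast
    moreover have "\<not> (snd u < snd w \<and> snd w < snd v)" using n(3)[OF H(2,1,3)] 1 uv by blast
    ultimately show ?thesis using 1 uv ne unfolding concordant_def by linarith
  next
    case 2
    have "\<not> snd v < snd w" using n(2)[OF H(1,3,2)] 2 uv by blast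
    moreover have "\<not> snd w < snd u" using n(3)[OF H(2,3,1)] 2 uv by blast
    ultimately show ?thesis using 2 uv ne unfolding concordant_def by linarith
  next
    case 3
    have "\<not> snd w < snd u" using n(4)[OF H(3,2,1)] 3 uv by blast
    moreover have "\<not> (snd u < snd w \<and> snd w < snd v)" using n(2)[OF H(1,2,3)] 3 uv by blast
    ultimately show ?thesis using 3 uv ne unfolding concordant_def by linarith
  qed
qed

text \<open>The points of a concordant pair can be exchanged one at a time by
  \<open>concordant_third\<close>.\<close>

lemma all_or_none_concordant:
  assumes no: "no_quadrant_triple H"
    and inj: "\<And>u v. u \<in> H \<Longrightarrow> v \<in> H \<Longrightarrow> u \<noteq> v \<Longrightarrow> fst u \<noteq> fst v \<and> snd u \<noteq> snd v"
    and uv: "u \<in> H" "v \<in> H" "concordant u v" and ww: "w \<in> H" "w' \<in> H" "w \<noteq> w'"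
  shows "concordant w w'"
proof -
  have third: "concordant u w" if "u \<in> H" "v \<in> H" "concordant u v" "w \<in> H" "w \<noteq> u" for u v w
  proof (cases "w = v")
    case False
    then have ne: "fst w \<noteq> fst u" "fst w \<noteq> fst v" "snd w \<noteq> snd u" "snd w \<noteq> snd v"
      using inj that by blast+
    from that(3) consider "fst u < fst v" "snd u < snd v" | "fst v < fst u" "snd v < snd u"
      unfolding concordant_def by blast
    then show ?thesis
    proof cases
      case 1
      from concordant_third[OF no that(1,2,4) ne 1] show ?thesis by blast
    next
      case 2
      from concordant_third[OF no that(2,1,4) ne(2,1,4,3) 2] show ?thesis by blast
    qed
  qed (use that in simp)
  show ?thesis
  proof (cases "w = u")
    case True
    then show ?thesis using third[OF uv] ww by blast
  next
    case False
    then have "concordant w u" using third[OF uv ww(1)] concordant_sym by blast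
    then show ?thesis using third[OF ww(1) uv(1) _ ww(2)] ww(3) by blast
  qed
qed

lemma totally_disconnected_support:
  assumes \<nu>: "\<nu> \<in> permutons"
    and cov: "\<And>\<epsilon>. 0 < \<epsilon> \<Longrightarrow> \<exists>N. box_cover N (sqrt 2 + \<epsilon>) \<epsilon> (measure_support \<nu>)"
    and strip: "\<And>a c b. a \<in> \<rat> \<Longrightarrow> c \<in> \<rat> \<Longrightarrow> 0 \<le> a \<Longrightarrow> a < c \<Longrightarrow> c \<le> 1 \<Longrightarrow> \<not> monotone_strip b a c \<nu>"
  shows "totally_disconnected (measure_support \<nu>)"
proof -
  note p = permutonsD[OF \<nu>]
  interpret prob_space \<nu> by (rule p)
  let ?S = "measure_support \<nu>"
  define G where "G = {u \<in> ?S. (\<forall>v\<in>?S. fst v = fst u \<longrightarrow> v = u) \<and> (\<forall>v\<in>?S. snd v = snd u \<longrightarrow> v = u)}"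
  have "AE u in \<nu>. u \<in> ?S \<and> (\<forall>v\<in>?S. c v = c u \<longrightarrow> v = u)" if "c = fst \<or> c = snd" for c
    by (rule AE_singleton_fibre[OF \<nu> that cov])
  from this[of fst] this[of snd] have "AE u in \<nu>. u \<in> ?S \<and> (\<forall>v\<in>?S. fst v = fst u \<longrightarrow> v = u)"
    "AE u in \<nu>. u \<in> ?S \<and> (\<forall>v\<in>?S. snd v = snd u \<longrightarrow> v = u)" by blast+
  then have G: "AE u in \<nu>. u \<in> G" by eventually_elim (auto simp: G_def)
  have Gf: "v = u" if "u \<in> G" "v \<in> ?S" "fst v = fst u \<or> snd v = snd u" for u v
    using that by (auto simp: G_def)
  have GS: "G \<subseteq> ?S" by (auto simp: G_def)
  have one: False if C: "connected C" "C \<subseteq> ?S" and zw: "z \<in> C" "w \<in> C" "fst z < fst w" for C z w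
  proof -
    have 01: "0 \<le> fst z" "fst w \<le> 1" using measure_support_subset[OF \<nu>] C zw by (auto simp: mem_Times_iff)
    \<comment> \<open>Rational endpoints, because strips are excluded almost surely only countably
      many at a time.\<close>
    obtain a where a: "a \<in> \<rat>" "fst z < a" "a < fst w" using Rats_dense_in_real[OF zw(3)] by blast
    obtain c where c: "c \<in> \<rat>" "a < c" "c < fst w" using Rats_dense_in_real[OF a(3)] by blast
    define H where "H = {u \<in> G. a < fst u \<and> fst u < c}"
    have "connected (fst ` C)" by (intro connected_continuous_image C continuous_intros)
    then have "{fst z..fst w} \<subseteq> fst ` C" using zw by (intro connected_contains_Icc) auto
    \<comment> \<open>C meets the vertical line through u, on which u is the only point of the
      support.\<close>
    then have HC: "u \<in> C" if "u \<in> H" for u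
    proof -
      assume sub: "{fst z..fst w} \<subseteq> fst ` C"
      have "fst u \<in> {fst z..fst w}" using that a c by (auto simp: H_def)
      then obtain v where "v \<in> C" "fst v = fst u" using sub by (metis imageE subsetD)
      then have "v = u" using Gf[of u v] that C by (auto simp: H_def)
      then show ?thesis using \<open>v \<in> C\<close> by simp
    qed
    have HG: "u \<in> G" if "u \<in> H" for u using that by (simp add: H_def)
    have "\<not> (s * fst z < s * fst p \<and> s * fst p < s * fst q \<and> t * snd p < t * snd q \<and> t * snd q < t * snd z)"
      if "s = 1 \<or> s = - 1" "t = 1 \<or> t = - 1" "z \<in> H" "p \<in> H" "q \<in> H" for s t :: real and z p q
      using no_separated_triple[OF C that(1,2), of p q z] that(3-5) HC HG Gf by blast
    then have no: "no_quadrant_triple H" unfolding no_quadrant_triple_def by blast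
    have inj: "fst u \<noteq> fst v \<and> snd u \<noteq> snd v" if "u \<in> H" "v \<in> H" "u \<noteq> v" for u v
    proof -
      have "u \<in> G" "v \<in> ?S" using HG[OF that(1)] HG[OF that(2)] GS by auto
      then have "\<not> (fst v = fst u \<or> snd v = snd u)" using Gf[of u v] that(3) by metis
      then show ?thesis by auto
    qed
    \<comment> \<open>One concordant pair makes all pairs of H concordant; otherwise every pair
      descends.\<close>
    define b where "b \<longleftrightarrow> (\<exists>u\<in>H. \<exists>v\<in>H. concordant u v)"
    have "(snd u < snd v) = b" if "u \<in> G" "v \<in> G" "a < fst u" "fst u < fst v" "fst v < c" for u v
    proof -
      have H: "u \<in> H" "v \<in> H" "u \<noteq> v" using that by (auto simp: H_def)
      have "concordant u v \<longleftrightarrow> snd u < snd v" using that(4) by (auto simp: concordant_def)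
      moreover have "concordant u v \<longleftrightarrow> b"
      proof
        assume b
        then obtain u' v' where uv': "u' \<in> H" "v' \<in> H" "concordant u' v'" unfolding b_def by blast
        show "concordant u v" by (rule all_or_none_concordant[OF no inj uv' H])
      qed (use H in \<open>auto simp: b_def\<close>)
      ultimately show ?thesis by simp
    qed
    then have "monotone_strip b a c \<nu>" unfolding monotone_strip_def using G by blast
    then show False using strip[OF a(1) c(1) _ c(2)] a c 01 by simp
  qed
  have "x = y" if C: "connected C" "C \<subseteq> ?S" and xy: "x \<in> C" "y \<in> C" for C x y
  proof (rule ccontr)
    assume ne: "x \<noteq> y"
    \<comment> \<open>By \<open>one\<close>, C lies on a single vertical line.\<close>
    have same: "fst u = fst x" if "u \<in> C" for u
      using one[OF C that xy(1)] one[OF C xy(1) that] by (meson linorder_neqE)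
    then have "snd x \<noteq> snd y" using ne xy by (metis prod_eq_iff)
    then obtain a c where ac: "a < c" "a \<in> snd ` C" "c \<in> snd ` C" using xy by (meson imageI linorder_neqE)
    have "connected (snd ` C)" by (intro connected_continuous_image C continuous_intros)
    then have sub: "{a..c} \<subseteq> snd ` C" using ac by (intro connected_contains_Icc) auto
    \<comment> \<open>Typical points at heights between a and c would belong to C, hence to a
      vertical line of measure 0, although the horizontal strip has measure c - a.\<close>
    have "AE u in \<nu>. fst u \<noteq> fst x"
    proof -
      have "prob {u. fst u \<in> {fst x}} = measure lborel ({0..1} \<inter> {fst x})"
        by (rule measure_coordinate[OF \<nu>]) auto
      also have "\<dots> = 0" 
        by (cases "fst x \<in> {0..1}") auto
      finally have "emeasure \<nu> {u. fst u \<in> {fst x}} = 0" by (simp add: emeasure_eq_measure)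
      moreover have "{u. fst u \<in> {fst x}} \<in> events"
        using measure_coordinate(1)[OF \<nu>, of fst "{fst x}"] p(1) by simp
      ultimately have "{u. fst u \<in> {fst x}} \<in> null_sets \<nu>" by blast
      from AE_not_in[OF this] show ?thesis by simp
    qed
    with G have "AE u in \<nu>. u \<notin> {u. snd u \<in> {a..c}}"
    proof eventually_elim
      case (elim u)
      show ?case
      proof
        assume "u \<in> {u. snd u \<in> {a..c}}"
        then obtain v where v: "v \<in> C" "snd v = snd u" using sub by (metis imageE mem_Collect_eq subsetD)
        then have "v = u" using Gf[of u v] elim C by blast
        then show False using same[OF v(1)] elim by simp
      qed
    qed
    then have "prob {u. snd u \<in> {a..c}} = 0" by (rule measure_eq_0_if_AE)
    moreover have "prob {u. snd u \<in> {a..c}} = measure lborel ({0..1} \<inter> {a..c})"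
      by (rule measure_coordinate[OF \<nu>]) auto
    moreover have "{0..1} \<inter> {a..c} = {a..c}"
      using ac C measure_support_subset[OF \<nu>] by fastforce
    ultimately have "measure lborel {a..c} = 0" by metis
    then show False using ac by simp
  qed
  note single = this
  show ?thesis unfolding totally_disconnected_def
  proof
    fix x assume "x \<in> ?S"
    then have x: "x \<in> connected_component_set ?S x" by simp
    have "y = x" if "y \<in> connected_component_set ?S x" for y
      by (rule single[OF connected_connected_component connected_component_subset that x])
    then show "connected_component_set ?S x = {x}" using x by blast
  qed
qed

theorem theorem1p5:
  fixes p :: real
    and M :: "'w measure"
    and \<mu> :: "'w \<Rightarrow> (real \<times> real) measure"
  assumes "0 < p" and "p < 1"
    and "brownian_separable_permuton p M \<mu>"
  shows "AE \<omega> in M.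
           totally_disconnected (measure_support (\<mu> \<omega>)) \<and>
           hausdorff_dim (measure_support (\<mu> \<omega>)) = 1 \<and>
           hausdorff_measure 1 (measure_support (\<mu> \<omega>)) \<le> ennreal (sqrt 2)"
proof -
  have \<mu>: "random_permuton M \<mu>" using assms by (simp add: brownian_separable_permuton_def)
  define Q where "Q = {(a, c, b :: bool). a \<in> \<rat> \<and> c \<in> \<rat> \<and> 0 \<le> a \<and> a < c \<and> c \<le> (1 :: real)}"
  have Q: "countable Q"
    by (rule countable_subset[of _ "\<rat> \<times> \<rat> \<times> UNIV"]) (auto simp: Q_def countable_rat)
  \<comment> \<open>Countably many scales and rational strips, so that the exceptional null sets can
    be united.\<close>
  have "AE \<omega> in M. \<forall>n. \<exists>N. box_cover N (sqrt 2 + 1 / real (Suc n)) (1 / real (Suc n)) (measure_support (\<mu> \<omega>))"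
    unfolding AE_all_countable by (intro allI AE_box_cover_support[OF assms(3)]) simp
  moreover have "AE \<omega> in M. \<forall>(a, c, b)\<in>Q. \<not> monotone_strip b a c (\<mu> \<omega>)"
    unfolding AE_ball_countable[OF Q] case_prod_unfold
    by (intro ballI AE_not_monotone_strip[OF assms(3,1,2)]) (auto simp: Q_def)
  moreover have "AE \<omega> in M. \<omega> \<in> space M" by (rule AE_space)
  ultimately show ?thesis
  proof eventually_elim
    case (elim \<omega>)
    have \<nu>: "\<mu> \<omega> \<in> permutons" by (rule random_permuton_space[OF \<mu> elim(3)])
    have cov: "\<exists>N. box_cover N (sqrt 2 + \<epsilon>) \<epsilon> (measure_support (\<mu> \<omega>))" if "0 < \<epsilon>" for \<epsilon>
    proof -
      obtain n where n: "1 / real (Suc n) < \<epsilon>"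
        using reals_Archimedean[OF \<open>0 < \<epsilon>\<close>] by (auto simp: inverse_eq_divide)
      obtain N where "box_cover N (sqrt 2 + 1 / real (Suc n)) (1 / real (Suc n)) (measure_support (\<mu> \<omega>))"
        using elim(1) by blast
      then have "box_cover N (sqrt 2 + \<epsilon>) \<epsilon> (measure_support (\<mu> \<omega>))"
        by (rule box_cover_mono) (use n in auto)
      then show ?thesis ..
    qed
    have "totally_disconnected (measure_support (\<mu> \<omega>))"
      by (rule totally_disconnected_support[OF \<nu> cov]) (use elim(2) in \<open>auto simp: Q_def\<close>)
    then show ?case
      using hausdorff_dim_eq_1[OF coordinate_measure_support[OF \<nu>] cov] hausdorff_measure_1_le[OF cov]
      by blast
  qed
qed

end
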